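(* Let $\iota: R\to A$ be a centrally projective Frobenius extension. Then for every Wakamatsu tilting left $R$-module $T$, the induced $A$-module $A\otimes_R T$ is Wakamatsu tilting.
   Context: All rings are associative with unit; modules are left modules unless otherwise specified. A ring extension $\iota:R\to A$ is a unital ring homomorphism. It is a Frobenius extension if $A$ is finitely generated projective as a left $R$-module and $A\cong\operatorname{Hom}_R(A,R)$ as $A$-$R$-bimodules, where $(af)(x)=f(xa)$ and $(fr)(x)=f(x)r$. A Frobenius extension is centrally projective if ${}_RA_R$ is isomorphic, as an $R$-$R$-bimodule, to a direct summand of $R^n$ for some $n\geq 1$. For an $R$-module $M$, $\operatorname{add}_R(M)$ is the class of direct summands of finite direct sums of copies of $M$. An $R$-module $T$ is Wakamatsu tilting if: (1) $T$ has a projective resolution by finitely generated projective $R$-modules; (2) $\operatorname{Ext}_R^i(T,T)=0$ for all $i>0$; (3) there is an exact sequence $0\to R\to T_0\to T_1\to T_2\to\cdots$ with each $T_j\in\operatorname{add}_R(T)$ which remains exact after applying $\operatorname{Hom}_R(-,T)$. *)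

theory Defs
  imports "HOL-Algebra.Algebra" "HOL-Library.Poly_Mapping"
begin

section \<open>Left modules over a not necessarily commutative ring\<close>

text \<open>
  The locale \<^locale>\<open>module\<close> of HOL-Algebra is restricted to commutative rings. We keep its record
  type (whose fields \<open>mult\<close> and \<open>one\<close> carry no meaning for modules) and its axioms.
\<close>

locale left_module = R?: ring R + M?: abelian_group M
    for R :: "('r, 'e) ring_scheme" (structure) and M :: "('r, 'm, 'f) module_scheme" (structure) +
  assumes smult_closed [simp, intro]:
      "\<lbrakk>a \<in> carrier R; x \<in> carrier M\<rbrakk> \<Longrightarrow> a \<odot>\<^bsub>M\<^esub> x \<in> carrier M"
    and smult_l_distr:
      "\<lbrakk>a \<in> carrier R; b \<in> carrier R; x \<in> carrier M\<rbrakk> \<Longrightarrow>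
        (a \<oplus> b) \<odot>\<^bsub>M\<^esub> x = a \<odot>\<^bsub>M\<^esub> x \<oplus>\<^bsub>M\<^esub> b \<odot>\<^bsub>M\<^esub> x"
    and smult_r_distr:
      "\<lbrakk>a \<in> carrier R; x \<in> carrier M; y \<in> carrier M\<rbrakk> \<Longrightarrow>
        a \<odot>\<^bsub>M\<^esub> (x \<oplus>\<^bsub>M\<^esub> y) = a \<odot>\<^bsub>M\<^esub> x \<oplus>\<^bsub>M\<^esub> a \<odot>\<^bsub>M\<^esub> y"
    and smult_assoc1:
      "\<lbrakk>a \<in> carrier R; b \<in> carrier R; x \<in> carrier M\<rbrakk> \<Longrightarrow>
        (a \<otimes> b) \<odot>\<^bsub>M\<^esub> x = a \<odot>\<^bsub>M\<^esub> (b \<odot>\<^bsub>M\<^esub> x)"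
    and smult_one [simp]:
      "x \<in> carrier M \<Longrightarrow> \<one> \<odot>\<^bsub>M\<^esub> x = x"

text \<open>
  Homomorphisms are extensional functions, so that the sets \<open>left_hom R M N\<close> are in bijection
  with the usual Hom groups. Composition is \<^const>\<open>compose\<close>.
\<close>

definition left_hom ::
  "('r, 'e) ring_scheme \<Rightarrow> ('r, 'm, 'f) module_scheme \<Rightarrow> ('r, 'n, 'g) module_scheme \<Rightarrow> ('m \<Rightarrow> 'n) set"
  where "left_hom R M N = {f \<in> carrier M \<rightarrow>\<^sub>E carrier N.
    (\<forall>x\<in>carrier M. \<forall>y\<in>carrier M. f (x \<oplus>\<^bsub>M\<^esub> y) = f x \<oplus>\<^bsub>N\<^esub> f y) \<and>
    (\<forall>r\<in>carrier R. \<forall>x\<in>carrier M. f (r \<odot>\<^bsub>M\<^esub> x) = r \<odot>\<^bsub>N\<^esub> f x)}"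

definition zero_hom ::
  "('r, 'm, 'f) module_scheme \<Rightarrow> ('r, 'n, 'g) module_scheme \<Rightarrow> 'm \<Rightarrow> 'n"
  where "zero_hom M N = (\<lambda>x\<in>carrier M. \<zero>\<^bsub>N\<^esub>)"

definition left_iso ::
  "('r, 'e) ring_scheme \<Rightarrow> ('r, 'm, 'f) module_scheme \<Rightarrow> ('r, 'n, 'g) module_scheme \<Rightarrow> bool"
  where "left_iso R M N \<longleftrightarrow> (\<exists>f \<in> left_hom R M N. bij_betw f (carrier M) (carrier N))"

definition direct_summand ::
  "('r, 'e) ring_scheme \<Rightarrow> 'm set \<Rightarrow> ('r, 'm, 'f) module_scheme \<Rightarrow> bool"
  where "direct_summand R U M \<longleftrightarrow> submodule U R M \<and>
    (\<exists>V. submodule V R M \<and> U \<inter> V = {\<zero>\<^bsub>M\<^esub>} \<and> U <+>\<^bsub>M\<^esub> V = carrier M)"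

definition iso_to_summand ::
  "('r, 'e) ring_scheme \<Rightarrow> ('r, 'm, 'f) module_scheme \<Rightarrow> ('r, 'n, 'g) module_scheme \<Rightarrow> bool"
  where "iso_to_summand R M N \<longleftrightarrow> (\<exists>U. direct_summand R U N \<and> left_iso R M (N\<lparr>carrier := U\<rparr>))"

definition regular :: "('r, 'e) ring_scheme \<Rightarrow> ('r, 'r) module"
  where "regular R = \<lparr>carrier = carrier R, monoid.mult = monoid.mult R, one = \<one>\<^bsub>R\<^esub>,
    ring.zero = \<zero>\<^bsub>R\<^esub>, ring.add = ring.add R, smult = monoid.mult R\<rparr>"

text \<open>The direct sum of copies of \<open>M\<close> indexed by \<open>I\<close>; the power \<open>M\<^sup>n\<close> is \<open>copower {..<n} M\<close>.\<close>

definition copower :: "'i set \<Rightarrow> ('r, 'm, 'f) module_scheme \<Rightarrow> ('r, 'i \<Rightarrow> 'm) module"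
  where "copower I M = \<lparr>carrier = {f \<in> I \<rightarrow>\<^sub>E carrier M. finite {i \<in> I. f i \<noteq> \<zero>\<^bsub>M\<^esub>}},
    monoid.mult = undefined, one = undefined,
    ring.zero = (\<lambda>i\<in>I. \<zero>\<^bsub>M\<^esub>), ring.add = (\<lambda>f g. \<lambda>i\<in>I. f i \<oplus>\<^bsub>M\<^esub> g i),
    smult = (\<lambda>r f. \<lambda>i\<in>I. r \<odot>\<^bsub>M\<^esub> f i)\<rparr>"

definition in_add ::
  "('r, 'e) ring_scheme \<Rightarrow> ('r, 't, 'f) module_scheme \<Rightarrow> ('r, 'm, 'g) module_scheme \<Rightarrow> bool"
  where "in_add R T M \<longleftrightarrow> left_module R M \<and> (\<exists>n::nat. iso_to_summand R M (copower {..<n} T))"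

definition fin_generated :: "('r, 'e) ring_scheme \<Rightarrow> ('r, 'm, 'f) module_scheme \<Rightarrow> bool"
  where "fin_generated R M \<longleftrightarrow> left_module R M \<and>
    (\<exists>S \<subseteq> carrier M. finite S \<and>
      (\<forall>x\<in>carrier M. \<exists>c \<in> S \<rightarrow> carrier R. x = finsum M (\<lambda>s. c s \<odot>\<^bsub>M\<^esub> s) S))"

text \<open>
  Projective means: isomorphic to a direct summand of a free module. The basis may be taken inside
  the type \<open>'m\<close> without loss of generality: if \<open>M\<close> is projective, then the canonical surjection
  from the free module with basis \<open>carrier M\<close> onto \<open>M\<close> splits.
\<close>

definition projective :: "('r, 'e) ring_scheme \<Rightarrow> ('r, 'm, 'f) module_scheme \<Rightarrow> bool"
  where "projective R M \<longleftrightarrow> left_module R M \<and>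
    (\<exists>I :: 'm set. iso_to_summand R M (copower I (regular R)))"


section \<open>Bimodules and Frobenius extensions\<close>

record ('l, 'r, 'b) bimodule = "('l, 'b) module" +
  rsmult :: "'b \<Rightarrow> 'r \<Rightarrow> 'b"

definition bimodule_iso :: "('l, 'e) ring_scheme \<Rightarrow> ('r, 'f) ring_scheme \<Rightarrow>
    ('l, 'r, 'm, 'g) bimodule_scheme \<Rightarrow> ('l, 'r, 'n, 'h) bimodule_scheme \<Rightarrow> bool"
  where "bimodule_iso L R M N \<longleftrightarrow> (\<exists>f \<in> left_hom L M N. bij_betw f (carrier M) (carrier N) \<and>
    (\<forall>x\<in>carrier M. \<forall>r\<in>carrier R. f (rsmult M x r) = rsmult N (f x) r))"

definition sub_bimodule :: "('l, 'e) ring_scheme \<Rightarrow> ('r, 'f) ring_scheme \<Rightarrow> 'm set \<Rightarrow>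
    ('l, 'r, 'm, 'g) bimodule_scheme \<Rightarrow> bool"
  where "sub_bimodule L R U M \<longleftrightarrow> submodule U L M \<and> (\<forall>x\<in>U. \<forall>r\<in>carrier R. rsmult M x r \<in> U)"

definition bimodule_iso_to_summand :: "('l, 'e) ring_scheme \<Rightarrow> ('r, 'f) ring_scheme \<Rightarrow>
    ('l, 'r, 'm, 'g) bimodule_scheme \<Rightarrow> ('l, 'r, 'n, 'h) bimodule_scheme \<Rightarrow> bool"
  where "bimodule_iso_to_summand L R M N \<longleftrightarrow>
    (\<exists>U V. sub_bimodule L R U N \<and> sub_bimodule L R V N \<and>
      U \<inter> V = {\<zero>\<^bsub>N\<^esub>} \<and> U <+>\<^bsub>N\<^esub> V = carrier N \<and> bimodule_iso L R M (N\<lparr>carrier := U\<rparr>))"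

definition bimodule_power ::
  "nat \<Rightarrow> ('l, 'r, 'm, 'g) bimodule_scheme \<Rightarrow> ('l, 'r, nat \<Rightarrow> 'm) bimodule"
  where "bimodule_power n M = module.extend (copower {..<n} M)
    (bimodule.fields (\<lambda>f r. \<lambda>i\<in>{..<n}. rsmult M (f i) r))"

text \<open>The ring \<open>B\<close> as an \<open>L\<close>-\<open>R\<close>-bimodule along ring homomorphisms \<open>f : L \<rightarrow> B\<close> and \<open>g : R \<rightarrow> B\<close>.\<close>

definition ring_bimodule ::
  "('l \<Rightarrow> 'b) \<Rightarrow> ('r \<Rightarrow> 'b) \<Rightarrow> ('b, 'e) ring_scheme \<Rightarrow> ('l, 'r, 'b) bimodule"
  where "ring_bimodule f g B = \<lparr>carrier = carrier B, monoid.mult = monoid.mult B, one = \<one>\<^bsub>B\<^esub>,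
    ring.zero = \<zero>\<^bsub>B\<^esub>, ring.add = ring.add B, smult = (\<lambda>l b. f l \<otimes>\<^bsub>B\<^esub> b), rsmult = (\<lambda>b r. b \<otimes>\<^bsub>B\<^esub> g r)\<rparr>"

definition restrict_scalars :: "('r \<Rightarrow> 'a) \<Rightarrow> ('a, 'e) ring_scheme \<Rightarrow> ('r, 'a) module"
  where "restrict_scalars \<iota> A = \<lparr>carrier = carrier A, monoid.mult = monoid.mult A, one = \<one>\<^bsub>A\<^esub>,
    ring.zero = \<zero>\<^bsub>A\<^esub>, ring.add = ring.add A, smult = (\<lambda>r a. \<iota> r \<otimes>\<^bsub>A\<^esub> a)\<rparr>"

text \<open>\<open>Hom\<^sub>R(A, R)\<close> as an \<open>A\<close>-\<open>R\<close>-bimodule, via \<open>(a f)(x) = f(x a)\<close> and \<open>(f r)(x) = f(x) r\<close>.\<close>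

definition dual_bimodule ::
  "('r, 'e) ring_scheme \<Rightarrow> ('a, 'f) ring_scheme \<Rightarrow> ('r \<Rightarrow> 'a) \<Rightarrow> ('a, 'r, 'a \<Rightarrow> 'r) bimodule"
  where "dual_bimodule R A \<iota> = \<lparr>carrier = left_hom R (restrict_scalars \<iota> A) (regular R),
    monoid.mult = undefined, one = undefined,
    ring.zero = (\<lambda>x\<in>carrier A. \<zero>\<^bsub>R\<^esub>),
    ring.add = (\<lambda>f g. \<lambda>x\<in>carrier A. f x \<oplus>\<^bsub>R\<^esub> g x),
    smult = (\<lambda>a f. \<lambda>x\<in>carrier A. f (x \<otimes>\<^bsub>A\<^esub> a)),
    rsmult = (\<lambda>f r. \<lambda>x\<in>carrier A. f x \<otimes>\<^bsub>R\<^esub> r)\<rparr>"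

definition ring_extension ::
  "('r, 'e) ring_scheme \<Rightarrow> ('a, 'f) ring_scheme \<Rightarrow> ('r \<Rightarrow> 'a) \<Rightarrow> bool"
  where "ring_extension R A \<iota> \<longleftrightarrow> ring R \<and> ring A \<and> \<iota> \<in> ring_hom R A"

definition frobenius_extension ::
  "('r, 'e) ring_scheme \<Rightarrow> ('a, 'f) ring_scheme \<Rightarrow> ('r \<Rightarrow> 'a) \<Rightarrow> bool"
  where "frobenius_extension R A \<iota> \<longleftrightarrow> ring_extension R A \<iota> \<and>
    fin_generated R (restrict_scalars \<iota> A) \<and> projective R (restrict_scalars \<iota> A) \<and>
    bimodule_iso A R (ring_bimodule id \<iota> A) (dual_bimodule R A \<iota>)"

definition centrally_projective ::
  "('r, 'e) ring_scheme \<Rightarrow> ('a, 'f) ring_scheme \<Rightarrow> ('r \<Rightarrow> 'a) \<Rightarrow> bool"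
  where "centrally_projective R A \<iota> \<longleftrightarrow>
    (\<exists>n::nat. n \<ge> 1 \<and>
      bimodule_iso_to_summand R R (ring_bimodule \<iota> \<iota> A) (bimodule_power n (ring_bimodule id id R)))"


section \<open>The induced module\<close>

text \<open>
  \<open>A \<otimes>\<^sub>R T\<close> is the quotient of the free abelian group on \<open>carrier A \<times> carrier T\<close> by the subgroup
  generated by the usual relations. In the \<open>A\<close>-action \<open>a (x \<otimes> t) = (a x) \<otimes> t\<close>, all the cosets
  in the union below coincide.
\<close>

definition tensor_relations :: "('r, 'e) ring_scheme \<Rightarrow> ('a, 'f) ring_scheme \<Rightarrow> ('r \<Rightarrow> 'a) \<Rightarrow>
    ('r, 't, 'g) module_scheme \<Rightarrow> ('a \<times> 't \<Rightarrow>\<^sub>0 int) set"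
  where "tensor_relations R A \<iota> T =
    {frag_of (x \<oplus>\<^bsub>A\<^esub> y, t) - frag_of (x, t) - frag_of (y, t) | x y t.
      x \<in> carrier A \<and> y \<in> carrier A \<and> t \<in> carrier T} \<union>
    {frag_of (x, s \<oplus>\<^bsub>T\<^esub> t) - frag_of (x, s) - frag_of (x, t) | x s t.
      x \<in> carrier A \<and> s \<in> carrier T \<and> t \<in> carrier T} \<union>
    {frag_of (x \<otimes>\<^bsub>A\<^esub> \<iota> r, t) - frag_of (x, r \<odot>\<^bsub>T\<^esub> t) | x r t.
      x \<in> carrier A \<and> r \<in> carrier R \<and> t \<in> carrier T}"

definition induced_module :: "('r, 'e) ring_scheme \<Rightarrow> ('a, 'f) ring_scheme \<Rightarrow> ('r \<Rightarrow> 'a) \<Rightarrow>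
    ('r, 't, 'g) module_scheme \<Rightarrow> ('a, ('a \<times> 't \<Rightarrow>\<^sub>0 int) set) module"
  where "induced_module R A \<iota> T =
    (let F = free_Abelian_group (carrier A \<times> carrier T);
         K = generate F (tensor_relations R A \<iota> T)
     in \<lparr>carrier = rcosets\<^bsub>F\<^esub> K, monoid.mult = undefined, one = undefined,
         ring.zero = K, ring.add = set_mult F,
         smult = (\<lambda>a U. \<Union>u\<in>U. K #>\<^bsub>F\<^esub> frag_extend (\<lambda>(x, t). frag_of (a \<otimes>\<^bsub>A\<^esub> x, t)) u)\<rparr>)"


section \<open>Resolutions, Ext and Wakamatsu tilting modules\<close>

text \<open>An exact sequence \<open>\<dots> \<rightarrow> P\<^sub>2 \<rightarrow> P\<^sub>1 \<rightarrow> P\<^sub>0 \<rightarrow> M \<rightarrow> 0\<close> with \<open>d n : P (n + 1) \<rightarrow> P n\<close>, \<open>e : P 0 \<rightarrow> M\<close>.\<close>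

definition projective_resolution :: "('r, 'e) ring_scheme \<Rightarrow> (nat \<Rightarrow> ('r, 'p, 'g) module_scheme) \<Rightarrow>
    (nat \<Rightarrow> 'p \<Rightarrow> 'p) \<Rightarrow> ('p \<Rightarrow> 'm) \<Rightarrow> ('r, 'm, 'h) module_scheme \<Rightarrow> bool"
  where "projective_resolution R P d e M \<longleftrightarrow>
    (\<forall>n. projective R (P n)) \<and>
    (\<forall>n. d n \<in> left_hom R (P (Suc n)) (P n)) \<and> e \<in> left_hom R (P 0) M \<and>
    e ` carrier (P 0) = carrier M \<and>
    a_kernel (P 0) M e = d 0 ` carrier (P 1) \<and>
    (\<forall>n. a_kernel (P (Suc n)) (P n) (d n) = d (Suc n) ` carrier (P (Suc (Suc n))))"

text \<open>The map \<open>Hom(h, N)\<close> induced by \<open>h : M \<rightarrow> M'\<close>.\<close>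

abbreviation precomp :: "('r, 'm, 'f) module_scheme \<Rightarrow> ('m \<Rightarrow> 'k) \<Rightarrow> ('k \<Rightarrow> 'n) \<Rightarrow> 'm \<Rightarrow> 'n"
  where "precomp M h \<equiv> (\<lambda>g. compose (carrier M) g h)"

definition ext_cocycles :: "('r, 'e) ring_scheme \<Rightarrow> (nat \<Rightarrow> ('r, 'p, 'g) module_scheme) \<Rightarrow>
    (nat \<Rightarrow> 'p \<Rightarrow> 'p) \<Rightarrow> ('r, 'n, 'h) module_scheme \<Rightarrow> nat \<Rightarrow> ('p \<Rightarrow> 'n) set"
  where "ext_cocycles R P d N i =
    {f \<in> left_hom R (P i) N. precomp (P (Suc i)) (d i) f = zero_hom (P (Suc i)) N}"

fun ext_coboundaries :: "('r, 'e) ring_scheme \<Rightarrow> (nat \<Rightarrow> ('r, 'p, 'g) module_scheme) \<Rightarrow>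
    (nat \<Rightarrow> 'p \<Rightarrow> 'p) \<Rightarrow> ('r, 'n, 'h) module_scheme \<Rightarrow> nat \<Rightarrow> ('p \<Rightarrow> 'n) set"
  where
    "ext_coboundaries R P d N 0 = {zero_hom (P 0) N}"
  | "ext_coboundaries R P d N (Suc i) = precomp (P (Suc i)) (d i) ` left_hom R (P i) N"

text \<open>
  A type for the terms of projective resolutions of a module \<open>M\<close> with elements in \<open>'m\<close>. It is large
  enough: the infinite type \<open>('r + 'm) list\<close> contains a basis for a free module mapping onto \<open>M\<close>,
  and since there are at most as many finitely supported functions \<open>('r + 'm) list \<Rightarrow> 'r\<close> as elements
  of \<open>('r + 'm) list\<close>, the same holds for each of the successive kernels. So every left module has a
  projective (even free) resolution with terms in this type, and every resolution by finitely
  generated projective modules is isomorphic to one with terms in this type.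
\<close>

type_synonym ('r, 'm) resolution_type = "('r + 'm) list \<Rightarrow> 'r"

text \<open>
  \<open>Ext\<^sup>i(M, N) = 0\<close>: the \<open>i\<close>-th cohomology group of \<open>Hom(P, N)\<close> is zero for projective resolutions
  \<open>P\<close> of \<open>M\<close>. As cohomology does not depend on \<open>P\<close> and resolutions exist (see above), it does not
  matter whether this is required for all or for some \<open>P\<close>.
\<close>

definition ext_vanishes :: "('r, 'e) ring_scheme \<Rightarrow> ('r, 'm, 'f) module_scheme \<Rightarrow>
    ('r, 'n, 'g) module_scheme \<Rightarrow> nat \<Rightarrow> bool"
  where "ext_vanishes R M N i \<longleftrightarrow>
    (\<forall>(P :: nat \<Rightarrow> ('r, ('r, 'm) resolution_type) module) d e. projective_resolution R P d e M \<longrightarrow>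
      ext_cocycles R P d N i = ext_coboundaries R P d N i)"

definition has_fg_projective_resolution ::
  "('r, 'e) ring_scheme \<Rightarrow> ('r, 'm, 'f) module_scheme \<Rightarrow> bool"
  where "has_fg_projective_resolution R M \<longleftrightarrow>
    (\<exists>(P :: nat \<Rightarrow> ('r, ('r, 'm) resolution_type) module) d e. projective_resolution R P d e M \<and>
      (\<forall>n. fin_generated R (P n)))"

text \<open>
  An exact sequence \<open>0 \<rightarrow> R \<rightarrow> C\<^sub>0 \<rightarrow> C\<^sub>1 \<rightarrow> \<dots>\<close> in which all \<open>C\<^sub>j\<close> lie in \<open>add(T)\<close>, with \<open>u : R \<rightarrow> C 0\<close> and
  \<open>d j : C j \<rightarrow> C (j + 1)\<close>.
\<close>

definition add_coresolution :: "('r, 'e) ring_scheme \<Rightarrow> ('r, 't, 'f) module_scheme \<Rightarrow>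
    (nat \<Rightarrow> ('r, 'c, 'g) module_scheme) \<Rightarrow> ('r \<Rightarrow> 'c) \<Rightarrow> (nat \<Rightarrow> 'c \<Rightarrow> 'c) \<Rightarrow> bool"
  where "add_coresolution R T C u d \<longleftrightarrow>
    (\<forall>j. in_add R T (C j)) \<and>
    u \<in> left_hom R (regular R) (C 0) \<and> (\<forall>j. d j \<in> left_hom R (C j) (C (Suc j))) \<and>
    inj_on u (carrier R) \<and>
    a_kernel (C 0) (C 1) (d 0) = u ` carrier R \<and>
    (\<forall>j. a_kernel (C (Suc j)) (C (Suc (Suc j))) (d (Suc j)) = d j ` carrier (C j))"

text \<open>Exactness of \<open>\<dots> \<rightarrow> Hom(C\<^sub>1, T) \<rightarrow> Hom(C\<^sub>0, T) \<rightarrow> Hom(R, T) \<rightarrow> 0\<close>.\<close>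

definition hom_exact :: "('r, 'e) ring_scheme \<Rightarrow> ('r, 't, 'f) module_scheme \<Rightarrow>
    (nat \<Rightarrow> ('r, 'c, 'g) module_scheme) \<Rightarrow> ('r \<Rightarrow> 'c) \<Rightarrow> (nat \<Rightarrow> 'c \<Rightarrow> 'c) \<Rightarrow> bool"
  where "hom_exact R T C u d \<longleftrightarrow>
    precomp (regular R) u ` left_hom R (C 0) T = left_hom R (regular R) T \<and>
    {f \<in> left_hom R (C 0) T. precomp (regular R) u f = zero_hom (regular R) T} =
      precomp (C 0) (d 0) ` left_hom R (C 1) T \<and>
    (\<forall>j. {f \<in> left_hom R (C (Suc j)) T. precomp (C j) (d j) f = zero_hom (C j) T} =
      precomp (C (Suc j)) (d (Suc j)) ` left_hom R (C (Suc (Suc j))) T)"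

text \<open>
  In the third condition, the terms may be taken in the type \<open>nat \<Rightarrow> 't\<close> without loss of generality,
  as every module in \<open>add(T)\<close> is isomorphic to a submodule of some \<open>T\<^sup>n\<close>.
\<close>

definition wakamatsu_tilting :: "('r, 'e) ring_scheme \<Rightarrow> ('r, 't, 'f) module_scheme \<Rightarrow> bool"
  where "wakamatsu_tilting R T \<longleftrightarrow> left_module R T \<and>
    has_fg_projective_resolution R T \<and>
    (\<forall>i>0. ext_vanishes R T T i) \<and>
    (\<exists>(C :: nat \<Rightarrow> ('r, nat \<Rightarrow> 't) module) u d. add_coresolution R T C u d \<and> hom_exact R T C u d)"

end

(* Central projectivity provides bimodule maps alpha_i : A -> R and elements c_i of A commuting with R
   such that a = sum_i c_i alpha_i(a). Hence an induced module N = A (x) M is described by an R-linear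
   map eta : M -> N (namely m |-> 1 (x) m) and R-linear maps rho_i : N -> M with
   rho_i(a eta(m)) = alpha_i(a) m and x = sum_i c_i eta(rho_i(x)); as an R-module, N is a direct
   summand of a power of M. So induction is exact, and exactness of Hom(-, T) on R-modules gives
   exactness of Hom(-, A (x) T) on the induced modules: the components rho_i o psi o eta of an A-linear
   map psi : A (x) M -> A (x) T are R-linear maps M -> T. Applied to a resolution and a coresolution of
   T, this gives the three conditions for A (x) T, Ext being independent of the resolution. *)

theory Submission
  imports Defs
begin

section \<open>Homomorphisms of left modules\<close>

text \<open>The definitions fix the element types of the terms of resolutions and coresolutions,
  whereas a tensor product consists of sets of formal sums, so induced terms cannot serve as they
  stand. For this reason the homological arguments do not speak of tensors: they rest on the data
  \<eta> and \<rho>, which survive every isomorphism of A-modules, and each induced term is copied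
  into the prescribed type. The copy fits because the term lies in add of a module with elements of
  the right type (A itself for resolutions, A \<otimes> T for coresolutions), so finitely many
  coordinates determine an element. Exactness of Hom passes to induced modules because the elements
  c_j commute with R: then m |-> c_j \<eta>(\<chi>(m)) is R-linear for every R-linear \<chi>, and
  factorisations found separately for each component of \<psi> add up to one R-linear map, which
  extends to an A-linear one. The vanishing of Ext in positive degree is an instance, being
  exactness of Hom(P, T) there. Only one finitely generated resolution of T is induced; vanishing
  for all other resolutions of A \<otimes> T follows by comparison with it.\<close>

context left_module
begin

lemma smult_l_null [simp]: "x \<in> carrier M \<Longrightarrow> \<zero> \<odot>\<^bsub>M\<^esub> x = \<zero>\<^bsub>M\<^esub>"
  using smult_l_distr[of \<zero> \<zero> x] M.add.r_cancel_one'[of "\<zero> \<odot>\<^bsub>M\<^esub> x" "\<zero> \<odot>\<^bsub>M\<^esub> x"]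
  by simp

lemma smult_r_null [simp]: "a \<in> carrier R \<Longrightarrow> a \<odot>\<^bsub>M\<^esub> \<zero>\<^bsub>M\<^esub> = \<zero>\<^bsub>M\<^esub>"
  using smult_r_distr[of a "\<zero>\<^bsub>M\<^esub>" "\<zero>\<^bsub>M\<^esub>"]
    M.add.r_cancel_one'[of "a \<odot>\<^bsub>M\<^esub> \<zero>\<^bsub>M\<^esub>" "a \<odot>\<^bsub>M\<^esub> \<zero>\<^bsub>M\<^esub>"]
  by simp

lemma smult_l_minus:
  assumes "a \<in> carrier R" "x \<in> carrier M"
  shows "(\<ominus> a) \<odot>\<^bsub>M\<^esub> x = \<ominus>\<^bsub>M\<^esub> (a \<odot>\<^bsub>M\<^esub> x)"
proof (rule M.add.inv_equality[symmetric])
  show "(\<ominus> a) \<odot>\<^bsub>M\<^esub> x \<oplus>\<^bsub>M\<^esub> a \<odot>\<^bsub>M\<^esub> x = \<zero>\<^bsub>M\<^esub>"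
    using assms by (simp flip: smult_l_distr add: R.l_neg)
qed (use assms in auto)

lemma smult_r_minus:
  "a \<in> carrier R \<Longrightarrow> x \<in> carrier M \<Longrightarrow> a \<odot>\<^bsub>M\<^esub> (\<ominus>\<^bsub>M\<^esub> x) = \<ominus>\<^bsub>M\<^esub> (a \<odot>\<^bsub>M\<^esub> x)"
  by (rule M.add.inv_equality[symmetric]) (auto simp flip: smult_r_distr simp: M.l_neg)

lemma smult_minus_one: "x \<in> carrier M \<Longrightarrow> (\<ominus> \<one>) \<odot>\<^bsub>M\<^esub> x = \<ominus>\<^bsub>M\<^esub> x"
  by (simp add: smult_l_minus)

lemma smult_finsum:
  assumes "a \<in> carrier R" "f \<in> I \<rightarrow> carrier M"
  shows "a \<odot>\<^bsub>M\<^esub> finsum M f I = (\<Oplus>\<^bsub>M\<^esub>i\<in>I. a \<odot>\<^bsub>M\<^esub> f i)"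
  using assms(2)
proof (induction I rule: infinite_finite_induct)
  case (insert x F)
  then show ?case using assms(1) by (simp add: Pi_def smult_r_distr)
qed (use assms(1) in auto)

lemma finsum_smult:
  assumes "x \<in> carrier M" "f \<in> I \<rightarrow> carrier R"
  shows "finsum R f I \<odot>\<^bsub>M\<^esub> x = (\<Oplus>\<^bsub>M\<^esub>i\<in>I. f i \<odot>\<^bsub>M\<^esub> x)"
  using assms(2)
proof (induction I rule: infinite_finite_induct)
  case (insert y F)
  then show ?case using assms(1) by (simp add: Pi_def smult_l_distr)
qed (use assms(1) in auto)

end

lemma left_moduleI:
  fixes R (structure) and M (structure)
  assumes "ring R" "abelian_group M"
    and "\<And>a x. \<lbrakk>a \<in> carrier R; x \<in> carrier M\<rbrakk> \<Longrightarrow> a \<odot>\<^bsub>M\<^esub> x \<in> carrier M"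
    and "\<And>a b x. \<lbrakk>a \<in> carrier R; b \<in> carrier R; x \<in> carrier M\<rbrakk> \<Longrightarrow>
      (a \<oplus>\<^bsub>R\<^esub> b) \<odot>\<^bsub>M\<^esub> x = a \<odot>\<^bsub>M\<^esub> x \<oplus>\<^bsub>M\<^esub> b \<odot>\<^bsub>M\<^esub> x"
    and "\<And>a x y. \<lbrakk>a \<in> carrier R; x \<in> carrier M; y \<in> carrier M\<rbrakk> \<Longrightarrow>
      a \<odot>\<^bsub>M\<^esub> (x \<oplus>\<^bsub>M\<^esub> y) = a \<odot>\<^bsub>M\<^esub> x \<oplus>\<^bsub>M\<^esub> a \<odot>\<^bsub>M\<^esub> y"
    and "\<And>a b x. \<lbrakk>a \<in> carrier R; b \<in> carrier R; x \<in> carrier M\<rbrakk> \<Longrightarrow>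
      (a \<otimes>\<^bsub>R\<^esub> b) \<odot>\<^bsub>M\<^esub> x = a \<odot>\<^bsub>M\<^esub> (b \<odot>\<^bsub>M\<^esub> x)"
    and "\<And>x. x \<in> carrier M \<Longrightarrow> \<one>\<^bsub>R\<^esub> \<odot>\<^bsub>M\<^esub> x = x"
  shows "left_module R M"
  using assms by (simp add: left_module_def left_module_axioms_def)

lemma (in abelian_monoid) finsum_swap:
  assumes "finite I" "finite J" "\<And>i j. i \<in> I \<Longrightarrow> j \<in> J \<Longrightarrow> f i j \<in> carrier G"
  shows "(\<Oplus>i\<in>I. \<Oplus>j\<in>J. f i j) = (\<Oplus>j\<in>J. \<Oplus>i\<in>I. f i j)"
  using assms(1,3)
proof (induction I rule: finite_induct)
  case (insert x F)
  then have "(\<Oplus>i\<in>insert x F. \<Oplus>j\<in>J. f i j) = (\<Oplus>j\<in>J. f x j) \<oplus> (\<Oplus>j\<in>J. \<Oplus>i\<in>F. f i j)"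
    by (simp add: Pi_def)
  also have "\<dots> = (\<Oplus>j\<in>J. f x j \<oplus> (\<Oplus>i\<in>F. f i j))"
    using insert by (intro finsum_addf[symmetric]) (auto intro!: finsum_closed)
  also have "\<dots> = (\<Oplus>j\<in>J. \<Oplus>i\<in>insert x F. f i j)"
    using insert by (intro finsum_cong') (auto simp: Pi_def intro!: finsum_closed)
  finally show ?case .
qed auto

lemma (in abelian_monoid) finsum_delta:
  assumes "finite I" "i \<in> I" "f i \<in> carrier G"
  shows "(\<Oplus>j\<in>I. if j = i then f j else \<zero>) = f i"
proof -
  have "(\<Oplus>j\<in>I. if j = i then f j else \<zero>) = (\<Oplus>j\<in>I. if i = j then f i else \<zero>)"
    using assms by (intro finsum_cong') auto
  then show ?thesis
    using add.finprod_singleton[of i I "\<lambda>_. f i"] assms by simp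
qed

section \<open>Calculus of extensional homomorphisms\<close>

lemma left_homI:
  assumes "\<And>x. x \<in> carrier M \<Longrightarrow> f x \<in> carrier N"
    and "\<And>x. x \<notin> carrier M \<Longrightarrow> f x = undefined"
    and "\<And>x y. x \<in> carrier M \<Longrightarrow> y \<in> carrier M \<Longrightarrow> f (x \<oplus>\<^bsub>M\<^esub> y) = f x \<oplus>\<^bsub>N\<^esub> f y"
    and "\<And>r x. r \<in> carrier R \<Longrightarrow> x \<in> carrier M \<Longrightarrow> f (r \<odot>\<^bsub>M\<^esub> x) = r \<odot>\<^bsub>N\<^esub> f x"
  shows "f \<in> left_hom R M N"
  using assms by (auto simp: left_hom_def PiE_def extensional_def)

text \<open>Homomorphisms are \<open>undefined\<close> off the carrier, so a formula becomes one
  only after restriction. The module hypothesis gives closure of the carrier under sums and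
  multiples, so that the restriction can be removed on both sides of the linearity
  conditions.\<close>

lemma left_hom_restrictI:
  assumes "left_module R M"
    and "\<And>x. x \<in> carrier M \<Longrightarrow> f x \<in> carrier N"
    and "\<And>x y. x \<in> carrier M \<Longrightarrow> y \<in> carrier M \<Longrightarrow> f (x \<oplus>\<^bsub>M\<^esub> y) = f x \<oplus>\<^bsub>N\<^esub> f y"
    and "\<And>r x. r \<in> carrier R \<Longrightarrow> x \<in> carrier M \<Longrightarrow> f (r \<odot>\<^bsub>M\<^esub> x) = r \<odot>\<^bsub>N\<^esub> f x"
  shows "(\<lambda>x\<in>carrier M. f x) \<in> left_hom R M N"
proof -
  interpret left_module R M by fact
  show ?thesis using assms(2-) by (intro left_homI) auto
qed

lemma left_hom_closed: "f \<in> left_hom R M N \<Longrightarrow> x \<in> carrier M \<Longrightarrow> f x \<in> carrier N"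
  by (auto simp: left_hom_def)

lemma left_hom_add:
  "f \<in> left_hom R M N \<Longrightarrow> x \<in> carrier M \<Longrightarrow> y \<in> carrier M \<Longrightarrow> f (x \<oplus>\<^bsub>M\<^esub> y) = f x \<oplus>\<^bsub>N\<^esub> f y"
  by (auto simp: left_hom_def)

lemma left_hom_smult:
  "f \<in> left_hom R M N \<Longrightarrow> r \<in> carrier R \<Longrightarrow> x \<in> carrier M \<Longrightarrow> f (r \<odot>\<^bsub>M\<^esub> x) = r \<odot>\<^bsub>N\<^esub> f x"
  by (auto simp: left_hom_def)

lemma left_hom_undefined: "f \<in> left_hom R M N \<Longrightarrow> x \<notin> carrier M \<Longrightarrow> f x = undefined"
  by (auto simp: left_hom_def PiE_def extensional_def)

lemma left_hom_eqI:
  assumes "f \<in> left_hom R M N" "g \<in> left_hom R M N'" "\<And>x. x \<in> carrier M \<Longrightarrow> f x = g x"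
  shows "f = g"
  using assms by (metis ext left_hom_undefined)

lemma left_hom_zero:
  assumes "left_module R M" "left_module R N" "f \<in> left_hom R M N"
  shows "f \<zero>\<^bsub>M\<^esub> = \<zero>\<^bsub>N\<^esub>"
proof -
  interpret M: left_module R M by fact
  interpret N: left_module R N by fact
  have "f \<zero>\<^bsub>M\<^esub> \<in> carrier N" "f \<zero>\<^bsub>M\<^esub> \<oplus>\<^bsub>N\<^esub> f \<zero>\<^bsub>M\<^esub> = f \<zero>\<^bsub>M\<^esub>"
    using left_hom_closed[OF assms(3)] left_hom_add[OF assms(3), of "\<zero>\<^bsub>M\<^esub>" "\<zero>\<^bsub>M\<^esub>"] by simp_all
  then show ?thesis using N.M.add.r_cancel_one' by metis
qed

lemma left_hom_minus:
  assumes "left_module R M" "left_module R N" "f \<in> left_hom R M N" "x \<in> carrier M"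
  shows "f (\<ominus>\<^bsub>M\<^esub> x) = \<ominus>\<^bsub>N\<^esub> f x"
proof -
  interpret M: left_module R M by fact
  interpret N: left_module R N by fact
  show ?thesis
    using left_hom_smult[OF assms(3), of "\<ominus>\<^bsub>R\<^esub> \<one>\<^bsub>R\<^esub>" x] assms(4) left_hom_closed[OF assms(3,4)]
    by (simp add: M.smult_minus_one N.smult_minus_one)
qed

lemma left_hom_finsum:
  assumes "left_module R M" "left_module R N" "f \<in> left_hom R M N" "g \<in> I \<rightarrow> carrier M"
  shows "f (finsum M g I) = (\<Oplus>\<^bsub>N\<^esub>i\<in>I. f (g i))"
proof -
  interpret M: left_module R M by fact
  interpret N: left_module R N by fact
  show ?thesis
    using assms(4)
  proof (induction I rule: infinite_finite_induct)
    case (insert x F)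
    then have "g x \<in> carrier M" "g \<in> F \<rightarrow> carrier M" by auto
    with insert show ?case
      using left_hom_closed[OF assms(3)]
      by (simp add: left_hom_add[OF assms(3)] Pi_def)
  qed (simp_all add: left_hom_zero[OF assms(1-3)])
qed

lemma left_hom_compose:
  assumes "left_module R M" "f \<in> left_hom R M N" "g \<in> left_hom R N K"
  shows "compose (carrier M) g f \<in> left_hom R M K"
  unfolding compose_def
  using assms by (intro left_hom_restrictI) (auto simp: left_hom_closed left_hom_add left_hom_smult)

lemma left_hom_id: "left_module R M \<Longrightarrow> (\<lambda>x\<in>carrier M. x) \<in> left_hom R M M"
  by (rule left_hom_restrictI) auto

lemma left_hom_sum:
  assumes "left_module R M" "left_module R N" "\<And>i. i \<in> I \<Longrightarrow> f i \<in> left_hom R M N"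
  shows "(\<lambda>x\<in>carrier M. \<Oplus>\<^bsub>N\<^esub>i\<in>I. f i x) \<in> left_hom R M N"
proof -
  interpret M: left_module R M by fact
  interpret N: left_module R N by fact
  note f = assms(3)
  show ?thesis
  proof (rule left_hom_restrictI[OF assms(1)])
    fix x y assume xy: "x \<in> carrier M" "y \<in> carrier M"
    have "(\<Oplus>\<^bsub>N\<^esub>i\<in>I. f i (x \<oplus>\<^bsub>M\<^esub> y)) = (\<Oplus>\<^bsub>N\<^esub>i\<in>I. f i x \<oplus>\<^bsub>N\<^esub> f i y)"
      using xy by (intro N.M.finsum_cong') (auto simp: left_hom_add[OF f] left_hom_closed[OF f])
    also have "\<dots> = (\<Oplus>\<^bsub>N\<^esub>i\<in>I. f i x) \<oplus>\<^bsub>N\<^esub> (\<Oplus>\<^bsub>N\<^esub>i\<in>I. f i y)"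
      using xy by (intro N.M.finsum_addf) (auto simp: left_hom_closed[OF f])
    finally show "(\<Oplus>\<^bsub>N\<^esub>i\<in>I. f i (x \<oplus>\<^bsub>M\<^esub> y)) = (\<Oplus>\<^bsub>N\<^esub>i\<in>I. f i x) \<oplus>\<^bsub>N\<^esub> (\<Oplus>\<^bsub>N\<^esub>i\<in>I. f i y)" .
  next
    fix r x assume x: "r \<in> carrier R" "x \<in> carrier M"
    have "(\<Oplus>\<^bsub>N\<^esub>i\<in>I. f i (r \<odot>\<^bsub>M\<^esub> x)) = (\<Oplus>\<^bsub>N\<^esub>i\<in>I. r \<odot>\<^bsub>N\<^esub> f i x)"
      using x by (intro N.M.finsum_cong') (auto simp: left_hom_smult[OF f] left_hom_closed[OF f])
    also have "\<dots> = r \<odot>\<^bsub>N\<^esub> (\<Oplus>\<^bsub>N\<^esub>i\<in>I. f i x)"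
      using x by (intro N.smult_finsum[symmetric]) (auto simp: left_hom_closed[OF f])
    finally show "(\<Oplus>\<^bsub>N\<^esub>i\<in>I. f i (r \<odot>\<^bsub>M\<^esub> x)) = r \<odot>\<^bsub>N\<^esub> (\<Oplus>\<^bsub>N\<^esub>i\<in>I. f i x)" .
  qed (auto intro!: N.M.finsum_closed simp: left_hom_closed[OF f])
qed

lemma left_hom_add_hom:
  assumes "left_module R M" "left_module R N" "f \<in> left_hom R M N" "g \<in> left_hom R M N"
  shows "(\<lambda>x\<in>carrier M. f x \<oplus>\<^bsub>N\<^esub> g x) \<in> left_hom R M N"
proof -
  interpret M: left_module R M by fact
  interpret N: left_module R N by fact
  show ?thesis
    using assms(3,4)
    by (intro left_hom_restrictI[OF assms(1)])
      (auto simp: left_hom_add left_hom_closed left_hom_smult N.smult_r_distr N.M.a_ac)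
qed

lemma left_hom_minus_hom:
  assumes "left_module R M" "left_module R N" "f \<in> left_hom R M N" "g \<in> left_hom R M N"
  shows "(\<lambda>x\<in>carrier M. f x \<ominus>\<^bsub>N\<^esub> g x) \<in> left_hom R M N"
proof -
  interpret M: left_module R M by fact
  interpret N: left_module R N by fact
  show ?thesis
    using assms(3,4)
    by (intro left_hom_restrictI[OF assms(1)])
      (auto simp: left_hom_add left_hom_closed left_hom_smult N.smult_r_distr N.smult_r_minus
          N.M.a_ac N.M.minus_add a_minus_def)
qed

lemma mem_a_kernel: "x \<in> a_kernel M N f \<longleftrightarrow> x \<in> carrier M \<and> f x = \<zero>\<^bsub>N\<^esub>"
  by (simp add: a_kernel_def')

lemma regular_simps [simp]:
  "carrier (regular R) = carrier R" "\<zero>\<^bsub>regular R\<^esub> = \<zero>\<^bsub>R\<^esub>" "add (regular R) = add R"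
  "smult (regular R) = monoid.mult R" "finsum (regular R) = finsum R"
  by (auto simp: regular_def finsum_def finprod_def fun_eq_iff)

lemma left_module_regular:
  assumes "ring R"
  shows "left_module R (regular R)"
proof -
  interpret ring R by fact
  show ?thesis
    using assms
    by (intro left_moduleI abelian_groupI) (auto simp: l_distr r_distr m_assoc a_ac intro: add.l_inv_ex)
qed

section \<open>Direct summands, projective modules and add(T)\<close>

lemma copower_simps [simp]:
  "carrier (copower I M) = {f \<in> I \<rightarrow>\<^sub>E carrier M. finite {i \<in> I. f i \<noteq> \<zero>\<^bsub>M\<^esub>}}"
  "\<zero>\<^bsub>copower I M\<^esub> = (\<lambda>i\<in>I. \<zero>\<^bsub>M\<^esub>)"
  "f \<oplus>\<^bsub>copower I M\<^esub> g = (\<lambda>i\<in>I. f i \<oplus>\<^bsub>M\<^esub> g i)"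
  "r \<odot>\<^bsub>copower I M\<^esub> f = (\<lambda>i\<in>I. r \<odot>\<^bsub>M\<^esub> f i)"
  by (simp_all add: copower_def)

lemma left_module_copower:
  fixes M :: "('r, 'm, 'f) module_scheme" and I :: "'i set"
  assumes "left_module R M"
  shows "left_module R (copower I M)"
proof -
  interpret left_module R M by fact
  have add: "finite {i \<in> I. f i \<oplus>\<^bsub>M\<^esub> g i \<noteq> \<zero>\<^bsub>M\<^esub>}"
    if "finite {i \<in> I. f i \<noteq> \<zero>\<^bsub>M\<^esub>}" "finite {i \<in> I. g i \<noteq> \<zero>\<^bsub>M\<^esub>}" for f g :: "'i \<Rightarrow> 'm"
    by (rule finite_subset[OF _ finite_UnI[OF that]]) auto
  have smult: "finite {i \<in> I. r \<odot>\<^bsub>M\<^esub> f i \<noteq> \<zero>\<^bsub>M\<^esub>}"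
    if "finite {i \<in> I. f i \<noteq> \<zero>\<^bsub>M\<^esub>}" "r \<in> carrier R" for f :: "'i \<Rightarrow> 'm" and r
    by (rule finite_subset[OF _ that(1)]) (use that(2) in auto)
  have neg: "\<exists>g\<in>carrier (copower I M). g \<oplus>\<^bsub>copower I M\<^esub> f = \<zero>\<^bsub>copower I M\<^esub>"
    if "f \<in> carrier (copower I M)" for f
  proof -
    \<comment> \<open>The negative is written as a multiple by -1, so that its finite support is an
      instance of \<open>smult\<close>.\<close>
    have "(\<lambda>i\<in>I. (\<ominus>\<^bsub>R\<^esub> \<one>\<^bsub>R\<^esub>) \<odot>\<^bsub>M\<^esub> f i) \<in> carrier (copower I M)"
      using that smult[of f "\<ominus>\<^bsub>R\<^esub> \<one>\<^bsub>R\<^esub>"] by (auto simp: PiE_iff cong: conj_cong)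
    moreover have "(\<ominus>\<^bsub>R\<^esub> \<one>\<^bsub>R\<^esub>) \<odot>\<^bsub>M\<^esub> f i \<oplus>\<^bsub>M\<^esub> f i = \<zero>\<^bsub>M\<^esub>" if "i \<in> I" for i
      using \<open>f \<in> carrier (copower I M)\<close> that by (simp add: PiE_iff smult_minus_one M.l_neg)
    ultimately show ?thesis
      by (intro bexI[of _ "\<lambda>i\<in>I. (\<ominus>\<^bsub>R\<^esub> \<one>\<^bsub>R\<^esub>) \<odot>\<^bsub>M\<^esub> f i"]) (simp_all cong: restrict_cong)
  qed
  have c: "f \<in> carrier (copower I M) \<longleftrightarrow> f \<in> extensional I \<and> (\<forall>i\<in>I. f i \<in> carrier M) \<and> finite {i \<in> I. f i \<noteq> \<zero>\<^bsub>M\<^esub>}"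
    for f by (auto simp: PiE_iff)
  show ?thesis
  proof (intro left_moduleI abelian_groupI neg R.ring_axioms, unfold c copower_simps(2-4))
    fix f g assume "f \<in> extensional I \<and> (\<forall>i\<in>I. f i \<in> carrier M) \<and> finite {i \<in> I. f i \<noteq> \<zero>\<^bsub>M\<^esub>}"
      "g \<in> extensional I \<and> (\<forall>i\<in>I. g i \<in> carrier M) \<and> finite {i \<in> I. g i \<noteq> \<zero>\<^bsub>M\<^esub>}"
    then show "(\<lambda>i\<in>I. f i \<oplus>\<^bsub>M\<^esub> g i) \<in> extensional I \<and> (\<forall>i\<in>I. (\<lambda>i\<in>I. f i \<oplus>\<^bsub>M\<^esub> g i) i \<in> carrier M) \<and>
        finite {i \<in> I. (\<lambda>i\<in>I. f i \<oplus>\<^bsub>M\<^esub> g i) i \<noteq> \<zero>\<^bsub>M\<^esub>}"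
      using add[of f g] by (simp cong: conj_cong)
  next
    fix r f assume "r \<in> carrier R"
      "f \<in> extensional I \<and> (\<forall>i\<in>I. f i \<in> carrier M) \<and> finite {i \<in> I. f i \<noteq> \<zero>\<^bsub>M\<^esub>}"
    then show "(\<lambda>i\<in>I. r \<odot>\<^bsub>M\<^esub> f i) \<in> extensional I \<and> (\<forall>i\<in>I. (\<lambda>i\<in>I. r \<odot>\<^bsub>M\<^esub> f i) i \<in> carrier M) \<and>
        finite {i \<in> I. (\<lambda>i\<in>I. r \<odot>\<^bsub>M\<^esub> f i) i \<noteq> \<zero>\<^bsub>M\<^esub>}"
      using smult[of f r] by (simp cong: conj_cong)
  qed (auto intro!: extensionalityI[of _ I]
      simp: M.a_ac smult_l_distr smult_r_distr smult_assoc1 cong: conj_cong)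
qed

lemma copower_eval_hom:
  assumes "left_module R M" "i \<in> I"
  shows "(\<lambda>f\<in>carrier (copower I M). f i) \<in> left_hom R (copower I M) M"
  by (rule left_hom_restrictI[OF left_module_copower[OF assms(1)]]) (use assms(2) in auto)

lemma copower_incl_hom:
  assumes "left_module R M" "i \<in> I"
  shows "(\<lambda>x\<in>carrier M. \<lambda>j\<in>I. if j = i then x else \<zero>\<^bsub>M\<^esub>) \<in> left_hom R M (copower I M)"
proof -
  interpret left_module R M by fact
  have "finite {j \<in> I. (if j = i then x else \<zero>\<^bsub>M\<^esub>) \<noteq> \<zero>\<^bsub>M\<^esub>}" for x
    by (rule finite_subset[of _ "{i}"]) auto
  then show ?thesis
    by (intro left_hom_restrictI assms(1)) (auto cong: conj_cong)
qed

text \<open>Evaluation at a coordinate k is a homomorphism, so it passes through the sum and leaves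
  a Kronecker delta. The set J may be larger than the support of v, so that several elements can be
  expanded over one index set.\<close>

lemma copower_decompose:
  assumes "left_module R M" "finite J" "J \<subseteq> I" "v \<in> carrier (copower I M)" "{i \<in> I. v i \<noteq> \<zero>\<^bsub>M\<^esub>} \<subseteq> J"
  shows "v = (\<Oplus>\<^bsub>copower I M\<^esub>i\<in>J. (\<lambda>j\<in>I. if j = i then v i else \<zero>\<^bsub>M\<^esub>))" (is "v = finsum _ ?F J")
proof -
  interpret M: left_module R M by fact
  interpret C: left_module R "copower I M" by (rule left_module_copower) fact
  have F: "?F i \<in> carrier (copower I M)" if "i \<in> J" for i
    using left_hom_closed[OF copower_incl_hom[OF assms(1), of i I], of "v i"] assms(3,4) that by auto
  have fs: "finsum (copower I M) ?F J \<in> carrier (copower I M)"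
    by (intro C.M.finsum_closed) (use F in auto)
  have "finsum (copower I M) ?F J k = v k" if k: "k \<in> I" for k
  proof -
    let ?e = "\<lambda>f\<in>carrier (copower I M). f k"
    have "finsum (copower I M) ?F J k = ?e (finsum (copower I M) ?F J)"
      using fs by (simp del: copower_simps)
    also have "\<dots> = (\<Oplus>\<^bsub>M\<^esub>i\<in>J. ?e (?F i))"
      using F by (intro left_hom_finsum[OF C.left_module_axioms M.left_module_axioms copower_eval_hom[OF assms(1) k]]) auto
    also have "\<dots> = (\<Oplus>\<^bsub>M\<^esub>i\<in>J. ?F i k)"
    proof (rule M.M.finsum_cong'[OF refl])
      show "?e (?F i) = ?F i k" if "i \<in> J" for i using F[OF that] by (rule restrict_apply')
      show "(\<lambda>i. ?F i k) \<in> J \<rightarrow> carrier M"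
        using assms(3,4) k by (auto simp: PiE_iff)
    qed
    also have "\<dots> = (\<Oplus>\<^bsub>M\<^esub>i\<in>J. if i = k then v i else \<zero>\<^bsub>M\<^esub>)"
      using assms(3,4) k by (intro M.M.finsum_cong') (auto simp: PiE_iff)
    also have "\<dots> = v k"
    proof (cases "k \<in> J")
      case True
      then show ?thesis using assms k by (intro M.M.finsum_delta) (auto simp: PiE_iff)
    next
      case False
      then have "(\<Oplus>\<^bsub>M\<^esub>i\<in>J. if i = k then v i else \<zero>\<^bsub>M\<^esub>) = (\<Oplus>\<^bsub>M\<^esub>i\<in>J. \<zero>\<^bsub>M\<^esub>)"
        by (intro M.M.finsum_cong') auto
      then show ?thesis using False assms(5) k by auto
    qed
    finally show ?thesis .
  qed
  moreover have "finsum (copower I M) ?F J \<in> extensional I" "v \<in> extensional I"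
    using fs assms(4) by (auto simp: PiE_iff)
  ultimately show ?thesis by (intro extensionalityI[of v I]) (simp_all del: copower_simps)
qed

text \<open>The projection onto U along V. It is described by its values on sums u + v, and the last
  clause says that every element has this form, so later computations need no choice of
  components.\<close>

lemma summand_projection:
  assumes "left_module R N" "submodule U R N" "submodule V R N"
    and "U \<inter> V = {\<zero>\<^bsub>N\<^esub>}" "U <+>\<^bsub>N\<^esub> V = carrier N"
  obtains p where "p \<in> left_hom R N N" "\<And>u v. u \<in> U \<Longrightarrow> v \<in> V \<Longrightarrow> p (u \<oplus>\<^bsub>N\<^esub> v) = u"
    "\<And>y. y \<in> carrier N \<Longrightarrow> \<exists>u\<in>U. \<exists>v\<in>V. y = u \<oplus>\<^bsub>N\<^esub> v"
proof -
  interpret left_module R N by fact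
  interpret U: submodule U R N by fact
  interpret V: submodule V R N by fact
  have UN: "u \<in> carrier N" "\<ominus>\<^bsub>N\<^esub> u \<in> U" if "u \<in> U" for u
    using that U.subset U.m_inv_closed by (auto simp: a_inv_def)
  have VN: "v \<in> carrier N" "\<ominus>\<^bsub>N\<^esub> v \<in> V" if "v \<in> V" for v
    using that V.subset V.m_inv_closed by (auto simp: a_inv_def)
  have Uadd: "u \<oplus>\<^bsub>N\<^esub> u' \<in> U" if "u \<in> U" "u' \<in> U" for u u' using U.m_closed that by simp
  have Vadd: "u \<oplus>\<^bsub>N\<^esub> u' \<in> V" if "u \<in> V" "u' \<in> V" for u u' using V.m_closed that by simp
  define p where "p = (\<lambda>y\<in>carrier N. SOME u. u \<in> U \<and> (\<exists>v\<in>V. y = u \<oplus>\<^bsub>N\<^esub> v))"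
  have dec: "\<exists>u\<in>U. \<exists>v\<in>V. y = u \<oplus>\<^bsub>N\<^esub> v" if "y \<in> carrier N" for y
    using that unfolding assms(5)[symmetric] set_add_def' by blast
  \<comment> \<open>Two decompositions of one element differ by an element of U that also lies in V,
    hence by zero.\<close>
  have uniq: "u = u'" if uv: "u \<in> U" "v \<in> V" "u' \<in> U" "v' \<in> V" "u \<oplus>\<^bsub>N\<^esub> v = u' \<oplus>\<^bsub>N\<^esub> v'" for u v u' v'
  proof -
    have "u = (u \<oplus>\<^bsub>N\<^esub> v) \<ominus>\<^bsub>N\<^esub> v"
      using uv(1,2) UN VN by (simp add: a_minus_def M.a_assoc M.r_neg)
    also have "\<dots> = u' \<oplus>\<^bsub>N\<^esub> (v' \<ominus>\<^bsub>N\<^esub> v)"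
      using uv UN VN by (simp add: a_minus_def M.a_assoc)
    finally have e: "\<ominus>\<^bsub>N\<^esub> u' \<oplus>\<^bsub>N\<^esub> u = v' \<ominus>\<^bsub>N\<^esub> v"
      using uv UN VN by (simp add: M.r_neg1)
    have "v' \<ominus>\<^bsub>N\<^esub> v \<in> V" "\<ominus>\<^bsub>N\<^esub> u' \<oplus>\<^bsub>N\<^esub> u \<in> U"
      using uv Uadd Vadd UN(2) VN(2) by (auto simp: a_minus_def)
    then have "\<ominus>\<^bsub>N\<^esub> u' \<oplus>\<^bsub>N\<^esub> u = \<zero>\<^bsub>N\<^esub>" using e assms(4) by auto
    then show ?thesis using uv UN by (metis M.r_neg2 M.r_zero)
  qed
  have p_add: "p (u \<oplus>\<^bsub>N\<^esub> v) = u" if "u \<in> U" "v \<in> V" for u v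
  proof -
    have "u \<oplus>\<^bsub>N\<^esub> v \<in> carrier N" using that UN VN by auto
    moreover have "(SOME w. w \<in> U \<and> (\<exists>v'\<in>V. u \<oplus>\<^bsub>N\<^esub> v = w \<oplus>\<^bsub>N\<^esub> v')) = u"
      using that uniq by (intro some_equality) blast+
    ultimately show ?thesis by (simp add: p_def)
  qed
  have "p \<in> left_hom R N N"
  proof (rule left_homI)
    fix y assume "y \<in> carrier N"
    then show "p y \<in> carrier N" using dec p_add UN by metis
  next
    fix y z assume "y \<in> carrier N" "z \<in> carrier N"
    then obtain u v u' v' where y: "u \<in> U" "v \<in> V" "y = u \<oplus>\<^bsub>N\<^esub> v" "u' \<in> U" "v' \<in> V" "z = u' \<oplus>\<^bsub>N\<^esub> v'"
      using dec by metis
    then have "y \<oplus>\<^bsub>N\<^esub> z = (u \<oplus>\<^bsub>N\<^esub> u') \<oplus>\<^bsub>N\<^esub> (v \<oplus>\<^bsub>N\<^esub> v')"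
      using UN VN by (simp add: M.a_ac)
    then show "p (y \<oplus>\<^bsub>N\<^esub> z) = p y \<oplus>\<^bsub>N\<^esub> p z"
      using y Uadd Vadd p_add by simp
  next
    fix r y assume r: "r \<in> carrier R" "y \<in> carrier N"
    then obtain u v where y: "u \<in> U" "v \<in> V" "y = u \<oplus>\<^bsub>N\<^esub> v" using dec by metis
    then show "p (r \<odot>\<^bsub>N\<^esub> y) = r \<odot>\<^bsub>N\<^esub> p y"
      using r UN VN p_add U.smult_closed V.smult_closed by (simp add: smult_r_distr)
  qed (simp add: p_def)
  then show thesis using p_add dec that by blast
qed

text \<open>Turns complements into a split monomorphism, the form in which module summands are
  handled below: the retraction projects onto U and then inverts the isomorphism onto U.\<close>

lemma iso_to_summandE:
  assumes "iso_to_summand R M N" "left_module R M" "left_module R N"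
  obtains s q where "s \<in> left_hom R M N" "q \<in> left_hom R N M" "\<And>x. x \<in> carrier M \<Longrightarrow> q (s x) = x"
proof -
  interpret M: left_module R M by fact
  interpret N: left_module R N by fact
  obtain U V f where UV: "submodule U R N" "submodule V R N" "U \<inter> V = {\<zero>\<^bsub>N\<^esub>}" "U <+>\<^bsub>N\<^esub> V = carrier N"
    and f: "f \<in> left_hom R M (N\<lparr>carrier := U\<rparr>)" "bij_betw f (carrier M) U"
    using assms(1) by (auto simp: iso_to_summand_def direct_summand_def left_iso_def)
  obtain p where p: "p \<in> left_hom R N N" "\<And>u v. u \<in> U \<Longrightarrow> v \<in> V \<Longrightarrow> p (u \<oplus>\<^bsub>N\<^esub> v) = u"
    "\<And>y. y \<in> carrier N \<Longrightarrow> \<exists>u\<in>U. \<exists>v\<in>V. y = u \<oplus>\<^bsub>N\<^esub> v"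
    by (rule summand_projection[OF assms(3) UV]) blast
  have UN: "U \<subseteq> carrier N" using submodule.axioms(1)[OF UV(1)] subgroup.subset by fastforce
  have fU: "f x \<in> U" if "x \<in> carrier M" for x using f(2) that by (auto simp: bij_betw_def)
  have pU: "p y \<in> U" if "y \<in> carrier N" for y using p(2,3) that by metis
  have zV: "\<zero>\<^bsub>N\<^esub> \<in> V" using UV(3) by auto
  have pu: "p u = u" if "u \<in> U" for u using p(2)[OF that zV] UN that by auto
  define g where "g = inv_into (carrier M) f"
  have g: "g u \<in> carrier M" "f (g u) = u" if "u \<in> U" for u
    using f(2) that by (auto simp: g_def bij_betw_def inv_into_into f_inv_into_f)
  have gf: "g (f x) = x" if "x \<in> carrier M" for x
    using f(2) that by (auto simp: g_def bij_betw_def)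
  have f_add: "f (x \<oplus>\<^bsub>M\<^esub> y) = f x \<oplus>\<^bsub>N\<^esub> f y" if "x \<in> carrier M" "y \<in> carrier M" for x y
    using left_hom_add[OF f(1) that] by simp
  have f_smult: "f (r \<odot>\<^bsub>M\<^esub> x) = r \<odot>\<^bsub>N\<^esub> f x" if "x \<in> carrier M" "r \<in> carrier R" for x r
    using left_hom_smult[OF f(1) that(2,1)] by simp
  show thesis
  proof
    show "f \<in> left_hom R M N"
      using f(1) fU UN f_add f_smult by (intro left_homI) (auto intro: left_hom_undefined)
    show "(\<lambda>y\<in>carrier N. g (p y)) \<in> left_hom R N M"
    proof (rule left_hom_restrictI[OF assms(3)])
      fix y z assume yz: "y \<in> carrier N" "z \<in> carrier N"
      have "p y \<oplus>\<^bsub>N\<^esub> p z = f (g (p y) \<oplus>\<^bsub>M\<^esub> g (p z))"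
        using yz g pU by (simp add: f_add)
      then show "g (p (y \<oplus>\<^bsub>N\<^esub> z)) = g (p y) \<oplus>\<^bsub>M\<^esub> g (p z)"
        using yz g pU gf by (simp add: left_hom_add[OF p(1)])
    next
      fix r y assume yz: "r \<in> carrier R" "y \<in> carrier N"
      have "r \<odot>\<^bsub>N\<^esub> p y = f (r \<odot>\<^bsub>M\<^esub> g (p y))"
        using yz g pU by (simp add: f_smult)
      then show "g (p (r \<odot>\<^bsub>N\<^esub> y)) = r \<odot>\<^bsub>M\<^esub> g (p y)"
        using yz g pU gf by (simp add: left_hom_smult[OF p(1)])
    qed (use g pU in auto)
    show "(\<lambda>y\<in>carrier N. g (p y)) (f x) = x" if "x \<in> carrier M" for x
      using that fU UN pu gf by auto
  qed
qed

text \<open>A retraction q of s splits N into the image of s and the kernel of q, through y =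
  s(q(y)) + (y - s(q(y))).\<close>

lemma iso_to_summandI:
  assumes "left_module R M" "left_module R N"
    and s: "s \<in> left_hom R M N" and q: "q \<in> left_hom R N M" and qs: "\<And>x. x \<in> carrier M \<Longrightarrow> q (s x) = x"
  shows "iso_to_summand R M N"
proof -
  interpret M: left_module R M by fact
  interpret N: left_module R N by fact
  note s0 = left_hom_zero[OF assms(1,2) s] and q0 = left_hom_zero[OF assms(2,1) q]
  note sm = left_hom_minus[OF assms(1,2) s] and qm = left_hom_minus[OF assms(2,1) q]
  note hs = left_hom_closed[OF s] left_hom_closed[OF q]
  define U where "U = s ` carrier M"
  define V where "V = a_kernel N M q"
  have UN: "U \<subseteq> carrier N" using hs by (auto simp: U_def)
  have VN: "V \<subseteq> carrier N" by (auto simp: V_def mem_a_kernel)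
  have U: "submodule U R N"
  proof (intro submodule.intro N.M.add.subgroupI submodule_axioms.intro)
    show "U \<noteq> {}" by (auto simp: U_def)
    show "\<ominus>\<^bsub>N\<^esub> u \<in> U" if "u \<in> U" for u
      using that by (auto simp: U_def image_iff simp flip: sm intro!: bexI[of _ "\<ominus>\<^bsub>M\<^esub> _"])
    show "u \<oplus>\<^bsub>N\<^esub> v \<in> U" if "u \<in> U" "v \<in> U" for u v
      using that by (auto simp: U_def simp flip: left_hom_add[OF s])
    show "a \<odot>\<^bsub>N\<^esub> u \<in> U" if "a \<in> carrier R" "u \<in> U" for a u
      using that by (auto simp: U_def simp flip: left_hom_smult[OF s])
  qed (use UN in auto)
  have V: "submodule V R N"
  proof (intro submodule.intro N.M.add.subgroupI submodule_axioms.intro)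
    show "V \<noteq> {}" using q0 mem_a_kernel[of "\<zero>\<^bsub>N\<^esub>" N M q] by (auto simp: V_def)
  qed (use VN in \<open>auto simp: V_def mem_a_kernel qm left_hom_add[OF q] left_hom_smult[OF q]\<close>)
  have "U \<inter> V = {\<zero>\<^bsub>N\<^esub>}"
  proof
    show "{\<zero>\<^bsub>N\<^esub>} \<subseteq> U \<inter> V" using s0 q0 by (auto simp: U_def V_def mem_a_kernel intro!: image_eqI[of _ _ "\<zero>\<^bsub>M\<^esub>"])
    show "U \<inter> V \<subseteq> {\<zero>\<^bsub>N\<^esub>}" using qs s0 by (auto simp: U_def V_def mem_a_kernel)
  qed
  moreover have "U <+>\<^bsub>N\<^esub> V = carrier N"
  proof
    show "U <+>\<^bsub>N\<^esub> V \<subseteq> carrier N" using UN VN by (auto simp: set_add_def')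
    show "carrier N \<subseteq> U <+>\<^bsub>N\<^esub> V"
    proof
      fix y assume y: "y \<in> carrier N"
      have "s (q y) \<in> U" using y hs by (auto simp: U_def)
      moreover have "y \<ominus>\<^bsub>N\<^esub> s (q y) \<in> V"
        using y hs qs by (simp add: V_def mem_a_kernel a_minus_def left_hom_add[OF q] qm M.M.r_neg)
      moreover have "y = s (q y) \<oplus>\<^bsub>N\<^esub> (y \<ominus>\<^bsub>N\<^esub> s (q y))"
        using y hs by (simp add: a_minus_def N.M.a_lcomm N.M.r_neg)
      ultimately show "y \<in> U <+>\<^bsub>N\<^esub> V" unfolding set_add_def' by blast
    qed
  qed
  moreover have "left_iso R M (N\<lparr>carrier := U\<rparr>)"
    unfolding left_iso_def
  proof (rule bexI[of _ s])
    show "s \<in> left_hom R M (N\<lparr>carrier := U\<rparr>)"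
      by (rule left_homI) (auto simp: U_def left_hom_add[OF s] left_hom_smult[OF s] left_hom_undefined[OF s])
    show "bij_betw s (carrier M) (carrier (N\<lparr>carrier := U\<rparr>))"
      using qs by (auto simp: bij_betw_def U_def intro: inj_on_inverseI)
  qed
  ultimately show ?thesis
    using U V unfolding iso_to_summand_def direct_summand_def by blast
qed


section \<open>Membership in add(T) through finite families of maps\<close>

lemma finsum_superset:
  assumes "abelian_monoid M" "finite J" "K \<subseteq> J" "f \<in> J \<rightarrow> carrier M" "\<And>j. j \<in> J - K \<Longrightarrow> f j = \<zero>\<^bsub>M\<^esub>"
  shows "finsum M f K = finsum M f J"
proof -
  interpret abelian_monoid M by fact
  show ?thesis using assms(2-) by (intro add.finprod_mono_neutral_cong_left) auto
qed

text \<open>Composing a splitting through a power of T with the coordinate projections and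
  inclusions writes the identity of M as a finite sum of maps that factor through T. In this form
  the property can be induced map by map.\<close>

lemma in_addE:
  assumes "in_add R T M" "left_module R T"
  obtains n :: nat and s q where
    "\<And>i. i < n \<Longrightarrow> s i \<in> left_hom R M T" "\<And>i. i < n \<Longrightarrow> q i \<in> left_hom R T M"
    "\<And>x. x \<in> carrier M \<Longrightarrow> x = (\<Oplus>\<^bsub>M\<^esub>i\<in>{..<n}. q i (s i x))"
proof -
  obtain n :: nat where M: "left_module R M" and iso: "iso_to_summand R M (copower {..<n} T)"
    using assms(1) by (auto simp: in_add_def)
  let ?C = "copower {..<n} T"
  interpret T: left_module R T by fact
  interpret M: left_module R M by fact
  note C = left_module_copower[OF assms(2), of "{..<n}"]
  obtain s q where s: "s \<in> left_hom R M ?C" and q: "q \<in> left_hom R ?C M"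
    and qs: "\<And>x. x \<in> carrier M \<Longrightarrow> q (s x) = x"
    by (rule iso_to_summandE[OF iso M C]) blast
  let ?e = "\<lambda>i. \<lambda>f\<in>carrier ?C. f i"
  let ?j = "\<lambda>i. \<lambda>x\<in>carrier T. \<lambda>j\<in>{..<n}. if j = i then x else \<zero>\<^bsub>T\<^esub>"
  have e: "?e i \<in> left_hom R ?C T" and j: "?j i \<in> left_hom R T ?C" if "i < n" for i
    using that copower_eval_hom[OF assms(2), of i "{..<n}"] copower_incl_hom[OF assms(2), of i "{..<n}"]
    by (simp_all del: copower_simps)
  show thesis
  proof
    show "compose (carrier M) (?e i) s \<in> left_hom R M T" if "i < n" for i
      using left_hom_compose[OF M s e[OF that]] .
    show "compose (carrier T) q (?j i) \<in> left_hom R T M" if "i < n" for i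
      using left_hom_compose[OF assms(2) j[OF that] q] .
    fix x assume x: "x \<in> carrier M"
    have sx: "s x \<in> carrier ?C" using left_hom_closed[OF s x] .
    have si: "s x i \<in> carrier T" if "i < n" for i using sx that by (auto simp: PiE_iff)
    have "x = q (s x)" using qs x by simp
    also have "s x = (\<Oplus>\<^bsub>?C\<^esub>i\<in>{..<n}. (\<lambda>j\<in>{..<n}. if j = i then s x i else \<zero>\<^bsub>T\<^esub>))"
      by (intro copower_decompose[OF assms(2) _ _ sx]) auto
    also have "\<dots> = (\<Oplus>\<^bsub>?C\<^esub>i\<in>{..<n}. ?j i (s x i))"
      using si left_hom_closed[OF j si]
      by (intro abelian_monoid.finsum_cong'[OF abelian_group.axioms(1)[OF left_module.axioms(2)[OF C]]])
        (auto simp del: copower_simps)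
    also have "q \<dots> = (\<Oplus>\<^bsub>M\<^esub>i\<in>{..<n}. q (?j i (s x i)))"
      using left_hom_closed[OF j si] by (intro left_hom_finsum[OF C M q]) auto
    also have "\<dots> = (\<Oplus>\<^bsub>M\<^esub>i\<in>{..<n}. compose (carrier T) q (?j i) (compose (carrier M) (?e i) s x))"
      using x sx si left_hom_closed[OF q left_hom_closed[OF j si]]
      by (intro M.M.finsum_cong') (auto simp: compose_def simp del: copower_simps)
    finally show "x = (\<Oplus>\<^bsub>M\<^esub>i\<in>{..<n}. compose (carrier T) q (?j i) (compose (carrier M) (?e i) s x))" .
  qed
qed

text \<open>The converse of \<open>in_addE\<close>. Any finite index set is allowed, since dual
  bases are indexed by elements of a module; the bijection \<open>h\<close> enumerates it, as
  \<open>in_add\<close> speaks of powers indexed by an initial segment of the naturals.\<close>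

lemma in_addI:
  assumes T: "left_module R T" and M: "left_module R M" and J: "finite J"
    and s: "\<And>j. j \<in> J \<Longrightarrow> s j \<in> left_hom R M T" and q: "\<And>j. j \<in> J \<Longrightarrow> q j \<in> left_hom R T M"
    and qs: "\<And>x. x \<in> carrier M \<Longrightarrow> x = (\<Oplus>\<^bsub>M\<^esub>j\<in>J. q j (s j x))"
  shows "in_add R T M"
proof -
  interpret T: left_module R T by fact
  interpret M: left_module R M by fact
  obtain h where h: "bij_betw h {..<card J} J"
    using ex_bij_betw_nat_finite[OF J] by (auto simp: atLeast0LessThan)
  let ?n = "card J"
  let ?C = "copower {..<?n} T"
  note C = left_module_copower[OF T, of "{..<?n}"]
  have hJ: "h i \<in> J" if "i < ?n" for i using h that by (auto simp: bij_betw_def)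
  have sc: "s j x \<in> carrier T" if "j \<in> J" "x \<in> carrier M" for j x using left_hom_closed[OF s] that .
  have qc: "q j x \<in> carrier M" if "j \<in> J" "x \<in> carrier T" for j x using left_hom_closed[OF q] that .
  let ?s = "\<lambda>x\<in>carrier M. \<lambda>i\<in>{..<?n}. s (h i) x"
  let ?q = "\<lambda>f\<in>carrier ?C. \<Oplus>\<^bsub>M\<^esub>i\<in>{..<?n}. compose (carrier ?C) (q (h i)) (\<lambda>f\<in>carrier ?C. f i) f"
  have "?s \<in> left_hom R M ?C"
    by (rule left_hom_restrictI[OF M])
      (auto simp: hJ sc left_hom_add[OF s] left_hom_smult[OF s] cong: restrict_cong)
  moreover have "?q \<in> left_hom R ?C M"
    by (intro left_hom_sum C M left_hom_compose[where N = T] copower_eval_hom q hJ T) auto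
  moreover have "?q (?s x) = x" if x: "x \<in> carrier M" for x
  proof -
    have sx: "?s x \<in> carrier ?C" using left_hom_closed calculation(1) x .
    have "?q (?s x) = (\<Oplus>\<^bsub>M\<^esub>i\<in>{..<?n}. q (h i) (s (h i) x))"
      using sx x by (simp only: restrict_apply' compose_eq) (intro M.M.finsum_cong', auto simp: hJ sc qc)
    also have "\<dots> = (\<Oplus>\<^bsub>M\<^esub>j\<in>J. q j (s j x))"
      using M.M.finsum_reindex[of "\<lambda>j. q j (s j x)" h "{..<?n}"] h x by (auto simp: bij_betw_def sc qc)
    also have "\<dots> = x" using qs[OF x] by simp
    finally show ?thesis .
  qed
  ultimately have "iso_to_summand R M ?C" by (rule iso_to_summandI[OF M C])
  with M show ?thesis by (auto simp: in_add_def)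
qed

section \<open>Projective modules through dual bases\<close>

lemma smult_right_hom:
  assumes "left_module R M" "x \<in> carrier M"
  shows "(\<lambda>r\<in>carrier R. r \<odot>\<^bsub>M\<^esub> x) \<in> left_hom R (regular R) M"
proof -
  interpret left_module R M by fact
  show ?thesis
    using left_hom_restrictI[OF left_module_regular[OF R.ring_axioms], of "\<lambda>r. r \<odot>\<^bsub>M\<^esub> x" M] assms(2)
    by (simp add: smult_l_distr smult_assoc1)
qed

text \<open>The dual basis lemma: the p i are the coordinates of the section into the free module,
  and the x i are the images of the unit vectors under the retraction. The expansion holds over
  every finite J containing the support, because the elements m, m' and m + m' have different
  supports and must be compared over a common J.\<close>

lemma projective_dual_basis:
  fixes P :: "('r, 'p, 'g) module_scheme"
  assumes "projective R P"
  obtains I :: "'p set" and x p where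
    "\<And>i. i \<in> I \<Longrightarrow> x i \<in> carrier P" "\<And>i. i \<in> I \<Longrightarrow> p i \<in> left_hom R P (regular R)"
    "\<And>m. m \<in> carrier P \<Longrightarrow> finite {i \<in> I. p i m \<noteq> \<zero>\<^bsub>R\<^esub>}"
    "\<And>m J. m \<in> carrier P \<Longrightarrow> finite J \<Longrightarrow> J \<subseteq> I \<Longrightarrow> {i \<in> I. p i m \<noteq> \<zero>\<^bsub>R\<^esub>} \<subseteq> J \<Longrightarrow>
      m = (\<Oplus>\<^bsub>P\<^esub>i\<in>J. p i m \<odot>\<^bsub>P\<^esub> x i)"
proof -
  obtain I :: "'p set" where P: "left_module R P" and iso: "iso_to_summand R P (copower I (regular R))"
    using assms by (auto simp: projective_def)
  interpret P: left_module R P by fact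
  let ?R = "regular R"
  let ?C = "copower I ?R"
  note R = left_module_regular[OF P.R.ring_axioms]
  note C = left_module_copower[OF R, of I]
  obtain s q where s: "s \<in> left_hom R P ?C" and q: "q \<in> left_hom R ?C P"
    and qs: "\<And>x. x \<in> carrier P \<Longrightarrow> q (s x) = x"
    by (rule iso_to_summandE[OF iso P C]) blast
  let ?e = "\<lambda>i. \<lambda>f\<in>carrier ?C. f i"
  let ?j = "\<lambda>i. \<lambda>x\<in>carrier ?R. \<lambda>j\<in>I. if j = i then x else \<zero>\<^bsub>?R\<^esub>"
  have e: "?e i \<in> left_hom R ?C ?R" and j: "?j i \<in> left_hom R ?R ?C" if "i \<in> I" for i
    using that copower_eval_hom[OF R, of i I] copower_incl_hom[OF R, of i I]
    by (simp_all del: copower_simps)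
  have sc: "s m \<in> carrier ?C" if "m \<in> carrier P" for m using left_hom_closed[OF s that] .
  have si: "s m i \<in> carrier R" if "m \<in> carrier P" "i \<in> I" for m i
    using sc[OF that(1)] that(2) by (auto simp: PiE_iff)
  have p: "compose (carrier P) (?e i) s m = s m i" if "m \<in> carrier P" for m i
    using that sc by (simp add: compose_def del: copower_simps)
  have qj: "q (?j i \<one>\<^bsub>R\<^esub>) \<in> carrier P" if "i \<in> I" for i
    using that by (intro left_hom_closed[OF q] left_hom_closed[OF j]) auto
  show thesis
  proof
    show "q (?j i \<one>\<^bsub>R\<^esub>) \<in> carrier P" if "i \<in> I" for i using qj that .
    show "compose (carrier P) (?e i) s \<in> left_hom R P ?R" if "i \<in> I" for i
      using left_hom_compose[OF P s e[OF that]] .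
    show "finite {i \<in> I. compose (carrier P) (?e i) s m \<noteq> \<zero>\<^bsub>R\<^esub>}" if "m \<in> carrier P" for m
      using sc[OF that] p[OF that] by simp
    fix m J assume m: "m \<in> carrier P" and J: "finite J" "J \<subseteq> I"
      and supp: "{i \<in> I. compose (carrier P) (?e i) s m \<noteq> \<zero>\<^bsub>R\<^esub>} \<subseteq> J"
    have JI: "i \<in> I" if "i \<in> J" for i using that J by auto
    have sm: "s m i \<in> carrier ?R" if "i \<in> J" for i using si[OF m JI[OF that]] by simp
    have "m = q (s m)" using qs m by simp
    also have "s m = (\<Oplus>\<^bsub>?C\<^esub>i\<in>J. (\<lambda>j\<in>I. if j = i then s m i else \<zero>\<^bsub>?R\<^esub>))"
      using supp p[OF m] by (intro copower_decompose[OF R J sc[OF m]]) simp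
    also have "\<dots> = (\<Oplus>\<^bsub>?C\<^esub>i\<in>J. ?j i (s m i))"
      using left_hom_closed[OF j[OF JI] sm] sm
      by (intro abelian_monoid.finsum_cong'[OF abelian_group.axioms(1)[OF left_module.axioms(2)[OF C]]])
        (auto simp del: copower_simps)
    also have "q \<dots> = (\<Oplus>\<^bsub>P\<^esub>i\<in>J. q (?j i (s m i)))"
      using left_hom_closed[OF j[OF JI] sm] by (intro left_hom_finsum[OF C P q]) (auto simp del: copower_simps)
    also have "\<dots> = (\<Oplus>\<^bsub>P\<^esub>i\<in>J. compose (carrier P) (?e i) s m \<odot>\<^bsub>P\<^esub> q (?j i \<one>\<^bsub>R\<^esub>))"
    proof (rule P.M.finsum_cong'[OF refl])
      show "(\<lambda>i. compose (carrier P) (?e i) s m \<odot>\<^bsub>P\<^esub> q (?j i \<one>\<^bsub>R\<^esub>)) \<in> J \<rightarrow> carrier P"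
        using p[OF m] si[OF m] JI qj by auto
      fix i assume i: "i \<in> J"
      \<comment> \<open>The coefficient \<open>s m i\<close> is written as a multiple of the unit,
        so that linearity moves it out of q.\<close>
      have "q (?j i (s m i \<odot>\<^bsub>?R\<^esub> \<one>\<^bsub>R\<^esub>)) = q (s m i \<odot>\<^bsub>?C\<^esub> ?j i \<one>\<^bsub>R\<^esub>)"
        using si[OF m JI[OF i]] by (subst left_hom_smult[OF j[OF JI[OF i]]]) simp_all
      also have "\<dots> = s m i \<odot>\<^bsub>P\<^esub> q (?j i \<one>\<^bsub>R\<^esub>)"
        using si[OF m JI[OF i]] by (intro left_hom_smult[OF q] left_hom_closed[OF j[OF JI[OF i]]]) simp_all
      finally show "q (?j i (s m i)) = compose (carrier P) (?e i) s m \<odot>\<^bsub>P\<^esub> q (?j i \<one>\<^bsub>R\<^esub>)"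
        using si[OF m JI[OF i]] p[OF m] by simp
    qed
    finally show "m = (\<Oplus>\<^bsub>P\<^esub>i\<in>J. compose (carrier P) (?e i) s m \<odot>\<^bsub>P\<^esub> q (?j i \<one>\<^bsub>R\<^esub>))" .
  qed
qed

text \<open>Preimages of the values g (x i) on a dual basis determine the lift. Instead of
  surjectivity of h, the values of g are required to lie in the image of h; applied to
  differentials, this avoids forming kernels and images as modules.\<close>

lemma projective_lift:
  fixes P :: "('r, 'p, 'g) module_scheme"
  assumes "projective R P" and L: "left_module R L" and N: "left_module R N"
    and h: "h \<in> left_hom R L N" and g: "g \<in> left_hom R P N" and gh: "g ` carrier P \<subseteq> h ` carrier L"
  obtains k where "k \<in> left_hom R P L" "\<And>m. m \<in> carrier P \<Longrightarrow> h (k m) = g m"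
proof -
  have P: "left_module R P" using assms(1) by (simp add: projective_def)
  interpret P: left_module R P by fact
  interpret L: left_module R L by fact
  interpret N: left_module R N by fact
  obtain I :: "'p set" and x p where x: "\<And>i. i \<in> I \<Longrightarrow> x i \<in> carrier P"
    and p: "\<And>i. i \<in> I \<Longrightarrow> p i \<in> left_hom R P (regular R)"
    and fin: "\<And>m. m \<in> carrier P \<Longrightarrow> finite {i \<in> I. p i m \<noteq> \<zero>\<^bsub>R\<^esub>}"
    and sum: "\<And>m J. m \<in> carrier P \<Longrightarrow> finite J \<Longrightarrow> J \<subseteq> I \<Longrightarrow> {i \<in> I. p i m \<noteq> \<zero>\<^bsub>R\<^esub>} \<subseteq> J \<Longrightarrow>
      m = (\<Oplus>\<^bsub>P\<^esub>i\<in>J. p i m \<odot>\<^bsub>P\<^esub> x i)"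
    by (fact projective_dual_basis[OF assms(1)])
  define y where "y = (\<lambda>i. inv_into (carrier L) h (g (x i)))"
  have "g (x i) \<in> h ` carrier L" if "i \<in> I" for i
    using subsetD[OF gh imageI[OF x[OF that]]] .
  then have y: "\<And>i. i \<in> I \<Longrightarrow> y i \<in> carrier L" "\<And>i. i \<in> I \<Longrightarrow> h (y i) = g (x i)"
    by (simp_all add: y_def inv_into_into f_inv_into_f)
  have pc: "p i m \<in> carrier R" if "i \<in> I" "m \<in> carrier P" for i m
    using left_hom_closed[OF p] that by auto
  let ?supp = "\<lambda>m. {i \<in> I. p i m \<noteq> \<zero>\<^bsub>R\<^esub>}"
  define k where "k = (\<lambda>m\<in>carrier P. \<Oplus>\<^bsub>L\<^esub>i\<in>?supp m. p i m \<odot>\<^bsub>L\<^esub> y i)"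
  have k: "k m = (\<Oplus>\<^bsub>L\<^esub>i\<in>J. p i m \<odot>\<^bsub>L\<^esub> y i)"
    if "m \<in> carrier P" "finite J" "J \<subseteq> I" "?supp m \<subseteq> J" for m J
    unfolding k_def restrict_apply'[OF that(1)]
    using that pc y(1) by (intro finsum_superset L.abelian_monoid_axioms) (auto simp: subset_iff)
  have kc: "(\<lambda>i. p i m \<odot>\<^bsub>L\<^esub> y i) \<in> J \<rightarrow> carrier L" if "m \<in> carrier P" "J \<subseteq> I" for m J
    using that pc y by auto
  show thesis
  proof
    show "k \<in> left_hom R P L"
    proof (rule left_homI)
      fix m assume "m \<in> carrier P"
      then show "k m \<in> carrier L" using kc by (auto simp: k_def)
    next
      fix m m' assume m: "m \<in> carrier P" "m' \<in> carrier P"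
      \<comment> \<open>The support of the sum is joined to the index set, which spares the proof
        that it lies in the union of the other two.\<close>
      let ?J = "?supp m \<union> ?supp m' \<union> ?supp (m \<oplus>\<^bsub>P\<^esub> m')"
      have J: "finite ?J" "?J \<subseteq> I" using fin m by auto
      have "k (m \<oplus>\<^bsub>P\<^esub> m') = (\<Oplus>\<^bsub>L\<^esub>i\<in>?J. p i (m \<oplus>\<^bsub>P\<^esub> m') \<odot>\<^bsub>L\<^esub> y i)"
        using m J by (intro k) auto
      also have "\<dots> = (\<Oplus>\<^bsub>L\<^esub>i\<in>?J. p i m \<odot>\<^bsub>L\<^esub> y i \<oplus>\<^bsub>L\<^esub> p i m' \<odot>\<^bsub>L\<^esub> y i)"
        using m pc y by (intro L.M.finsum_cong') (auto simp: left_hom_add[OF p] L.smult_l_distr)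
      also have "\<dots> = (\<Oplus>\<^bsub>L\<^esub>i\<in>?J. p i m \<odot>\<^bsub>L\<^esub> y i) \<oplus>\<^bsub>L\<^esub> (\<Oplus>\<^bsub>L\<^esub>i\<in>?J. p i m' \<odot>\<^bsub>L\<^esub> y i)"
        using m J by (intro L.M.finsum_addf kc)
      also have "\<dots> = k m \<oplus>\<^bsub>L\<^esub> k m'"
        by (subst (1 2) k[OF _ J]) (use m in auto)
      finally show "k (m \<oplus>\<^bsub>P\<^esub> m') = k m \<oplus>\<^bsub>L\<^esub> k m'" .
    next
      fix r m assume m: "r \<in> carrier R" "m \<in> carrier P"
      let ?J = "?supp m \<union> ?supp (r \<odot>\<^bsub>P\<^esub> m)"
      have J: "finite ?J" "?J \<subseteq> I" using fin m by auto
      have "k (r \<odot>\<^bsub>P\<^esub> m) = (\<Oplus>\<^bsub>L\<^esub>i\<in>?J. p i (r \<odot>\<^bsub>P\<^esub> m) \<odot>\<^bsub>L\<^esub> y i)"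
        using m J by (intro k) auto
      also have "\<dots> = (\<Oplus>\<^bsub>L\<^esub>i\<in>?J. r \<odot>\<^bsub>L\<^esub> (p i m \<odot>\<^bsub>L\<^esub> y i))"
        using m pc y by (intro L.M.finsum_cong') (auto simp: left_hom_smult[OF p] L.smult_assoc1)
      also have "\<dots> = r \<odot>\<^bsub>L\<^esub> (\<Oplus>\<^bsub>L\<^esub>i\<in>?J. p i m \<odot>\<^bsub>L\<^esub> y i)"
        using m J by (intro L.smult_finsum[symmetric] kc)
      also have "\<dots> = r \<odot>\<^bsub>L\<^esub> k m"
        by (subst k[OF m(2) J]) auto
      finally show "k (r \<odot>\<^bsub>P\<^esub> m) = r \<odot>\<^bsub>L\<^esub> k m" .
    qed (simp add: k_def)
    fix m assume m: "m \<in> carrier P"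
    have J: "finite (?supp m)" "?supp m \<subseteq> I" using fin m by auto
    have "h (k m) = (\<Oplus>\<^bsub>N\<^esub>i\<in>?supp m. h (p i m \<odot>\<^bsub>L\<^esub> y i))"
      using m J by (subst k[OF m J order_refl]) (intro left_hom_finsum[OF L N h] kc)
    also have "\<dots> = (\<Oplus>\<^bsub>N\<^esub>i\<in>?supp m. g (p i m \<odot>\<^bsub>P\<^esub> x i))"
      using m pc x y left_hom_closed[OF g]
      by (intro N.M.finsum_cong') (auto simp: left_hom_smult[OF h] left_hom_smult[OF g])
    also have "\<dots> = g (\<Oplus>\<^bsub>P\<^esub>i\<in>?supp m. p i m \<odot>\<^bsub>P\<^esub> x i)"
      using m pc x by (intro left_hom_finsum[OF P N g, symmetric]) auto
    also have "\<dots> = g m"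
      using sum[OF m J order_refl] by simp
    finally show "h (k m) = g m" .
  qed
qed

text \<open>A dual basis may be infinite, but finitely many generators have nonzero coordinates only
  at a finite set J of indices. By linearity the coordinates of every element then vanish outside
  J.\<close>

lemma in_add_regular_if_fg_projective:
  fixes P :: "('r, 'p, 'g) module_scheme"
  assumes "fin_generated R P" "projective R P"
  shows "in_add R (regular R) P"
proof -
  have P: "left_module R P" using assms(2) by (simp add: projective_def)
  interpret P: left_module R P by fact
  note R = left_module_regular[OF P.R.ring_axioms]
  obtain I :: "'p set" and x p where x: "\<And>i. i \<in> I \<Longrightarrow> x i \<in> carrier P"
    and p: "\<And>i. i \<in> I \<Longrightarrow> p i \<in> left_hom R P (regular R)"
    and fin: "\<And>m. m \<in> carrier P \<Longrightarrow> finite {i \<in> I. p i m \<noteq> \<zero>\<^bsub>R\<^esub>}"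
    and sum: "\<And>m J. m \<in> carrier P \<Longrightarrow> finite J \<Longrightarrow> J \<subseteq> I \<Longrightarrow> {i \<in> I. p i m \<noteq> \<zero>\<^bsub>R\<^esub>} \<subseteq> J \<Longrightarrow>
      m = (\<Oplus>\<^bsub>P\<^esub>i\<in>J. p i m \<odot>\<^bsub>P\<^esub> x i)"
    by (fact projective_dual_basis[OF assms(2)])
  obtain S where S: "S \<subseteq> carrier P" "finite S"
    "\<And>m. m \<in> carrier P \<Longrightarrow> \<exists>c\<in>S \<rightarrow> carrier R. m = (\<Oplus>\<^bsub>P\<^esub>s\<in>S. c s \<odot>\<^bsub>P\<^esub> s)"
    using assms(1) by (auto simp: fin_generated_def)
  define J where "J = (\<Union>s\<in>S. {i \<in> I. p i s \<noteq> \<zero>\<^bsub>R\<^esub>})"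
  have J: "finite J" "J \<subseteq> I" using S fin by (auto simp: J_def)
  have supp: "{i \<in> I. p i m \<noteq> \<zero>\<^bsub>R\<^esub>} \<subseteq> J" if m: "m \<in> carrier P" for m
  proof (intro subsetI, rule ccontr)
    fix i assume i: "i \<in> {i \<in> I. p i m \<noteq> \<zero>\<^bsub>R\<^esub>}" and "i \<notin> J"
    then have 0: "p i s = \<zero>\<^bsub>R\<^esub>" if "s \<in> S" for s using that by (auto simp: J_def)
    obtain c where c: "c \<in> S \<rightarrow> carrier R" "m = (\<Oplus>\<^bsub>P\<^esub>s\<in>S. c s \<odot>\<^bsub>P\<^esub> s)" using S(3)[OF m] by blast
    have iI: "i \<in> I" using i by simp
    have "p i m = (\<Oplus>\<^bsub>regular R\<^esub>s\<in>S. p i (c s \<odot>\<^bsub>P\<^esub> s))"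
      unfolding c(2) using S(1) c(1) by (intro left_hom_finsum[OF P R p[OF iI]]) auto
    also have "\<dots> = (\<Oplus>\<^bsub>regular R\<^esub>s\<in>S. \<zero>\<^bsub>R\<^esub>)"
      using S(1) c(1) unfolding regular_simps
      by (intro P.R.finsum_cong') (auto simp: left_hom_smult[OF p[OF iI]] 0 Pi_def subset_iff)
    finally show False using i by simp
  qed
  show ?thesis
  proof (rule in_addI[OF R P J(1), of p "\<lambda>i. \<lambda>r\<in>carrier R. r \<odot>\<^bsub>P\<^esub> x i"])
    show "p j \<in> left_hom R P (regular R)" if "j \<in> J" for j using that J p by auto
    show "(\<lambda>r\<in>carrier R. r \<odot>\<^bsub>P\<^esub> x j) \<in> left_hom R (regular R) P" if "j \<in> J" for j
      using that J x by (intro smult_right_hom[OF P]) auto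
    fix m assume m: "m \<in> carrier P"
    have "m = (\<Oplus>\<^bsub>P\<^esub>i\<in>J. p i m \<odot>\<^bsub>P\<^esub> x i)" using sum[OF m J supp[OF m]] .
    also have "\<dots> = (\<Oplus>\<^bsub>P\<^esub>i\<in>J. (\<lambda>r\<in>carrier R. r \<odot>\<^bsub>P\<^esub> x i) (p i m))"
      using left_hom_closed[OF p _ , of _ m] m J(2) x by (intro P.M.finsum_cong') (auto simp: subset_iff)
    finally show "m = (\<Oplus>\<^bsub>P\<^esub>i\<in>J. (\<lambda>r\<in>carrier R. r \<odot>\<^bsub>P\<^esub> x i) (p i m))" .
  qed
qed

text \<open>
  Generators with equal values are merged, since \<^const>\<open>fin_generated\<close> and \<^const>\<open>projective\<close> index
  them by elements of the module.
\<close>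

lemma in_add_regularE:
  assumes "in_add R (regular R) P"
  obtains S p where "finite S" "S \<subseteq> carrier P" "\<And>t. t \<in> S \<Longrightarrow> p t \<in> left_hom R P (regular R)"
    "\<And>m. m \<in> carrier P \<Longrightarrow> m = (\<Oplus>\<^bsub>P\<^esub>t\<in>S. p t m \<odot>\<^bsub>P\<^esub> t)"
proof -
  have P: "left_module R P" using assms by (simp add: in_add_def)
  interpret P: left_module R P by fact
  note R = left_module_regular[OF P.R.ring_axioms]
  obtain n :: nat and s q where s: "\<And>i. i < n \<Longrightarrow> s i \<in> left_hom R P (regular R)"
    and q: "\<And>i. i < n \<Longrightarrow> q i \<in> left_hom R (regular R) P"
    and qs: "\<And>m. m \<in> carrier P \<Longrightarrow> m = (\<Oplus>\<^bsub>P\<^esub>i\<in>{..<n}. q i (s i m))"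
    by (fact in_addE[OF assms R])
  define x where "x = (\<lambda>i. q i \<one>\<^bsub>R\<^esub>)"
  define S where "S = x ` {..<n}"
  let ?F = "\<lambda>t. {i \<in> {..<n}. x i = t}"
  define p where "p = (\<lambda>t. \<lambda>m\<in>carrier P. \<Oplus>\<^bsub>regular R\<^esub>i\<in>?F t. s i m)"
  have x: "x i \<in> carrier P" if "i < n" for i using left_hom_closed[OF q[OF that]] by (auto simp: x_def)
  have sc: "s i m \<in> carrier R" if "i < n" "m \<in> carrier P" for i m using left_hom_closed[OF s] that by auto
  have qr: "q i r = r \<odot>\<^bsub>P\<^esub> x i" if "i < n" "r \<in> carrier R" for i r
    using left_hom_smult[OF q[OF that(1)] that(2), of "\<one>\<^bsub>R\<^esub>"] that by (simp add: x_def)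
  show thesis
  proof
    show "finite S" "S \<subseteq> carrier P" using x by (auto simp: S_def)
    show "p t \<in> left_hom R P (regular R)" for t
      unfolding p_def by (rule left_hom_sum[OF P R]) (auto intro: s)
    fix m assume m: "m \<in> carrier P"
    have "m = (\<Oplus>\<^bsub>P\<^esub>i\<in>{..<n}. s i m \<odot>\<^bsub>P\<^esub> x i)"
      using m sc x qr by (subst qs[OF m]) (intro P.M.finsum_cong', auto)
    also have "{..<n} = (\<Union>t\<in>S. ?F t)" by (auto simp: S_def)
    also have "(\<Oplus>\<^bsub>P\<^esub>i\<in>(\<Union>t\<in>S. ?F t). s i m \<odot>\<^bsub>P\<^esub> x i) = (\<Oplus>\<^bsub>P\<^esub>t\<in>S. \<Oplus>\<^bsub>P\<^esub>i\<in>?F t. s i m \<odot>\<^bsub>P\<^esub> x i)"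
      using m sc x by (intro P.M.add.finprod_UN_disjoint) (auto simp: S_def pairwise_def disjnt_def)
    also have "\<dots> = (\<Oplus>\<^bsub>P\<^esub>t\<in>S. p t m \<odot>\<^bsub>P\<^esub> t)"
    proof (rule P.M.finsum_cong'[OF refl])
      show "(\<lambda>t. p t m \<odot>\<^bsub>P\<^esub> t) \<in> S \<rightarrow> carrier P"
        using m sc x by (auto simp: p_def S_def intro!: P.smult_closed P.R.finsum_closed)
      fix t assume "t \<in> S"
      then have t: "t \<in> carrier P" using x by (auto simp: S_def)
      have "p t m \<odot>\<^bsub>P\<^esub> t = (\<Oplus>\<^bsub>P\<^esub>i\<in>?F t. s i m \<odot>\<^bsub>P\<^esub> t)"
        using m t sc by (auto simp: p_def intro!: P.finsum_smult)
      also have "\<dots> = (\<Oplus>\<^bsub>P\<^esub>i\<in>?F t. s i m \<odot>\<^bsub>P\<^esub> x i)"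
        using m x sc by (intro P.M.finsum_cong') auto
      finally show "(\<Oplus>\<^bsub>P\<^esub>i\<in>?F t. s i m \<odot>\<^bsub>P\<^esub> x i) = p t m \<odot>\<^bsub>P\<^esub> t" by simp
    qed
    finally show "m = (\<Oplus>\<^bsub>P\<^esub>t\<in>S. p t m \<odot>\<^bsub>P\<^esub> t)" .
  qed
qed

lemma fin_generated_if_in_add_regular:
  assumes "in_add R (regular R) P"
  shows "fin_generated R P"
proof -
  obtain S p where S: "finite S" "S \<subseteq> carrier P" and p: "\<And>t. t \<in> S \<Longrightarrow> p t \<in> left_hom R P (regular R)"
    and sum: "\<And>m. m \<in> carrier P \<Longrightarrow> m = (\<Oplus>\<^bsub>P\<^esub>t\<in>S. p t m \<odot>\<^bsub>P\<^esub> t)"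
    by (fact in_add_regularE[OF assms])
  have "\<exists>c\<in>S \<rightarrow> carrier R. m = (\<Oplus>\<^bsub>P\<^esub>t\<in>S. c t \<odot>\<^bsub>P\<^esub> t)" if m: "m \<in> carrier P" for m
    using sum[OF m] left_hom_closed[OF p _, of _ m] m by (intro bexI[of _ "\<lambda>t. p t m"]) auto
  then show ?thesis using S assms by (auto simp: fin_generated_def in_add_def)
qed

lemma projective_if_in_add_regular:
  assumes "in_add R (regular R) P"
  shows "projective R P"
proof -
  have P: "left_module R P" using assms by (simp add: in_add_def)
  interpret P: left_module R P by fact
  note R = left_module_regular[OF P.R.ring_axioms]
  obtain S p where S: "finite S" "S \<subseteq> carrier P" and p: "\<And>t. t \<in> S \<Longrightarrow> p t \<in> left_hom R P (regular R)"
    and sum: "\<And>m. m \<in> carrier P \<Longrightarrow> m = (\<Oplus>\<^bsub>P\<^esub>t\<in>S. p t m \<odot>\<^bsub>P\<^esub> t)"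
    by (fact in_add_regularE[OF assms])
  let ?C = "copower S (regular R)"
  note C = left_module_copower[OF R, of S]
  have pc: "p t m \<in> carrier R" if "t \<in> S" "m \<in> carrier P" for t m
    using left_hom_closed[OF p[OF that(1)] that(2)] by simp
  let ?s = "\<lambda>m\<in>carrier P. \<lambda>t\<in>S. p t m"
  let ?h = "\<lambda>t. compose (carrier ?C) (\<lambda>r\<in>carrier R. r \<odot>\<^bsub>P\<^esub> t) (\<lambda>f\<in>carrier ?C. f t)"
  let ?q = "\<lambda>f\<in>carrier ?C. \<Oplus>\<^bsub>P\<^esub>t\<in>S. ?h t f"
  have s: "?s \<in> left_hom R P ?C"
    by (rule left_hom_restrictI[OF P])
      (auto simp: S(1) pc left_hom_add[OF p] left_hom_smult[OF p] cong: restrict_cong)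
  have q: "?q \<in> left_hom R ?C P"
    using S by (intro left_hom_sum C P left_hom_compose[where N = "regular R"] copower_eval_hom R smult_right_hom) auto
  have "?q (?s m) = m" if m: "m \<in> carrier P" for m
  proof -
    have sm: "?s m \<in> carrier ?C" using left_hom_closed[OF s m] .
    have "?q (?s m) = (\<Oplus>\<^bsub>P\<^esub>t\<in>S. p t m \<odot>\<^bsub>P\<^esub> t)"
      using sm m S(2) pc by (simp only: restrict_apply' compose_eq) (intro P.M.finsum_cong', auto)
    then show ?thesis using sum[OF m] by simp
  qed
  then have "iso_to_summand R P ?C" by (rule iso_to_summandI[OF P C s q])
  with P show ?thesis by (auto simp: projective_def)
qed

text \<open>Transport of structure, used to copy a module into an element type fixed in advance; the
  operations pull back along the inverse of g on the carrier, compute in M and push forward.\<close>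

definition image_module :: "('m \<Rightarrow> 'n) \<Rightarrow> ('r, 'm, 'f) module_scheme \<Rightarrow> ('r, 'n) module"
  where "image_module g M = (let h = inv_into (carrier M) g in
    \<lparr>carrier = g ` carrier M, monoid.mult = undefined, one = undefined,
     ring.zero = g \<zero>\<^bsub>M\<^esub>, ring.add = (\<lambda>x y. g (h x \<oplus>\<^bsub>M\<^esub> h y)), smult = (\<lambda>a x. g (a \<odot>\<^bsub>M\<^esub> h x))\<rparr>)"

lemma image_module_iso:
  assumes M: "left_module R M" and g: "inj_on g (carrier M)"
  shows "left_module R (image_module g M)"
    and "restrict g (carrier M) \<in> left_hom R M (image_module g M)"
    and "restrict (inv_into (carrier M) g) (carrier (image_module g M)) \<in> left_hom R (image_module g M) M"
    and "carrier (image_module g M) = g ` carrier M"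
proof -
  interpret M: left_module R M by fact
  let ?h = "inv_into (carrier M) g"
  have h [simp]: "?h (g x) = x" if "x \<in> carrier M" for x using g that by simp
  have c [simp]: "carrier (image_module g M) = g ` carrier M"
    and z [simp]: "\<zero>\<^bsub>image_module g M\<^esub> = g \<zero>\<^bsub>M\<^esub>"
    and a [simp]: "x \<oplus>\<^bsub>image_module g M\<^esub> y = g (?h x \<oplus>\<^bsub>M\<^esub> ?h y)"
    and m [simp]: "r \<odot>\<^bsub>image_module g M\<^esub> x = g (r \<odot>\<^bsub>M\<^esub> ?h x)" for x y r
    by (simp_all add: image_module_def Let_def)
  show L: "left_module R (image_module g M)"
  proof (intro left_moduleI abelian_groupI M.R.ring_axioms)
    fix y assume "y \<in> carrier (image_module g M)"
    then obtain x where x: "x \<in> carrier M" "y = g x" by auto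
    then show "\<exists>y'\<in>carrier (image_module g M). y' \<oplus>\<^bsub>image_module g M\<^esub> y = \<zero>\<^bsub>image_module g M\<^esub>"
      by (intro bexI[of _ "g (\<ominus>\<^bsub>M\<^esub> x)"]) (auto simp: M.M.l_neg)
  qed (auto simp: M.M.a_ac M.smult_l_distr M.smult_r_distr M.smult_assoc1)
  show "restrict g (carrier M) \<in> left_hom R M (image_module g M)"
    by (rule left_hom_restrictI[OF M]) auto
  show "restrict ?h (carrier (image_module g M)) \<in> left_hom R (image_module g M) M"
    by (rule left_hom_restrictI[OF L]) auto
  show "carrier (image_module g M) = g ` carrier M" by simp
qed

section \<open>Independence of Ext from the resolution\<close>

lemma mem_ext_cocycles:
  "f \<in> ext_cocycles R P d N i \<longleftrightarrow>
    f \<in> left_hom R (P i) N \<and> (\<forall>x\<in>carrier (P (Suc i)). f (d i x) = \<zero>\<^bsub>N\<^esub>)"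
  by (auto simp: ext_cocycles_def compose_def zero_hom_def fun_eq_iff restrict_def)

lemma precomp_eqI:
  assumes "f \<in> left_hom R M N" "\<And>x. x \<in> carrier M \<Longrightarrow> f x = g (h x)"
  shows "f = precomp M h g"
proof
  show "f x = precomp M h g x" for x
    by (cases "x \<in> carrier M") (simp_all add: assms(2) compose_def left_hom_undefined[OF assms(1)])
qed

section \<open>Exactness of a resolution in terms of elements\<close>

context
  fixes R P d e M
  assumes res: "projective_resolution R P d e M"
begin

lemma resolution_module: "left_module R (P n)"
  using res by (simp add: projective_resolution_def projective_def)

lemma resolution_hom: "d n \<in> left_hom R (P (Suc n)) (P n)" "e \<in> left_hom R (P 0) M"
  using res by (auto simp: projective_resolution_def)

lemma resolution_kernel:
  "a_kernel (P (Suc n)) (P n) (d n) = d (Suc n) ` carrier (P (Suc (Suc n)))"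
  "a_kernel (P 0) M e = d 0 ` carrier (P (Suc 0))"
  using res by (simp_all add: projective_resolution_def)

lemma resolution_exact:
  "x \<in> carrier (P (Suc n)) \<Longrightarrow> d n x = \<zero>\<^bsub>P n\<^esub> \<Longrightarrow> x \<in> d (Suc n) ` carrier (P (Suc (Suc n)))"
  "x \<in> carrier (P 0) \<Longrightarrow> e x = \<zero>\<^bsub>M\<^esub> \<Longrightarrow> x \<in> d 0 ` carrier (P (Suc 0))"
  unfolding resolution_kernel[symmetric] by (simp_all add: mem_a_kernel)

lemma resolution_complex:
  assumes "x \<in> carrier (P (Suc (Suc n)))"
  shows "d n (d (Suc n) x) = \<zero>\<^bsub>P n\<^esub>"
  using imageI[OF assms, of "d (Suc n)"] unfolding resolution_kernel[symmetric] mem_a_kernel by simp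

lemma resolution_complex_0:
  assumes "x \<in> carrier (P (Suc 0))"
  shows "e (d 0 x) = \<zero>\<^bsub>M\<^esub>"
  using imageI[OF assms, of "d 0"] unfolding resolution_kernel[symmetric] mem_a_kernel by simp

end

text \<open>The comparison theorem for projective resolutions: each component is a lift through d',
  and exactness of the target resolution makes the next lift possible.\<close>

lemma resolution_chain_map:
  assumes M: "left_module R M"
    and P: "projective_resolution R P d e M" and Q: "projective_resolution R Q d' e' M"
  obtains \<phi> where "\<And>n. \<phi> n \<in> left_hom R (P n) (Q n)"
    "\<And>x. x \<in> carrier (P 0) \<Longrightarrow> e' (\<phi> 0 x) = e x"
    "\<And>n x. x \<in> carrier (P (Suc n)) \<Longrightarrow> d' n (\<phi> (Suc n) x) = \<phi> n (d n x)"
proof -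
  have proj: "projective R (P n)" for n using P by (simp add: projective_resolution_def)
  have aug: "e ` carrier (P 0) \<subseteq> e' ` carrier (Q 0)" using P Q by (simp add: projective_resolution_def)
  note modP = resolution_module[OF P] and modQ = resolution_module[OF Q]
  note dP = resolution_hom[OF P] and dQ = resolution_hom[OF Q]
  have dc: "d n x \<in> carrier (P n)" if "x \<in> carrier (P (Suc n))" for n x using left_hom_closed[OF dP(1) that] .
  \<comment> \<open>\<open>I\<close> is the invariant of the recursion. Its last clause is the image
    condition for lifting the next component; the clause for n = 0 carries the compatibility with
    the augmentations. \<open>S\<close> links consecutive components.\<close>
  define I where "I = (\<lambda>n \<phi>. \<phi> \<in> left_hom R (P n) (Q n) \<and> (n = 0 \<longrightarrow> (\<forall>x\<in>carrier (P 0). e' (\<phi> x) = e x)) \<and>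
    (\<forall>x\<in>carrier (P (Suc n)). \<phi> (d n x) \<in> d' n ` carrier (Q (Suc n))))"
  define S where "S = (\<lambda>n \<phi> \<phi>'. \<forall>x\<in>carrier (P (Suc n)). d' n (\<phi>' x) = \<phi> (d n x))"
  have "\<exists>\<phi>. \<forall>n. I n (\<phi> n) \<and> S n (\<phi> n) (\<phi> (Suc n))"
  proof (rule dependent_nat_choice)
    obtain k where k: "k \<in> left_hom R (P 0) (Q 0)" "\<And>x. x \<in> carrier (P 0) \<Longrightarrow> e' (k x) = e x"
      by (rule projective_lift[OF proj modQ M dQ(2) dP(2) aug]) blast
    have "k (d 0 x) \<in> d' 0 ` carrier (Q (Suc 0))" if x: "x \<in> carrier (P (Suc 0))" for x
      using k(2)[OF dc[OF x]] resolution_complex_0[OF P x]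
      by (intro resolution_exact(2)[OF Q] left_hom_closed[OF k(1)] dc x) simp
    with k have "I 0 k" by (simp add: I_def)
    then show "\<exists>\<phi>. I 0 \<phi>" by blast
  next
    fix \<phi> n assume "I n \<phi>"
    then have \<phi>: "\<phi> \<in> left_hom R (P n) (Q n)"
      and im: "\<And>x. x \<in> carrier (P (Suc n)) \<Longrightarrow> \<phi> (d n x) \<in> d' n ` carrier (Q (Suc n))"
      by (auto simp: I_def)
    let ?g = "compose (carrier (P (Suc n))) \<phi> (d n)"
    have g: "?g \<in> left_hom R (P (Suc n)) (Q n)" by (rule left_hom_compose[OF modP dP(1) \<phi>])
    have "?g ` carrier (P (Suc n)) \<subseteq> d' n ` carrier (Q (Suc n))"
      using im by (auto simp: compose_def)
    then obtain k where k: "k \<in> left_hom R (P (Suc n)) (Q (Suc n))"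
      "\<And>x. x \<in> carrier (P (Suc n)) \<Longrightarrow> d' n (k x) = ?g x"
      by (rule projective_lift[OF proj modQ modQ dQ(1) g]) blast
    have ke: "d' n (k x) = \<phi> (d n x)" if "x \<in> carrier (P (Suc n))" for x
      using k(2)[OF that] that by (simp add: compose_def)
    have "k (d (Suc n) x) \<in> d' (Suc n) ` carrier (Q (Suc (Suc n)))" if x: "x \<in> carrier (P (Suc (Suc n)))" for x
      using ke[OF dc[OF x]] resolution_complex[OF P x] left_hom_zero[OF modP modQ \<phi>]
      by (intro resolution_exact(1)[OF Q] left_hom_closed[OF k(1)] dc x) simp
    then have "I (Suc n) k" using k(1) by (simp add: I_def)
    moreover have "S n \<phi> k" using ke by (simp add: S_def)
    ultimately show "\<exists>\<phi>'. I (Suc n) \<phi>' \<and> S n \<phi> \<phi>'" by blast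
  qed
  then obtain \<phi> where "\<And>n. I n (\<phi> n)" "\<And>n. S n (\<phi> n) (\<phi> (Suc n))" by blast
  then show thesis by (intro that[of \<phi>]) (auto simp: I_def S_def)
qed

text \<open>A chain endomorphism lying over the zero map of M is null homotopic. The relation is
  recorded in the positive degrees, which are the ones seen by Ext in positive degree.\<close>

lemma resolution_null_homotopy:
  assumes res: "projective_resolution R P d e M"
    and M: "left_module R M" and \<tau>: "\<And>n. \<tau> n \<in> left_hom R (P n) (P n)"
    and \<tau>0: "\<And>x. x \<in> carrier (P 0) \<Longrightarrow> e (\<tau> 0 x) = \<zero>\<^bsub>M\<^esub>"
    and \<tau>d: "\<And>n x. x \<in> carrier (P (Suc n)) \<Longrightarrow> d n (\<tau> (Suc n) x) = \<tau> n (d n x)"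
  obtains s where "\<And>n. s n \<in> left_hom R (P n) (P (Suc n))"
    "\<And>n x. x \<in> carrier (P (Suc n)) \<Longrightarrow> d (Suc n) (s (Suc n) x) = \<tau> (Suc n) x \<ominus>\<^bsub>P (Suc n)\<^esub> s n (d n x)"
proof -
  have proj: "projective R (P n)" for n using res by (simp add: projective_resolution_def)
  note mod = resolution_module[OF res]
  note dh = resolution_hom(1)[OF res]
  have \<tau>c: "\<tau> n x \<in> carrier (P n)" if "x \<in> carrier (P n)" for n x using left_hom_closed[OF \<tau> that] .
  have dc: "d n x \<in> carrier (P n)" if "x \<in> carrier (P (Suc n))" for n x using left_hom_closed[OF dh that] .
  \<comment> \<open>The invariant asks for d s = \<tau> on boundaries. It makes \<tau> - s d a map
    into the cycles of the next degree, hence into the image of the next differential, where it can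
    be lifted.\<close>
  define I where "I = (\<lambda>n s. s \<in> left_hom R (P n) (P (Suc n)) \<and>
    (\<forall>x\<in>carrier (P (Suc n)). d n (s (d n x)) = \<tau> n (d n x)))"
  define Q where "Q = (\<lambda>n s s'. \<forall>x\<in>carrier (P (Suc n)).
    d (Suc n) (s' x) = \<tau> (Suc n) x \<ominus>\<^bsub>P (Suc n)\<^esub> s (d n x))"
  have "\<exists>s. \<forall>n. I n (s n) \<and> Q n (s n) (s (Suc n))"
  proof (rule dependent_nat_choice)
    have "\<tau> 0 ` carrier (P 0) \<subseteq> d 0 ` carrier (P (Suc 0))"
      using \<tau>c \<tau>0 by (auto intro!: resolution_exact(2)[OF res])
    then obtain k where "k \<in> left_hom R (P 0) (P (Suc 0))" "\<And>x. x \<in> carrier (P 0) \<Longrightarrow> d 0 (k x) = \<tau> 0 x"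
      by (rule projective_lift[OF proj mod mod dh \<tau>]) blast
    then have "I 0 k" using dc by (simp add: I_def)
    then show "\<exists>s. I 0 s" by blast
  next
    fix s n assume "I n s"
    then have s: "s \<in> left_hom R (P n) (P (Suc n))"
      and sd: "\<And>x. x \<in> carrier (P (Suc n)) \<Longrightarrow> d n (s (d n x)) = \<tau> n (d n x)"
      by (auto simp: I_def)
    interpret Pn: left_module R "P n" by (rule mod)
    interpret Ps: left_module R "P (Suc n)" by (rule mod)
    have sc: "s x \<in> carrier (P (Suc n))" if "x \<in> carrier (P n)" for x using left_hom_closed[OF s that] .
    let ?g = "\<lambda>x\<in>carrier (P (Suc n)). \<tau> (Suc n) x \<ominus>\<^bsub>P (Suc n)\<^esub> compose (carrier (P (Suc n))) s (d n) x"
    have g: "?g \<in> left_hom R (P (Suc n)) (P (Suc n))"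
      by (intro left_hom_minus_hom mod \<tau> left_hom_compose[OF mod dh s])
    have ge: "?g x = \<tau> (Suc n) x \<ominus>\<^bsub>P (Suc n)\<^esub> s (d n x)" if "x \<in> carrier (P (Suc n))" for x
      using that by (simp add: compose_def)
    have "?g ` carrier (P (Suc n)) \<subseteq> d (Suc n) ` carrier (P (Suc (Suc n)))"
    proof safe
      fix x assume x: "x \<in> carrier (P (Suc n))"
      have "d n (?g x) = d n (\<tau> (Suc n) x) \<ominus>\<^bsub>P n\<^esub> d n (s (d n x))"
        unfolding ge[OF x] a_minus_def using x \<tau>c sc dc
        by (simp add: compose_eq left_hom_add[OF dh] left_hom_minus[OF mod mod dh])
      also have "\<dots> = \<zero>\<^bsub>P n\<^esub>" using x \<tau>c dc by (simp add: \<tau>d sd Pn.M.r_neg a_minus_def)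
      finally show "?g x \<in> d (Suc n) ` carrier (P (Suc (Suc n)))"
        by (intro resolution_exact(1)[OF res] left_hom_closed[OF g] x)
    qed
    then obtain k where k: "k \<in> left_hom R (P (Suc n)) (P (Suc (Suc n)))"
      "\<And>x. x \<in> carrier (P (Suc n)) \<Longrightarrow> d (Suc n) (k x) = ?g x"
      by (rule projective_lift[OF proj mod mod dh g]) blast
    have ke: "d (Suc n) (k x) = \<tau> (Suc n) x \<ominus>\<^bsub>P (Suc n)\<^esub> s (d n x)" if "x \<in> carrier (P (Suc n))" for x
      using k(2)[OF that] ge[OF that] by simp
    have "d (Suc n) (k (d (Suc n) x)) = \<tau> (Suc n) (d (Suc n) x)" if x: "x \<in> carrier (P (Suc (Suc n)))" for x
      using ke[OF dc[OF x]] x \<tau>c dc left_hom_zero[OF mod mod s]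
      by (simp add: resolution_complex[OF res] a_minus_def)
    then have "I (Suc n) k" using k(1) by (simp add: I_def)
    moreover have "Q n s k" using ke by (simp add: Q_def)
    ultimately show "\<exists>s'. I (Suc n) s' \<and> Q n s s'" by blast
  qed
  then obtain s where "\<And>n. I n (s n)" "\<And>n. Q n (s n) (s (Suc n))" by blast
  then show thesis by (intro that[of s]) (auto simp: I_def Q_def)
qed

text \<open>Two resolutions are compared by chain maps whose composite is homotopic to the identity.\<close>

lemma ext_independent_of_resolution:
  assumes P: "projective_resolution R P d e M" and Q: "projective_resolution R Q d' e' M"
    and M: "left_module R M" and N: "left_module R N"
    and van: "ext_cocycles R Q d' N (Suc k) \<subseteq> ext_coboundaries R Q d' N (Suc k)"
  shows "ext_cocycles R P d N (Suc k) = ext_coboundaries R P d N (Suc k)"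
proof
  note modP = resolution_module[OF P] and modQ = resolution_module[OF Q]
  note dP = resolution_hom[OF P] and dQ = resolution_hom[OF Q]
  interpret N: left_module R N by fact
  show "ext_coboundaries R P d N (Suc k) \<subseteq> ext_cocycles R P d N (Suc k)"
    using left_hom_closed[OF dP(1)]
    by (auto simp: mem_ext_cocycles compose_eq resolution_complex[OF P] left_hom_zero[OF modP N]
        intro!: left_hom_compose[OF modP dP(1)])
  show "ext_cocycles R P d N (Suc k) \<subseteq> ext_coboundaries R P d N (Suc k)"
  proof
    fix f assume "f \<in> ext_cocycles R P d N (Suc k)"
    then have f: "f \<in> left_hom R (P (Suc k)) N"
      and fd: "\<And>x. x \<in> carrier (P (Suc (Suc k))) \<Longrightarrow> f (d (Suc k) x) = \<zero>\<^bsub>N\<^esub>"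
      by (auto simp: mem_ext_cocycles)
    obtain \<phi> where \<phi>: "\<And>n. \<phi> n \<in> left_hom R (P n) (Q n)"
      and \<phi>0: "\<And>x. x \<in> carrier (P 0) \<Longrightarrow> e' (\<phi> 0 x) = e x"
      and \<phi>d: "\<And>n x. x \<in> carrier (P (Suc n)) \<Longrightarrow> d' n (\<phi> (Suc n) x) = \<phi> n (d n x)"
      by (rule resolution_chain_map[OF M P Q]) blast
    obtain \<psi> where \<psi>: "\<And>n. \<psi> n \<in> left_hom R (Q n) (P n)"
      and \<psi>0: "\<And>x. x \<in> carrier (Q 0) \<Longrightarrow> e (\<psi> 0 x) = e' x"
      and \<psi>d: "\<And>n x. x \<in> carrier (Q (Suc n)) \<Longrightarrow> d n (\<psi> (Suc n) x) = \<psi> n (d' n x)"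
      by (rule resolution_chain_map[OF M Q P]) blast
    have \<phi>c: "\<phi> n x \<in> carrier (Q n)" if "x \<in> carrier (P n)" for n x using left_hom_closed[OF \<phi> that] .
    have \<psi>c: "\<psi> n x \<in> carrier (P n)" if "x \<in> carrier (Q n)" for n x using left_hom_closed[OF \<psi> that] .
    have dc: "d n x \<in> carrier (P n)" if "x \<in> carrier (P (Suc n))" for n x using left_hom_closed[OF dP(1) that] .
    have fc: "f x \<in> carrier N" if "x \<in> carrier (P (Suc k))" for x using left_hom_closed[OF f that] .
    \<comment> \<open>The difference between the identity and the round trip through Q lies over the
      zero map of M, hence is null homotopic. It is written with an explicit identity map and with
      \<open>compose\<close> to fit \<open>left_hom_minus_hom\<close>.\<close>
    define \<tau> where "\<tau> = (\<lambda>n. \<lambda>x\<in>carrier (P n). (\<lambda>x\<in>carrier (P n). x) x \<ominus>\<^bsub>P n\<^esub> compose (carrier (P n)) (\<psi> n) (\<phi> n) x)"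
    have \<tau>: "\<tau> n \<in> left_hom R (P n) (P n)" for n
      unfolding \<tau>_def by (intro left_hom_minus_hom modP left_hom_id left_hom_compose[OF modP \<phi> \<psi>])
    have \<tau>e: "\<tau> n x = x \<ominus>\<^bsub>P n\<^esub> \<psi> n (\<phi> n x)" if "x \<in> carrier (P n)" for n x
      using that by (simp add: \<tau>_def compose_def)
    have "e (\<tau> 0 x) = \<zero>\<^bsub>M\<^esub>" if x: "x \<in> carrier (P 0)" for x
    proof -
      interpret M: left_module R M by fact
      interpret P0: left_module R "P 0" by (rule modP)
      show ?thesis using x \<phi>c \<psi>c left_hom_closed[OF dP(2) x]
        by (simp add: \<tau>e a_minus_def left_hom_add[OF dP(2)] left_hom_minus[OF modP M dP(2)] \<psi>0 \<phi>0 M.M.r_neg)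
    qed
    moreover have "d n (\<tau> (Suc n) x) = \<tau> n (d n x)" if x: "x \<in> carrier (P (Suc n))" for n x
    proof -
      interpret Pn: left_module R "P (Suc n)" by (rule modP)
      show ?thesis using x \<phi>c \<psi>c dc
        by (simp add: \<tau>e a_minus_def left_hom_add[OF dP(1)] left_hom_minus[OF modP modP dP(1)] \<psi>d \<phi>d)
    qed
    ultimately obtain s where s: "\<And>n. s n \<in> left_hom R (P n) (P (Suc n))"
      and sd: "\<And>n x. x \<in> carrier (P (Suc n)) \<Longrightarrow> d (Suc n) (s (Suc n) x) = \<tau> (Suc n) x \<ominus>\<^bsub>P (Suc n)\<^esub> s n (d n x)"
      by (rule resolution_null_homotopy[OF P M \<tau>]) blast+
    have "compose (carrier (Q (Suc k))) f (\<psi> (Suc k)) \<in> ext_cocycles R Q d' N (Suc k)"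
      using left_hom_closed[OF dQ(1)] \<psi>c by (auto simp: mem_ext_cocycles compose_def fd simp flip: \<psi>d
        intro!: left_hom_compose[OF modQ \<psi> f, unfolded compose_def])
    then obtain g where g: "g \<in> left_hom R (Q k) N"
      and "compose (carrier (Q (Suc k))) f (\<psi> (Suc k)) = compose (carrier (Q (Suc k))) g (d' k)"
      using van by auto
    then have ge: "f (\<psi> (Suc k) x) = g (d' k x)" if "x \<in> carrier (Q (Suc k))" for x
      using that by (metis compose_eq)
    \<comment> \<open>The homotopy gives x = d(s(x)) + s(d(x)) + \<psi>(\<phi>(x)). The cocycle f
      kills the first term, and on the last term f \<circ> \<psi> = g \<circ> d', which is g \<circ>
      \<phi> applied to d(x); this leaves f = G \<circ> d.\<close>
    define G where "G = (\<lambda>x\<in>carrier (P k). compose (carrier (P k)) f (s k) x \<oplus>\<^bsub>N\<^esub> compose (carrier (P k)) g (\<phi> k) x)"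
    have G: "G \<in> left_hom R (P k) N"
      unfolding G_def by (intro left_hom_add_hom modP N left_hom_compose[OF modP s f] left_hom_compose[OF modP \<phi> g])
    have "f = precomp (P (Suc k)) (d k) G"
    proof (rule precomp_eqI[OF f])
      fix x assume x: "x \<in> carrier (P (Suc k))"
      interpret Pk: left_module R "P (Suc k)" by (rule modP)
      let ?y = "s k (d k x)" and ?z = "\<psi> (Suc k) (\<phi> (Suc k) x)" and ?w = "d (Suc k) (s (Suc k) x)"
      have c: "?y \<in> carrier (P (Suc k))" "?z \<in> carrier (P (Suc k))" "s (Suc k) x \<in> carrier (P (Suc (Suc k)))"
        using x dc \<phi>c \<psi>c left_hom_closed[OF s] by auto
      then have cw: "?w \<in> carrier (P (Suc k))" using dc by simp
      have "?w = (x \<ominus>\<^bsub>P (Suc k)\<^esub> ?z) \<ominus>\<^bsub>P (Suc k)\<^esub> ?y" using x by (simp add: sd \<tau>e)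
      then have "?w \<oplus>\<^bsub>P (Suc k)\<^esub> (?y \<oplus>\<^bsub>P (Suc k)\<^esub> ?z) = x"
        using x c by (simp add: a_minus_def Pk.M.a_assoc Pk.M.r_neg1 Pk.M.l_neg)
      then have "f x = f ?w \<oplus>\<^bsub>N\<^esub> (f ?y \<oplus>\<^bsub>N\<^esub> f ?z)"
        using c cw by (metis left_hom_add[OF f] Pk.M.a_closed)
      also have "\<dots> = f ?y \<oplus>\<^bsub>N\<^esub> f ?z" using fd c fc by simp
      also have "f ?z = g (\<phi> k (d k x))" using ge[OF \<phi>c[OF x]] \<phi>d[OF x] by simp
      finally show "f x = G (d k x)" using dc[OF x] by (simp add: G_def compose_def)
    qed
    then show "f \<in> ext_coboundaries R P d N (Suc k)" using G by auto
  qed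
qed

section \<open>Induced modules along a centrally projective extension\<close>

text \<open>Restriction of scalars for an arbitrary A-module; \<open>restrict_scalars\<close> takes
  the ring A itself as its argument.\<close>

definition restricted :: "('r \<Rightarrow> 'a) \<Rightarrow> ('a, 'm, 'g) module_scheme \<Rightarrow> ('r, 'm) module"
  where "restricted \<iota> N = \<lparr>carrier = carrier N, monoid.mult = undefined, one = undefined,
    ring.zero = \<zero>\<^bsub>N\<^esub>, ring.add = ring.add N, smult = (\<lambda>r x. \<iota> r \<odot>\<^bsub>N\<^esub> x)\<rparr>"

lemma restricted_simps [simp]:
  "carrier (restricted \<iota> N) = carrier N" "\<zero>\<^bsub>restricted \<iota> N\<^esub> = \<zero>\<^bsub>N\<^esub>"
  "add (restricted \<iota> N) = add N" "r \<odot>\<^bsub>restricted \<iota> N\<^esub> x = \<iota> r \<odot>\<^bsub>N\<^esub> x"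
  "finsum (restricted \<iota> N) = finsum N"
  by (auto simp: restricted_def finsum_def finprod_def fun_eq_iff)

text \<open>The data of a split pair of bimodule maps between A and a power of R:
  \<open>\<alpha>_left\<close> and \<open>\<alpha>_right\<close> concern A \<rightarrow> R^n,
  \<open>c_comm\<close> concerns the way back, and \<open>basis\<close> says that the composite is
  the identity of A. No independence is implied: \<open>\<alpha> i (c j)\<close> need not be a
  Kronecker delta.\<close>

locale central_basis = R: ring R + A: ring A
  for R :: "('r, 'e) ring_scheme" and A :: "('a, 'f) ring_scheme" +
  fixes \<iota> :: "'r \<Rightarrow> 'a" and n :: nat and \<alpha> :: "nat \<Rightarrow> 'a \<Rightarrow> 'r" and c :: "nat \<Rightarrow> 'a"
  assumes \<iota>_hom: "\<iota> \<in> ring_hom R A"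
    and \<alpha>_closed: "i < n \<Longrightarrow> a \<in> carrier A \<Longrightarrow> \<alpha> i a \<in> carrier R"
    and \<alpha>_add: "i < n \<Longrightarrow> a \<in> carrier A \<Longrightarrow> b \<in> carrier A \<Longrightarrow> \<alpha> i (a \<oplus>\<^bsub>A\<^esub> b) = \<alpha> i a \<oplus>\<^bsub>R\<^esub> \<alpha> i b"
    and \<alpha>_left: "i < n \<Longrightarrow> r \<in> carrier R \<Longrightarrow> a \<in> carrier A \<Longrightarrow> \<alpha> i (\<iota> r \<otimes>\<^bsub>A\<^esub> a) = r \<otimes>\<^bsub>R\<^esub> \<alpha> i a"
    and \<alpha>_right: "i < n \<Longrightarrow> r \<in> carrier R \<Longrightarrow> a \<in> carrier A \<Longrightarrow> \<alpha> i (a \<otimes>\<^bsub>A\<^esub> \<iota> r) = \<alpha> i a \<otimes>\<^bsub>R\<^esub> r"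
    and c_closed: "i < n \<Longrightarrow> c i \<in> carrier A"
    and c_comm: "i < n \<Longrightarrow> r \<in> carrier R \<Longrightarrow> \<iota> r \<otimes>\<^bsub>A\<^esub> c i = c i \<otimes>\<^bsub>A\<^esub> \<iota> r"
    and basis: "a \<in> carrier A \<Longrightarrow> a = (\<Oplus>\<^bsub>A\<^esub>i\<in>{..<n}. c i \<otimes>\<^bsub>A\<^esub> \<iota> (\<alpha> i a))"
begin

lemma \<iota>_closed: "r \<in> carrier R \<Longrightarrow> \<iota> r \<in> carrier A"
  and \<iota>_add: "r \<in> carrier R \<Longrightarrow> s \<in> carrier R \<Longrightarrow> \<iota> (r \<oplus>\<^bsub>R\<^esub> s) = \<iota> r \<oplus>\<^bsub>A\<^esub> \<iota> s"
  and \<iota>_mult: "r \<in> carrier R \<Longrightarrow> s \<in> carrier R \<Longrightarrow> \<iota> (r \<otimes>\<^bsub>R\<^esub> s) = \<iota> r \<otimes>\<^bsub>A\<^esub> \<iota> s"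
  and \<iota>_one: "\<iota> \<one>\<^bsub>R\<^esub> = \<one>\<^bsub>A\<^esub>"
  using \<iota>_hom by (auto simp: ring_hom_def)

lemma left_module_restricted:
  assumes "left_module A N"
  shows "left_module R (restricted \<iota> N)"
proof -
  interpret N: left_module A N by fact
  show ?thesis
    by (intro left_moduleI abelian_groupI R.ring_axioms)
      (auto simp: \<iota>_closed \<iota>_add \<iota>_mult \<iota>_one N.smult_l_distr N.smult_r_distr N.smult_assoc1 N.M.a_ac
        intro: N.M.add.l_inv_ex)
qed

lemma left_hom_restricted:
  assumes "left_module A M" "f \<in> left_hom A M N"
  shows "f \<in> left_hom R (restricted \<iota> M) (restricted \<iota> N)"
  by (rule left_homI) (auto simp: \<iota>_closed left_hom_closed[OF assms(2)] left_hom_add[OF assms(2)]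
      left_hom_smult[OF assms(2)] left_hom_undefined[OF assms(2)])

end

text \<open>A model of A \<otimes> M that may live in any type. By \<open>extend_hom\<close>,
  \<open>extend_\<eta>\<close> and \<open>hom_eqI\<close> it has the universal property of the
  induced module, so the axioms determine N up to isomorphism.\<close>

locale induced = central_basis R A \<iota> n \<alpha> c + M: left_module R M + N: left_module A N
  for R :: "('r, 'e) ring_scheme" and A :: "('a, 'f) ring_scheme" and \<iota> n \<alpha> c
    and M :: "('r, 'm, 'g) module_scheme" and N :: "('a, 'n, 'h) module_scheme" +
  fixes \<eta> :: "'m \<Rightarrow> 'n" and \<rho> :: "nat \<Rightarrow> 'n \<Rightarrow> 'm"
  assumes \<eta>_hom: "\<eta> \<in> left_hom R M (restricted \<iota> N)"
    and \<rho>_hom: "i < n \<Longrightarrow> \<rho> i \<in> left_hom R (restricted \<iota> N) M"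
    and \<rho>_smult_\<eta>: "i < n \<Longrightarrow> a \<in> carrier A \<Longrightarrow> m \<in> carrier M \<Longrightarrow> \<rho> i (a \<odot>\<^bsub>N\<^esub> \<eta> m) = \<alpha> i a \<odot>\<^bsub>M\<^esub> m"
    and expand: "x \<in> carrier N \<Longrightarrow> x = (\<Oplus>\<^bsub>N\<^esub>j\<in>{..<n}. c j \<odot>\<^bsub>N\<^esub> \<eta> (\<rho> j x))"
begin

lemma \<eta>_closed: "m \<in> carrier M \<Longrightarrow> \<eta> m \<in> carrier N"
  using left_hom_closed[OF \<eta>_hom] by simp

lemma \<rho>_closed: "i < n \<Longrightarrow> x \<in> carrier N \<Longrightarrow> \<rho> i x \<in> carrier M"
  using left_hom_closed[OF \<rho>_hom] by simp

lemmas restricted_module = left_module_restricted[OF N.left_module_axioms]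

lemma \<rho>_finsum:
  "i < n \<Longrightarrow> f \<in> J \<rightarrow> carrier N \<Longrightarrow> \<rho> i (finsum N f J) = (\<Oplus>\<^bsub>M\<^esub>j\<in>J. \<rho> i (f j))"
  using left_hom_finsum[OF restricted_module M.left_module_axioms \<rho>_hom] by simp

text \<open>The coordinates \<rho> are linear over R only. Expanding x shows how they behave under
  A: through the matrix of multiplication by a, with entries
  \<open>\<alpha> j (a \<otimes> c k)\<close>.\<close>

lemma \<rho>_smult:
  assumes "j < n" "a \<in> carrier A" "x \<in> carrier N"
  shows "\<rho> j (a \<odot>\<^bsub>N\<^esub> x) = (\<Oplus>\<^bsub>M\<^esub>k\<in>{..<n}. \<alpha> j (a \<otimes>\<^bsub>A\<^esub> c k) \<odot>\<^bsub>M\<^esub> \<rho> k x)"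
proof -
  have "a \<odot>\<^bsub>N\<^esub> x = a \<odot>\<^bsub>N\<^esub> (\<Oplus>\<^bsub>N\<^esub>k\<in>{..<n}. c k \<odot>\<^bsub>N\<^esub> \<eta> (\<rho> k x))"
    using expand[OF assms(3)] by simp
  also have "\<dots> = (\<Oplus>\<^bsub>N\<^esub>k\<in>{..<n}. a \<odot>\<^bsub>N\<^esub> (c k \<odot>\<^bsub>N\<^esub> \<eta> (\<rho> k x)))"
    using assms by (intro N.smult_finsum) (auto simp: c_closed \<eta>_closed \<rho>_closed)
  also have "\<dots> = (\<Oplus>\<^bsub>N\<^esub>k\<in>{..<n}. (a \<otimes>\<^bsub>A\<^esub> c k) \<odot>\<^bsub>N\<^esub> \<eta> (\<rho> k x))"
    using assms by (intro N.M.finsum_cong') (auto simp: c_closed \<eta>_closed \<rho>_closed N.smult_assoc1)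
  finally have "\<rho> j (a \<odot>\<^bsub>N\<^esub> x) = (\<Oplus>\<^bsub>M\<^esub>k\<in>{..<n}. \<rho> j ((a \<otimes>\<^bsub>A\<^esub> c k) \<odot>\<^bsub>N\<^esub> \<eta> (\<rho> k x)))"
    using assms by (simp add: \<rho>_finsum c_closed \<eta>_closed \<rho>_closed Pi_def)
  also have "\<dots> = (\<Oplus>\<^bsub>M\<^esub>k\<in>{..<n}. \<alpha> j (a \<otimes>\<^bsub>A\<^esub> c k) \<odot>\<^bsub>M\<^esub> \<rho> k x)"
    using assms by (intro M.M.finsum_cong') (auto simp: c_closed \<rho>_closed \<alpha>_closed \<rho>_smult_\<eta>)
  finally show ?thesis .
qed

lemma \<eta>_smult: "r \<in> carrier R \<Longrightarrow> m \<in> carrier M \<Longrightarrow> \<eta> (r \<odot>\<^bsub>M\<^esub> m) = \<iota> r \<odot>\<^bsub>N\<^esub> \<eta> m"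
  using left_hom_smult[OF \<eta>_hom] by simp

text \<open>The A-linear map that corresponds to the R-linear \<phi> under the adjunction between
  induction and restriction, informally a \<otimes> m |-> a \<phi>(m). The formula is forced by the
  expansion of x.\<close>

definition extend :: "('a, 'l, 'k) module_scheme \<Rightarrow> ('m \<Rightarrow> 'l) \<Rightarrow> 'n \<Rightarrow> 'l"
  where "extend L \<phi> = (\<lambda>x\<in>carrier N. \<Oplus>\<^bsub>L\<^esub>j\<in>{..<n}. c j \<odot>\<^bsub>L\<^esub> \<phi> (\<rho> j x))"

context
  fixes L :: "('a, 'l, 'k) module_scheme" and \<phi> :: "'m \<Rightarrow> 'l"
  assumes L: "left_module A L" and \<phi>: "\<phi> \<in> left_hom R M (restricted \<iota> L)"
begin

lemma \<phi>_closed: "m \<in> carrier M \<Longrightarrow> \<phi> m \<in> carrier L"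
  and \<phi>_smult: "r \<in> carrier R \<Longrightarrow> m \<in> carrier M \<Longrightarrow> \<phi> (r \<odot>\<^bsub>M\<^esub> m) = \<iota> r \<odot>\<^bsub>L\<^esub> \<phi> m"
  using left_hom_closed[OF \<phi>] left_hom_smult[OF \<phi>] by simp_all

text \<open>For A-linearity, \<open>\<rho>_smult\<close> produces a double sum with coefficients
  \<open>c j \<otimes> \<iota> (\<alpha> j (a \<otimes> c k))\<close>. After the order of summation
  is exchanged, the sum over j is the basis expansion of a c_k.\<close>

lemma extend_hom: "extend L \<phi> \<in> left_hom A N L"
proof -
  interpret L: left_module A L by (rule L)
  note closed = c_closed \<phi>_closed \<rho>_closed \<alpha>_closed \<iota>_closed
  show ?thesis
    unfolding extend_def
  proof (rule left_hom_restrictI[OF N.left_module_axioms])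
    fix x assume "x \<in> carrier N"
    then show "(\<Oplus>\<^bsub>L\<^esub>j\<in>{..<n}. c j \<odot>\<^bsub>L\<^esub> \<phi> (\<rho> j x)) \<in> carrier L"
      by (auto intro!: L.M.finsum_closed simp: closed)
  next
    fix x y assume xy: "x \<in> carrier N" "y \<in> carrier N"
    have "(\<Oplus>\<^bsub>L\<^esub>j\<in>{..<n}. c j \<odot>\<^bsub>L\<^esub> \<phi> (\<rho> j (x \<oplus>\<^bsub>N\<^esub> y))) =
        (\<Oplus>\<^bsub>L\<^esub>j\<in>{..<n}. c j \<odot>\<^bsub>L\<^esub> \<phi> (\<rho> j x) \<oplus>\<^bsub>L\<^esub> c j \<odot>\<^bsub>L\<^esub> \<phi> (\<rho> j y))"
      using xy left_hom_add[OF \<rho>_hom] left_hom_add[OF \<phi>]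
      by (intro L.M.finsum_cong') (auto simp: closed L.smult_r_distr)
    also have "\<dots> = (\<Oplus>\<^bsub>L\<^esub>j\<in>{..<n}. c j \<odot>\<^bsub>L\<^esub> \<phi> (\<rho> j x)) \<oplus>\<^bsub>L\<^esub> (\<Oplus>\<^bsub>L\<^esub>j\<in>{..<n}. c j \<odot>\<^bsub>L\<^esub> \<phi> (\<rho> j y))"
      using xy by (intro L.M.finsum_addf) (auto simp: closed)
    finally show "(\<Oplus>\<^bsub>L\<^esub>j\<in>{..<n}. c j \<odot>\<^bsub>L\<^esub> \<phi> (\<rho> j (x \<oplus>\<^bsub>N\<^esub> y))) = \<dots>" .
  next
    fix a x assume a: "a \<in> carrier A" and x: "x \<in> carrier N"
    have "c j \<odot>\<^bsub>L\<^esub> \<phi> (\<rho> j (a \<odot>\<^bsub>N\<^esub> x)) =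
        (\<Oplus>\<^bsub>L\<^esub>k\<in>{..<n}. (c j \<otimes>\<^bsub>A\<^esub> \<iota> (\<alpha> j (a \<otimes>\<^bsub>A\<^esub> c k))) \<odot>\<^bsub>L\<^esub> \<phi> (\<rho> k x))" if j: "j < n" for j
    proof -
      have "\<phi> (\<rho> j (a \<odot>\<^bsub>N\<^esub> x)) = (\<Oplus>\<^bsub>L\<^esub>k\<in>{..<n}. \<phi> (\<alpha> j (a \<otimes>\<^bsub>A\<^esub> c k) \<odot>\<^bsub>M\<^esub> \<rho> k x))"
        using left_hom_finsum[OF M.left_module_axioms left_module_restricted[OF L] \<phi>,
            of "\<lambda>k. \<alpha> j (a \<otimes>\<^bsub>A\<^esub> c k) \<odot>\<^bsub>M\<^esub> \<rho> k x" "{..<n}"] a x j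
        by (simp add: \<rho>_smult closed Pi_def)
      also have "\<dots> = (\<Oplus>\<^bsub>L\<^esub>k\<in>{..<n}. \<iota> (\<alpha> j (a \<otimes>\<^bsub>A\<^esub> c k)) \<odot>\<^bsub>L\<^esub> \<phi> (\<rho> k x))"
        using a x j by (intro L.M.finsum_cong') (auto simp: closed \<phi>_smult)
      finally have "c j \<odot>\<^bsub>L\<^esub> \<phi> (\<rho> j (a \<odot>\<^bsub>N\<^esub> x)) =
          (\<Oplus>\<^bsub>L\<^esub>k\<in>{..<n}. c j \<odot>\<^bsub>L\<^esub> (\<iota> (\<alpha> j (a \<otimes>\<^bsub>A\<^esub> c k)) \<odot>\<^bsub>L\<^esub> \<phi> (\<rho> k x)))"
        using a x j by (simp add: L.smult_finsum closed Pi_def)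
      also have "\<dots> = (\<Oplus>\<^bsub>L\<^esub>k\<in>{..<n}. (c j \<otimes>\<^bsub>A\<^esub> \<iota> (\<alpha> j (a \<otimes>\<^bsub>A\<^esub> c k))) \<odot>\<^bsub>L\<^esub> \<phi> (\<rho> k x))"
        using a x j by (intro L.M.finsum_cong') (auto simp: closed L.smult_assoc1)
      finally show ?thesis .
    qed
    then have "(\<Oplus>\<^bsub>L\<^esub>j\<in>{..<n}. c j \<odot>\<^bsub>L\<^esub> \<phi> (\<rho> j (a \<odot>\<^bsub>N\<^esub> x))) =
        (\<Oplus>\<^bsub>L\<^esub>j\<in>{..<n}. \<Oplus>\<^bsub>L\<^esub>k\<in>{..<n}. (c j \<otimes>\<^bsub>A\<^esub> \<iota> (\<alpha> j (a \<otimes>\<^bsub>A\<^esub> c k))) \<odot>\<^bsub>L\<^esub> \<phi> (\<rho> k x))"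
      using a x by (intro L.M.finsum_cong') (auto simp: closed intro!: L.M.finsum_closed)
    also have "\<dots> =
        (\<Oplus>\<^bsub>L\<^esub>k\<in>{..<n}. \<Oplus>\<^bsub>L\<^esub>j\<in>{..<n}. (c j \<otimes>\<^bsub>A\<^esub> \<iota> (\<alpha> j (a \<otimes>\<^bsub>A\<^esub> c k))) \<odot>\<^bsub>L\<^esub> \<phi> (\<rho> k x))"
      using a x by (intro L.M.finsum_swap) (auto simp: closed)
    also have "\<dots> = (\<Oplus>\<^bsub>L\<^esub>k\<in>{..<n}. a \<odot>\<^bsub>L\<^esub> (c k \<odot>\<^bsub>L\<^esub> \<phi> (\<rho> k x)))"
    proof (rule L.M.finsum_cong'[OF refl])
      show "(\<lambda>k. a \<odot>\<^bsub>L\<^esub> (c k \<odot>\<^bsub>L\<^esub> \<phi> (\<rho> k x))) \<in> {..<n} \<rightarrow> carrier L" using a x by (auto simp: closed)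
      fix k assume k: "k \<in> {..<n}"
      have "(\<Oplus>\<^bsub>L\<^esub>j\<in>{..<n}. (c j \<otimes>\<^bsub>A\<^esub> \<iota> (\<alpha> j (a \<otimes>\<^bsub>A\<^esub> c k))) \<odot>\<^bsub>L\<^esub> \<phi> (\<rho> k x)) =
          (\<Oplus>\<^bsub>A\<^esub>j\<in>{..<n}. c j \<otimes>\<^bsub>A\<^esub> \<iota> (\<alpha> j (a \<otimes>\<^bsub>A\<^esub> c k))) \<odot>\<^bsub>L\<^esub> \<phi> (\<rho> k x)"
        using a x k by (intro L.finsum_smult[symmetric]) (auto simp: closed)
      also have "(\<Oplus>\<^bsub>A\<^esub>j\<in>{..<n}. c j \<otimes>\<^bsub>A\<^esub> \<iota> (\<alpha> j (a \<otimes>\<^bsub>A\<^esub> c k))) = a \<otimes>\<^bsub>A\<^esub> c k"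
        using a k by (intro basis[symmetric]) (auto simp: closed)
      finally show "(\<Oplus>\<^bsub>L\<^esub>j\<in>{..<n}. (c j \<otimes>\<^bsub>A\<^esub> \<iota> (\<alpha> j (a \<otimes>\<^bsub>A\<^esub> c k))) \<odot>\<^bsub>L\<^esub> \<phi> (\<rho> k x)) =
          a \<odot>\<^bsub>L\<^esub> (c k \<odot>\<^bsub>L\<^esub> \<phi> (\<rho> k x))"
        using a x k by (simp add: closed L.smult_assoc1)
    qed
    also have "\<dots> = a \<odot>\<^bsub>L\<^esub> (\<Oplus>\<^bsub>L\<^esub>k\<in>{..<n}. c k \<odot>\<^bsub>L\<^esub> \<phi> (\<rho> k x))"
      using a x by (intro L.smult_finsum[symmetric]) (auto simp: closed)
    finally show "(\<Oplus>\<^bsub>L\<^esub>j\<in>{..<n}. c j \<odot>\<^bsub>L\<^esub> \<phi> (\<rho> j (a \<odot>\<^bsub>N\<^esub> x))) = \<dots>" .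
  qed
qed

text \<open>The coordinates of \<eta>(m) are the multiples of m by \<open>\<alpha> j\<close> of the
  unit, so the sum collapses to the basis expansion of the unit of A.\<close>

lemma extend_\<eta>:
  assumes m: "m \<in> carrier M"
  shows "extend L \<phi> (\<eta> m) = \<phi> m"
proof -
  interpret L: left_module A L by (rule L)
  note closed = c_closed \<phi>_closed \<rho>_closed \<alpha>_closed \<iota>_closed \<eta>_closed
  have \<rho>\<eta>: "\<rho> j (\<eta> m) = \<alpha> j \<one>\<^bsub>A\<^esub> \<odot>\<^bsub>M\<^esub> m" if "j < n" for j
    using \<rho>_smult_\<eta>[OF that A.one_closed m] m by (simp add: closed)
  have "extend L \<phi> (\<eta> m) = (\<Oplus>\<^bsub>L\<^esub>j\<in>{..<n}. c j \<odot>\<^bsub>L\<^esub> \<phi> (\<rho> j (\<eta> m)))"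
    using m by (simp add: extend_def closed)
  also have "\<dots> = (\<Oplus>\<^bsub>L\<^esub>j\<in>{..<n}. (c j \<otimes>\<^bsub>A\<^esub> \<iota> (\<alpha> j \<one>\<^bsub>A\<^esub>)) \<odot>\<^bsub>L\<^esub> \<phi> m)"
    using m by (intro L.M.finsum_cong') (auto simp: closed \<rho>\<eta> \<phi>_smult L.smult_assoc1)
  also have "\<dots> = (\<Oplus>\<^bsub>A\<^esub>j\<in>{..<n}. c j \<otimes>\<^bsub>A\<^esub> \<iota> (\<alpha> j \<one>\<^bsub>A\<^esub>)) \<odot>\<^bsub>L\<^esub> \<phi> m"
    using m by (intro L.finsum_smult[symmetric]) (auto simp: closed)
  also have "\<dots> = \<phi> m" using basis[OF A.one_closed] m by (simp add: closed)
  finally show ?thesis .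
qed

end

lemma hom_expand:
  assumes "left_module A L" "f \<in> left_hom A N L" "x \<in> carrier N"
  shows "f x = (\<Oplus>\<^bsub>L\<^esub>j\<in>{..<n}. c j \<odot>\<^bsub>L\<^esub> f (\<eta> (\<rho> j x)))"
proof -
  interpret L: left_module A L by fact
  have "f x = f (\<Oplus>\<^bsub>N\<^esub>j\<in>{..<n}. c j \<odot>\<^bsub>N\<^esub> \<eta> (\<rho> j x))" using expand[OF assms(3)] by simp
  also have "\<dots> = (\<Oplus>\<^bsub>L\<^esub>j\<in>{..<n}. f (c j \<odot>\<^bsub>N\<^esub> \<eta> (\<rho> j x)))"
    using assms by (intro left_hom_finsum[OF N.left_module_axioms]) (auto simp: c_closed \<eta>_closed \<rho>_closed)
  also have "\<dots> = (\<Oplus>\<^bsub>L\<^esub>j\<in>{..<n}. c j \<odot>\<^bsub>L\<^esub> f (\<eta> (\<rho> j x)))"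
    using assms left_hom_closed[OF assms(2)]
    by (intro L.M.finsum_cong') (auto simp: c_closed \<eta>_closed \<rho>_closed left_hom_smult[OF assms(2)])
  finally show ?thesis .
qed

text \<open>By \<open>expand\<close>, the image of \<eta> generates N over A.\<close>

lemma hom_eqI:
  assumes "left_module A L" "f \<in> left_hom A N L" "g \<in> left_hom A N L"
    and "\<And>m. m \<in> carrier M \<Longrightarrow> f (\<eta> m) = g (\<eta> m)"
  shows "f = g"
proof (rule left_hom_eqI[OF assms(2,3)])
  interpret L: left_module A L by fact
  fix x assume x: "x \<in> carrier N"
  have "f x = (\<Oplus>\<^bsub>L\<^esub>j\<in>{..<n}. c j \<odot>\<^bsub>L\<^esub> f (\<eta> (\<rho> j x)))" by (rule hom_expand[OF assms(1,2) x])
  also have "\<dots> = (\<Oplus>\<^bsub>L\<^esub>j\<in>{..<n}. c j \<odot>\<^bsub>L\<^esub> g (\<eta> (\<rho> j x)))"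
    using x left_hom_closed[OF assms(3)]
    by (intro L.M.finsum_cong') (auto simp: assms(4) c_closed \<eta>_closed \<rho>_closed)
  also have "\<dots> = g x" by (rule hom_expand[OF assms(1,3) x, symmetric])
  finally show "f x = g x" .
qed

end

section \<open>Maps between induced modules and their exactness\<close>

locale induced_hom = D: induced R A \<iota> n \<alpha> c M N \<eta> \<rho> + E: induced R A \<iota> n \<alpha> c M' N' \<eta>' \<rho>'
  for R :: "('r, 'e) ring_scheme" and A :: "('a, 'f) ring_scheme" and \<iota> n \<alpha> c
    and M :: "('r, 'm, 'g) module_scheme" and N :: "('a, 'n, 'h) module_scheme" and \<eta> \<rho>
    and M' :: "('r, 'k, 'i) module_scheme" and N' :: "('a, 'l, 'j) module_scheme" and \<eta>' \<rho>' +
  fixes f :: "'m \<Rightarrow> 'k" and g :: "'n \<Rightarrow> 'l"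
  assumes f_hom: "f \<in> left_hom R M M'" and g_hom: "g \<in> left_hom A N N'"
    and g_\<eta>: "m \<in> carrier M \<Longrightarrow> g (\<eta> m) = \<eta>' (f m)"
begin

lemma f_closed: "m \<in> carrier M \<Longrightarrow> f m \<in> carrier M'"
  and g_closed: "x \<in> carrier N \<Longrightarrow> g x \<in> carrier N'"
  using left_hom_closed[OF f_hom] left_hom_closed[OF g_hom] by simp_all

lemma g_expand: "x \<in> carrier N \<Longrightarrow> g x = (\<Oplus>\<^bsub>N'\<^esub>j\<in>{..<n}. c j \<odot>\<^bsub>N'\<^esub> \<eta>' (f (\<rho> j x)))"
  unfolding D.hom_expand[OF E.N.left_module_axioms g_hom]
  by (intro E.N.M.finsum_cong') (auto simp: g_\<eta> D.\<rho>_closed D.c_closed E.\<eta>_closed f_closed)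

text \<open>Naturality of the coordinates: after expansion of x both sides are sums of f applied to
  \<open>\<alpha> i (c j)\<close> times \<open>\<rho> j x\<close>. This reduces questions about g to
  questions about f, one coordinate at a time.\<close>

lemma \<rho>_g:
  assumes i: "i < n" and x: "x \<in> carrier N"
  shows "\<rho>' i (g x) = f (\<rho> i x)"
proof -
  note closed = D.\<rho>_closed D.c_closed D.\<alpha>_closed E.\<eta>_closed D.\<eta>_closed f_closed
  have "\<rho>' i (g x) = (\<Oplus>\<^bsub>M'\<^esub>j\<in>{..<n}. \<rho>' i (c j \<odot>\<^bsub>N'\<^esub> \<eta>' (f (\<rho> j x))))"
    unfolding g_expand[OF x] using x i by (intro E.\<rho>_finsum) (auto simp: closed)
  also have "\<dots> = (\<Oplus>\<^bsub>M'\<^esub>j\<in>{..<n}. f (\<alpha> i (c j) \<odot>\<^bsub>M\<^esub> \<rho> j x))"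
    using x i by (intro E.M.M.finsum_cong') (auto simp: closed E.\<rho>_smult_\<eta> left_hom_smult[OF f_hom])
  also have "\<dots> = f (\<Oplus>\<^bsub>M\<^esub>j\<in>{..<n}. \<alpha> i (c j) \<odot>\<^bsub>M\<^esub> \<rho> j x)"
    using x i by (intro left_hom_finsum[OF D.M.left_module_axioms E.M.left_module_axioms f_hom, symmetric])
      (auto simp: closed)
  also have "(\<Oplus>\<^bsub>M\<^esub>j\<in>{..<n}. \<alpha> i (c j) \<odot>\<^bsub>M\<^esub> \<rho> j x) = (\<Oplus>\<^bsub>M\<^esub>j\<in>{..<n}. \<rho> i (c j \<odot>\<^bsub>N\<^esub> \<eta> (\<rho> j x)))"
    using x i by (intro D.M.M.finsum_cong') (auto simp: closed D.\<rho>_smult_\<eta>)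
  also have "\<dots> = \<rho> i x"
    using D.\<rho>_finsum[OF i, of "\<lambda>j. c j \<odot>\<^bsub>N\<^esub> \<eta> (\<rho> j x)" "{..<n}"] D.expand[OF x] x
    by (simp add: closed Pi_def)
  finally show ?thesis .
qed

lemma inj_on_induced:
  assumes "inj_on f (carrier M)"
  shows "inj_on g (carrier N)"
proof (rule inj_onI)
  fix x y assume xy: "x \<in> carrier N" "y \<in> carrier N" "g x = g y"
  have \<rho>: "\<rho> i x = \<rho> i y" if "i < n" for i
  proof (rule inj_onD[OF assms])
    show "f (\<rho> i x) = f (\<rho> i y)"
      using \<rho>_g[OF that xy(1)] \<rho>_g[OF that xy(2)] xy(3) by simp
  qed (use xy that D.\<rho>_closed in auto)
  have "x = (\<Oplus>\<^bsub>N\<^esub>j\<in>{..<n}. c j \<odot>\<^bsub>N\<^esub> \<eta> (\<rho> j x))" by (rule D.expand[OF xy(1)])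
  also have "\<dots> = (\<Oplus>\<^bsub>N\<^esub>j\<in>{..<n}. c j \<odot>\<^bsub>N\<^esub> \<eta> (\<rho> j y))"
    using xy by (intro D.N.M.finsum_cong') (auto simp: \<rho> D.c_closed D.\<rho>_closed D.\<eta>_closed)
  also have "\<dots> = y" by (rule D.expand[OF xy(2), symmetric])
  finally show "x = y" .
qed

text \<open>Preimages m_j of the coordinates of y are chosen independently. The coordinates of the
  sum of the c_j \<eta>(m_j) may differ from the m_j, yet g sends this sum to the expansion of
  y.\<close>

lemma mem_image_induced:
  assumes y: "y \<in> carrier N'" and im: "\<And>i. i < n \<Longrightarrow> \<rho>' i y \<in> f ` carrier M"
  shows "y \<in> g ` carrier N"
proof -
  define m where "m = (\<lambda>i. inv_into (carrier M) f (\<rho>' i y))"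
  have m: "m i \<in> carrier M" "f (m i) = \<rho>' i y" if "i < n" for i
    using im[OF that] by (simp_all add: m_def inv_into_into f_inv_into_f)
  let ?x = "\<Oplus>\<^bsub>N\<^esub>j\<in>{..<n}. c j \<odot>\<^bsub>N\<^esub> \<eta> (m j)"
  have x: "?x \<in> carrier N" by (auto intro!: D.N.M.finsum_closed simp: D.c_closed D.\<eta>_closed m)
  have "g ?x = (\<Oplus>\<^bsub>N'\<^esub>j\<in>{..<n}. g (c j \<odot>\<^bsub>N\<^esub> \<eta> (m j)))"
    by (intro left_hom_finsum[OF D.N.left_module_axioms E.N.left_module_axioms g_hom])
      (auto simp: D.c_closed D.\<eta>_closed m)
  also have "\<dots> = (\<Oplus>\<^bsub>N'\<^esub>j\<in>{..<n}. c j \<odot>\<^bsub>N'\<^esub> \<eta>' (\<rho>' j y))"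
    using y by (intro E.N.M.finsum_cong')
      (auto simp: D.c_closed D.\<eta>_closed m left_hom_smult[OF g_hom] g_\<eta> E.\<eta>_closed E.\<rho>_closed)
  also have "\<dots> = y" by (rule E.expand[OF y, symmetric])
  finally show ?thesis using x by (metis imageI)
qed

lemma image_induced:
  assumes "f ` carrier M = carrier M'"
  shows "g ` carrier N = carrier N'"
proof
  show "g ` carrier N \<subseteq> carrier N'" using g_closed by auto
  show "carrier N' \<subseteq> g ` carrier N"
    using assms E.\<rho>_closed by (auto intro!: mem_image_induced)
qed

text \<open>Each component of \<psi> \<circ> \<eta> factors through f by its own \<chi>_j. The sum h
  of the maps c_j \<eta>T \<circ> \<chi>_j satisfies h \<circ> f = \<psi> \<circ> \<eta> by
  expansion in S, and the A-linear extension of h is the required factor because maps out of N are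
  determined on the image of \<eta>.\<close>

lemma factor_through_induced:
  assumes T: "induced R A \<iota> n \<alpha> c T S \<eta>T \<rho>T" and \<psi>: "\<psi> \<in> left_hom A N S"
    and fac: "\<And>i. i < n \<Longrightarrow> \<exists>\<chi>\<in>left_hom R M' T. \<forall>m\<in>carrier M. \<rho>T i (\<psi> (\<eta> m)) = \<chi> (f m)"
  shows "\<psi> \<in> precomp N g ` left_hom A N' S"
proof -
  interpret T: induced R A \<iota> n \<alpha> c T S \<eta>T \<rho>T by fact
  note S = T.N.left_module_axioms
  obtain \<chi> where \<chi>: "\<And>i. i < n \<Longrightarrow> \<chi> i \<in> left_hom R M' T"
    and \<chi>f: "\<And>i m. i < n \<Longrightarrow> m \<in> carrier M \<Longrightarrow> \<rho>T i (\<psi> (\<eta> m)) = \<chi> i (f m)"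
    using fac by metis
  have \<chi>c: "\<chi> i m \<in> carrier T" if "i < n" "m \<in> carrier M'" for i m
    using left_hom_closed[OF \<chi>[OF that(1)] that(2)] .
  define h where "h = (\<lambda>m\<in>carrier M'. \<Oplus>\<^bsub>restricted \<iota> S\<^esub>j\<in>{..<n}. (\<lambda>m\<in>carrier M'. c j \<odot>\<^bsub>S\<^esub> \<eta>T (\<chi> j m)) m)"
  have he: "h m = (\<Oplus>\<^bsub>S\<^esub>j\<in>{..<n}. c j \<odot>\<^bsub>S\<^esub> \<eta>T (\<chi> j m))" if "m \<in> carrier M'" for m
    using that by (simp add: h_def)
  have h: "h \<in> left_hom R M' (restricted \<iota> S)"
    unfolding h_def
  proof (intro left_hom_sum left_hom_restrictI E.M.left_module_axioms T.restricted_module)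
    fix j assume j: "j \<in> {..<n}"
    then have j': "j < n" by simp
    note closed = D.c_closed T.\<eta>_closed \<chi>c D.\<iota>_closed
    fix x assume x: "x \<in> carrier M'"
    show "c j \<odot>\<^bsub>S\<^esub> \<eta>T (\<chi> j x) \<in> carrier (restricted \<iota> S)" using j' x by (simp add: closed)
    show "c j \<odot>\<^bsub>S\<^esub> \<eta>T (\<chi> j (x \<oplus>\<^bsub>M'\<^esub> y)) =
        c j \<odot>\<^bsub>S\<^esub> \<eta>T (\<chi> j x) \<oplus>\<^bsub>restricted \<iota> S\<^esub> c j \<odot>\<^bsub>S\<^esub> \<eta>T (\<chi> j y)" if y: "y \<in> carrier M'" for y
      using j' x y left_hom_add[OF T.\<eta>_hom]
      by (simp add: closed left_hom_add[OF \<chi>[OF j']] T.N.smult_r_distr)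
    \<comment> \<open>The commutation of c j with \<iota> r enters here; for an arbitrary element of
      A in place of c j the map need not be R-linear.\<close>
    show "c j \<odot>\<^bsub>S\<^esub> \<eta>T (\<chi> j (r \<odot>\<^bsub>M'\<^esub> x)) = r \<odot>\<^bsub>restricted \<iota> S\<^esub> (c j \<odot>\<^bsub>S\<^esub> \<eta>T (\<chi> j x))"
      if r: "r \<in> carrier R" for r
      using j' x r by (simp add: closed left_hom_smult[OF \<chi>[OF j']] T.\<eta>_smult D.c_comm
          flip: T.N.smult_assoc1)
  qed
  have eh: "E.extend S h \<in> left_hom A N' S" by (rule E.extend_hom[OF S h])
  have "\<psi> = precomp N g (E.extend S h)"
  proof (rule D.hom_eqI[OF S \<psi> left_hom_compose[OF D.N.left_module_axioms g_hom eh]])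
    fix m assume m: "m \<in> carrier M"
    have \<psi>m: "\<psi> (\<eta> m) \<in> carrier S" using left_hom_closed[OF \<psi> D.\<eta>_closed[OF m]] .
    have "\<psi> (\<eta> m) = (\<Oplus>\<^bsub>S\<^esub>j\<in>{..<n}. c j \<odot>\<^bsub>S\<^esub> \<eta>T (\<rho>T j (\<psi> (\<eta> m))))" by (rule T.expand[OF \<psi>m])
    also have "\<dots> = (\<Oplus>\<^bsub>S\<^esub>j\<in>{..<n}. c j \<odot>\<^bsub>S\<^esub> \<eta>T (\<chi> j (f m)))"
      using m by (intro T.N.M.finsum_cong') (auto simp: \<chi>f D.c_closed T.\<eta>_closed \<chi>c f_closed)
    also have "\<dots> = h (f m)" using he[OF f_closed[OF m]] by simp
    also have "\<dots> = E.extend S h (\<eta>' (f m))" by (rule E.extend_\<eta>[OF S h f_closed[OF m], symmetric])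
    also have "\<dots> = precomp N g (E.extend S h) (\<eta> m)" using m by (simp add: compose_eq D.\<eta>_closed g_\<eta>)
    finally show "\<psi> (\<eta> m) = precomp N g (E.extend S h) (\<eta> m)" .
  qed
  with eh show ?thesis by blast
qed

end

text \<open>The extension of \<eta>' \<circ> f serves as A \<otimes> f, between any two models of
  the induced modules.\<close>

lemma (in induced) induced_map:
  assumes E: "induced R A \<iota> n \<alpha> c M' N' \<eta>' \<rho>'" and f: "f \<in> left_hom R M M'"
  shows "induced_hom R A \<iota> n \<alpha> c M N \<eta> \<rho> M' N' \<eta>' \<rho>' f (extend N' (compose (carrier M) \<eta>' f))"
proof -
  interpret E: induced R A \<iota> n \<alpha> c M' N' \<eta>' \<rho>' by fact
  have h: "compose (carrier M) \<eta>' f \<in> left_hom R M (restricted \<iota> N')"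
    by (rule left_hom_compose[OF M.left_module_axioms f E.\<eta>_hom])
  show ?thesis
    by unfold_locales
      (use f extend_hom[OF E.N.left_module_axioms h] extend_\<eta>[OF E.N.left_module_axioms h] in
        \<open>auto simp: compose_eq\<close>)
qed

text \<open>If G kills y, then by \<open>\<rho>_g\<close> g kills the coordinates of y, so these lie
  in the image of f and \<open>mem_image_induced\<close> applies. Conversely, the coordinates of F x
  are values of f, which g kills.\<close>

lemma induced_exact:
  assumes f: "induced_hom R A \<iota> n \<alpha> c M1 N1 \<eta>1 \<rho>1 M2 N2 \<eta>2 \<rho>2 f F"
    and g: "induced_hom R A \<iota> n \<alpha> c M2 N2 \<eta>2 \<rho>2 M3 N3 \<eta>3 \<rho>3 g G"
    and exact: "a_kernel M2 M3 g = f ` carrier M1"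
  shows "a_kernel N2 N3 G = F ` carrier N1"
proof
  interpret f: induced_hom R A \<iota> n \<alpha> c M1 N1 \<eta>1 \<rho>1 M2 N2 \<eta>2 \<rho>2 f F by fact
  interpret g: induced_hom R A \<iota> n \<alpha> c M2 N2 \<eta>2 \<rho>2 M3 N3 \<eta>3 \<rho>3 g G by fact
  show "a_kernel N2 N3 G \<subseteq> F ` carrier N1"
  proof
    fix y assume "y \<in> a_kernel N2 N3 G"
    then have y: "y \<in> carrier N2" "G y = \<zero>\<^bsub>N3\<^esub>" by (auto simp: mem_a_kernel)
    show "y \<in> F ` carrier N1"
    proof (rule f.mem_image_induced[OF y(1)])
      fix i assume i: "i < n"
      have "g (\<rho>2 i y) = \<rho>3 i \<zero>\<^bsub>N3\<^esub>" using g.\<rho>_g[OF i y(1)] y(2) by simp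
      also have "\<dots> = \<zero>\<^bsub>M3\<^esub>"
        using left_hom_zero[OF g.E.restricted_module g.E.M.left_module_axioms g.E.\<rho>_hom[OF i]] by simp
      finally show "\<rho>2 i y \<in> f ` carrier M1"
        unfolding exact[symmetric] using f.E.\<rho>_closed[OF i y(1)] by (simp add: mem_a_kernel)
    qed
  qed
  show "F ` carrier N1 \<subseteq> a_kernel N2 N3 G"
  proof safe
    fix x assume x: "x \<in> carrier N1"
    have gf: "g (f m) = \<zero>\<^bsub>M3\<^esub>" if "m \<in> carrier M1" for m
      using imageI[OF that, of f] unfolding exact[symmetric] by (simp add: mem_a_kernel)
    have "G (F x) = (\<Oplus>\<^bsub>N3\<^esub>j\<in>{..<n}. c j \<odot>\<^bsub>N3\<^esub> \<eta>3 (g (\<rho>2 j (F x))))"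
      by (rule g.g_expand[OF f.g_closed[OF x]])
    also have "\<dots> = (\<Oplus>\<^bsub>N3\<^esub>j\<in>{..<n}. \<zero>\<^bsub>N3\<^esub>)"
      using x left_hom_zero[OF g.E.M.left_module_axioms g.E.restricted_module g.E.\<eta>_hom]
      by (intro g.E.N.M.finsum_cong') (auto simp: f.\<rho>_g gf f.D.\<rho>_closed f.D.c_closed)
    finally show "F x \<in> a_kernel N2 N3 G" using f.g_closed[OF x] by (simp add: mem_a_kernel)
  qed
qed

text \<open>The R-linear components \<rho>T_i \<circ> h \<circ> \<eta>2 of h vanish on the image of
  f because h vanishes on that of F; exactness over R factors them through g, and
  \<open>factor_through_induced\<close> assembles the factors. The other inclusion comes from G
  \<circ> F = 0.\<close>

lemma induced_hom_exact:
  assumes f: "induced_hom R A \<iota> n \<alpha> c M1 N1 \<eta>1 \<rho>1 M2 N2 \<eta>2 \<rho>2 f F"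
    and g: "induced_hom R A \<iota> n \<alpha> c M2 N2 \<eta>2 \<rho>2 M3 N3 \<eta>3 \<rho>3 g G"
    and T: "induced R A \<iota> n \<alpha> c T S \<eta>T \<rho>T"
    and gf: "\<And>x. x \<in> carrier N1 \<Longrightarrow> G (F x) = \<zero>\<^bsub>N3\<^esub>"
    and exact: "{h \<in> left_hom R M2 T. precomp M1 f h = zero_hom M1 T} \<subseteq> precomp M2 g ` left_hom R M3 T"
  shows "{h \<in> left_hom A N2 S. precomp N1 F h = zero_hom N1 S} = precomp N2 G ` left_hom A N3 S"
proof
  interpret f: induced_hom R A \<iota> n \<alpha> c M1 N1 \<eta>1 \<rho>1 M2 N2 \<eta>2 \<rho>2 f F by fact
  interpret g: induced_hom R A \<iota> n \<alpha> c M2 N2 \<eta>2 \<rho>2 M3 N3 \<eta>3 \<rho>3 g G by fact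
  interpret T: induced R A \<iota> n \<alpha> c T S \<eta>T \<rho>T by fact
  show "precomp N2 G ` left_hom A N3 S \<subseteq> {h \<in> left_hom A N2 S. precomp N1 F h = zero_hom N1 S}"
  proof safe
    fix h assume h: "h \<in> left_hom A N3 S"
    show "precomp N2 G h \<in> left_hom A N2 S"
      by (rule left_hom_compose[OF f.E.N.left_module_axioms g.g_hom h])
    show "precomp N1 F (precomp N2 G h) = zero_hom N1 S"
      using left_hom_zero[OF g.E.N.left_module_axioms T.N.left_module_axioms h] f.g_closed
      by (auto simp: compose_def zero_hom_def fun_eq_iff gf)
  qed
  show "{h \<in> left_hom A N2 S. precomp N1 F h = zero_hom N1 S} \<subseteq> precomp N2 G ` left_hom A N3 S"
  proof
    fix h assume "h \<in> {h \<in> left_hom A N2 S. precomp N1 F h = zero_hom N1 S}"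
    then have h: "h \<in> left_hom A N2 S" and hF: "precomp N1 F h = zero_hom N1 S" by auto
    show "h \<in> precomp N2 G ` left_hom A N3 S"
    proof (rule g.factor_through_induced[OF T h])
      fix i assume i: "i < n"
      define k where "k = compose (carrier M2) (\<rho>T i) (compose (carrier M2) h \<eta>2)"
      have k: "k \<in> left_hom R M2 T"
        unfolding k_def
        by (rule left_hom_compose[OF f.E.M.left_module_axioms left_hom_compose[OF f.E.M.left_module_axioms
          f.E.\<eta>_hom f.D.left_hom_restricted[OF f.E.N.left_module_axioms h]] T.\<rho>_hom[OF i]])
      have ke: "k m = \<rho>T i (h (\<eta>2 m))" if "m \<in> carrier M2" for m
        using that by (simp add: k_def compose_eq)
      have "k (f m) = \<zero>\<^bsub>T\<^esub>" if m: "m \<in> carrier M1" for m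
      proof -
        have "h (F (\<eta>1 m)) = \<zero>\<^bsub>S\<^esub>"
          using fun_cong[OF hF, of "\<eta>1 m"] f.D.\<eta>_closed[OF m] by (simp add: compose_eq zero_hom_def)
        then show ?thesis
          using m f.f_closed left_hom_zero[OF T.restricted_module T.M.left_module_axioms T.\<rho>_hom[OF i]]
          by (simp add: ke f.g_\<eta>)
      qed
      then have "precomp M1 f k = zero_hom M1 T"
        by (auto simp: compose_def zero_hom_def fun_eq_iff)
      then obtain \<chi> where \<chi>: "\<chi> \<in> left_hom R M3 T" "k = precomp M2 g \<chi>"
        using exact k by blast
      then show "\<exists>\<chi>\<in>left_hom R M3 T. \<forall>m\<in>carrier M2. \<rho>T i (h (\<eta>2 m)) = \<chi> (g m)"
        using ke by (intro bexI[of _ \<chi>]) (auto simp: compose_eq)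
    qed
  qed
qed

text \<open>The same argument by components, without a kernel condition; it serves the end of the
  Hom sequence, where exactness means surjectivity onto Hom(R, T).\<close>

lemma induced_hom_surj:
  assumes g: "induced_hom R A \<iota> n \<alpha> c M2 N2 \<eta>2 \<rho>2 M3 N3 \<eta>3 \<rho>3 g G"
    and T: "induced R A \<iota> n \<alpha> c T S \<eta>T \<rho>T"
    and surj: "precomp M2 g ` left_hom R M3 T = left_hom R M2 T"
  shows "precomp N2 G ` left_hom A N3 S = left_hom A N2 S"
proof
  interpret g: induced_hom R A \<iota> n \<alpha> c M2 N2 \<eta>2 \<rho>2 M3 N3 \<eta>3 \<rho>3 g G by fact
  interpret T: induced R A \<iota> n \<alpha> c T S \<eta>T \<rho>T by fact
  show "precomp N2 G ` left_hom A N3 S \<subseteq> left_hom A N2 S"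
    by (auto intro!: left_hom_compose[OF g.D.N.left_module_axioms g.g_hom])
  show "left_hom A N2 S \<subseteq> precomp N2 G ` left_hom A N3 S"
  proof
    fix h assume h: "h \<in> left_hom A N2 S"
    show "h \<in> precomp N2 G ` left_hom A N3 S"
    proof (rule g.factor_through_induced[OF T h])
      fix i assume i: "i < n"
      define k where "k = compose (carrier M2) (\<rho>T i) (compose (carrier M2) h \<eta>2)"
      have k: "k \<in> left_hom R M2 T"
        unfolding k_def
        by (rule left_hom_compose[OF g.D.M.left_module_axioms left_hom_compose[OF g.D.M.left_module_axioms
          g.D.\<eta>_hom g.D.left_hom_restricted[OF g.D.N.left_module_axioms h]] T.\<rho>_hom[OF i]])
      have ke: "k m = \<rho>T i (h (\<eta>2 m))" if "m \<in> carrier M2" for m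
        using that by (simp add: k_def compose_eq)
      obtain \<chi> where \<chi>: "\<chi> \<in> left_hom R M3 T" "k = precomp M2 g \<chi>"
        using surj k by blast
      then show "\<exists>\<chi>\<in>left_hom R M3 T. \<forall>m\<in>carrier M2. \<rho>T i (h (\<eta>2 m)) = \<chi> (g m)"
        using ke by (intro bexI[of _ \<chi>]) (auto simp: compose_eq)
    qed
  qed
qed

text \<open>The maps that split M off a power of T are induced one by one. That their composites
  still add up to the identity is an equality of A-linear maps, so it suffices to verify it after
  \<eta>, where it holds by assumption on M.\<close>

lemma in_add_induced:
  assumes "in_add R T M" and D: "induced R A \<iota> n \<alpha> c M N \<eta> \<rho>" and T: "induced R A \<iota> n \<alpha> c T S \<eta>T \<rho>T"
  shows "in_add A S N"
proof -
  interpret D: induced R A \<iota> n \<alpha> c M N \<eta> \<rho> by fact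
  interpret T: induced R A \<iota> n \<alpha> c T S \<eta>T \<rho>T by fact
  obtain k :: nat and s q where s: "\<And>i. i < k \<Longrightarrow> s i \<in> left_hom R M T"
    and q: "\<And>i. i < k \<Longrightarrow> q i \<in> left_hom R T M"
    and qs: "\<And>x. x \<in> carrier M \<Longrightarrow> x = (\<Oplus>\<^bsub>M\<^esub>i\<in>{..<k}. q i (s i x))"
    by (fact in_addE[OF assms(1) T.M.left_module_axioms])
  let ?s = "\<lambda>i. D.extend S (compose (carrier M) \<eta>T (s i))"
  let ?q = "\<lambda>i. T.extend N (compose (carrier T) \<eta> (q i))"
  have si: "induced_hom R A \<iota> n \<alpha> c M N \<eta> \<rho> T S \<eta>T \<rho>T (s i) (?s i)" if "i < k" for i
    by (rule D.induced_map[OF T s[OF that]])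
  have qi: "induced_hom R A \<iota> n \<alpha> c T S \<eta>T \<rho>T M N \<eta> \<rho> (q i) (?q i)" if "i < k" for i
    by (rule T.induced_map[OF D q[OF that]])
  note sh = induced_hom.g_hom[OF si] and qh = induced_hom.g_hom[OF qi]
  show ?thesis
  proof (rule in_addI[OF T.N.left_module_axioms D.N.left_module_axioms, of "{..<k}" ?s ?q])
    fix x assume x: "x \<in> carrier N"
    let ?f = "\<lambda>x\<in>carrier N. \<Oplus>\<^bsub>N\<^esub>i\<in>{..<k}. compose (carrier N) (?q i) (?s i) x"
    have "(\<lambda>x\<in>carrier N. x) = ?f"
    proof (rule D.hom_eqI[OF D.N.left_module_axioms left_hom_id[OF D.N.left_module_axioms]])
      show "?f \<in> left_hom A N N"
        by (intro left_hom_sum D.N.left_module_axioms left_hom_compose[OF _ sh qh]) auto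
      fix m assume m: "m \<in> carrier M"
      have sc: "s i m \<in> carrier T" "q i (s i m) \<in> carrier M" if "i < k" for i
        using left_hom_closed[OF s[OF that] m] left_hom_closed[OF q[OF that]] by auto
      have "?f (\<eta> m) = (\<Oplus>\<^bsub>N\<^esub>i\<in>{..<k}. compose (carrier N) (?q i) (?s i) (\<eta> m))"
        using D.\<eta>_closed[OF m] by simp
      also have "\<dots> = (\<Oplus>\<^bsub>N\<^esub>i\<in>{..<k}. \<eta> (q i (s i m)))"
        using m D.\<eta>_closed sc induced_hom.g_\<eta>[OF si] induced_hom.g_\<eta>[OF qi]
        by (intro D.N.M.finsum_cong') (auto simp: compose_eq)
      also have "\<dots> = \<eta> (\<Oplus>\<^bsub>M\<^esub>i\<in>{..<k}. q i (s i m))"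
        using left_hom_finsum[OF D.M.left_module_axioms D.restricted_module D.\<eta>_hom, of "\<lambda>i. q i (s i m)" "{..<k}"] sc
        by simp
      also have "\<dots> = \<eta> m" using qs[OF m] by simp
      finally show "(\<lambda>x\<in>carrier N. x) (\<eta> m) = ?f (\<eta> m)" using D.\<eta>_closed[OF m] by simp
    qed
    from fun_cong[OF this, of x] have "x = (\<Oplus>\<^bsub>N\<^esub>i\<in>{..<k}. compose (carrier N) (?q i) (?s i) x)"
      using x by simp
    also have "\<dots> = (\<Oplus>\<^bsub>N\<^esub>i\<in>{..<k}. ?q i (?s i x))"
      using x left_hom_closed[OF qh] left_hom_closed[OF sh] by (intro D.N.M.finsum_cong') (auto simp: compose_eq)
    finally show "x = (\<Oplus>\<^bsub>N\<^esub>i\<in>{..<k}. ?q i (?s i x))" .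
  qed (use sh qh in auto)
qed

text \<open>The identification of A \<otimes> R with A. Through it, modules in add(R) induce to
  modules in add(A), and a coresolution of R induces to one of A.\<close>

lemma (in central_basis) induced_regular:
  "induced R A \<iota> n \<alpha> c (regular R) (regular A) (restrict \<iota> (carrier R)) (\<lambda>i. restrict (\<alpha> i) (carrier A))"
proof -
  interpret M: left_module R "regular R" by (rule left_module_regular[OF R.ring_axioms])
  interpret N: left_module A "regular A" by (rule left_module_regular[OF A.ring_axioms])
  show ?thesis
  proof unfold_locales
    show "restrict \<iota> (carrier R) \<in> left_hom R (regular R) (restricted \<iota> (regular A))"
      by (rule left_homI) (auto simp: \<iota>_closed \<iota>_add \<iota>_mult)
    show "restrict (\<alpha> i) (carrier A) \<in> left_hom R (restricted \<iota> (regular A)) (regular R)" if "i < n" for i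
      using that by (intro left_homI) (auto simp: \<alpha>_closed \<alpha>_add \<alpha>_left \<iota>_closed)
    fix x assume x: "x \<in> carrier (regular A)"
    then have "x = (\<Oplus>\<^bsub>A\<^esub>j\<in>{..<n}. c j \<otimes>\<^bsub>A\<^esub> \<iota> (\<alpha> j x))" by (intro basis) simp
    also have "\<dots> = (\<Oplus>\<^bsub>regular A\<^esub>j\<in>{..<n}. c j \<odot>\<^bsub>regular A\<^esub>
        restrict \<iota> (carrier R) (restrict (\<alpha> j) (carrier A) x))"
      unfolding regular_simps using x by (intro A.finsum_cong') (auto simp: \<alpha>_closed \<iota>_closed c_closed)
    finally show "x = \<dots>" .
  qed (auto simp: \<iota>_closed \<alpha>_right)
qed

text \<open>Carrying \<eta> and \<rho> along an isomorphism allows the tensor product to be replaced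
  by a copy in another type.\<close>

lemma (in induced) induced_iso:
  assumes N': "left_module A N'" and k: "k \<in> left_hom A N N'" and h: "h \<in> left_hom A N' N"
    and hk: "\<And>x. x \<in> carrier N \<Longrightarrow> h (k x) = x" and kh: "\<And>y. y \<in> carrier N' \<Longrightarrow> k (h y) = y"
  shows "induced R A \<iota> n \<alpha> c M N' (compose (carrier M) k \<eta>) (\<lambda>i. compose (carrier N') (\<rho> i) h)"
proof -
  interpret N': left_module A N' by fact
  note kc = left_hom_closed[OF k] and hc = left_hom_closed[OF h]
  show ?thesis
  proof unfold_locales
    show "compose (carrier M) k \<eta> \<in> left_hom R M (restricted \<iota> N')"
      by (rule left_hom_compose[OF M.left_module_axioms \<eta>_hom left_hom_restricted[OF N.left_module_axioms k]])
    show "compose (carrier N') (\<rho> i) h \<in> left_hom R (restricted \<iota> N') M" if "i < n" for i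
      using left_hom_compose[OF left_module_restricted[OF N'] left_hom_restricted[OF N' h] \<rho>_hom[OF that]]
      by simp
    show "compose (carrier N') (\<rho> i) h (a \<odot>\<^bsub>N'\<^esub> compose (carrier M) k \<eta> m) = \<alpha> i a \<odot>\<^bsub>M\<^esub> m"
      if "i < n" "a \<in> carrier A" "m \<in> carrier M" for i a m
      using that by (simp add: compose_eq \<eta>_closed kc hk left_hom_smult[OF h] \<rho>_smult_\<eta>)
    fix x assume x: "x \<in> carrier N'"
    have "x = k (h x)" using kh[OF x] by simp
    also have "\<dots> = (\<Oplus>\<^bsub>N'\<^esub>j\<in>{..<n}. c j \<odot>\<^bsub>N'\<^esub> k (\<eta> (\<rho> j (h x))))"
      by (rule hom_expand[OF N' k hc[OF x]])
    also have "\<dots> = (\<Oplus>\<^bsub>N'\<^esub>j\<in>{..<n}. c j \<odot>\<^bsub>N'\<^esub> compose (carrier M) k \<eta> (compose (carrier N') (\<rho> j) h x))"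
      using x by (intro N'.M.finsum_cong') (auto simp: compose_eq c_closed kc \<eta>_closed \<rho>_closed hc)
    finally show "x = (\<Oplus>\<^bsub>N'\<^esub>j\<in>{..<n}. c j \<odot>\<^bsub>N'\<^esub> compose (carrier M) k \<eta> (compose (carrier N') (\<rho> j) h x))" .
  qed
qed

text \<open>An element of N is determined by finitely many coordinates in S; the surjection h
  provides at least one argument for each coordinate. Taking the identity for h covers functions on
  \<open>nat\<close>, and taking the length covers functions on lists.\<close>

lemma in_add_embedding:
  fixes N :: "('a, 'n, 'h) module_scheme" and S :: "('a, 's, 'i) module_scheme" and h :: "'z \<Rightarrow> nat"
  assumes "in_add A S N" "left_module A S" "surj h"
  obtains k :: "'n \<Rightarrow> 'z \<Rightarrow> 's" where "inj_on k (carrier N)"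
proof -
  obtain m :: nat and s q where s: "\<And>i. i < m \<Longrightarrow> s i \<in> left_hom A N S"
    and q: "\<And>i. i < m \<Longrightarrow> q i \<in> left_hom A S N"
    and qs: "\<And>x. x \<in> carrier N \<Longrightarrow> x = (\<Oplus>\<^bsub>N\<^esub>i\<in>{..<m}. q i (s i x))"
    by (fact in_addE[OF assms(1,2)])
  interpret N: left_module A N using assms(1) by (simp add: in_add_def)
  show thesis
  proof
    show "inj_on (\<lambda>x z. if h z < m then s (h z) x else undefined) (carrier N)"
    proof (rule inj_onI)
      fix x y assume xy: "x \<in> carrier N" "y \<in> carrier N"
        and eq: "(\<lambda>z. if h z < m then s (h z) x else undefined) = (\<lambda>z. if h z < m then s (h z) y else undefined)"
      have "s i x = s i y" if "i < m" for i
        using fun_cong[OF eq, of "inv_into UNIV h i"] that by (simp add: surj_f_inv_f[OF assms(3)])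
      then have "(\<Oplus>\<^bsub>N\<^esub>i\<in>{..<m}. q i (s i x)) = (\<Oplus>\<^bsub>N\<^esub>i\<in>{..<m}. q i (s i y))"
        using left_hom_closed[OF q left_hom_closed[OF s xy(2)]] by (intro N.M.finsum_cong') auto
      then show "x = y" using qs[OF xy(1)] qs[OF xy(2)] by simp
    qed
  qed
qed

section \<open>The tensor product\<close>

locale extension_of_scalars = R: ring R + A: ring A + M: left_module R M
  for R :: "('r, 'e) ring_scheme" and A :: "('a, 'f) ring_scheme" and M :: "('r, 'm, 'g) module_scheme" +
  fixes \<iota> :: "'r \<Rightarrow> 'a"
  assumes \<iota>_hom: "\<iota> \<in> ring_hom R A"
begin

abbreviation F where "F \<equiv> free_Abelian_group (carrier A \<times> carrier M)"
abbreviation K where "K \<equiv> generate F (tensor_relations R A \<iota> M)"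
abbreviation N where "N \<equiv> induced_module R A \<iota> M"

definition cl where "cl u = K #>\<^bsub>F\<^esub> u"
definition tensor where "tensor a m = cl (frag_of (a, m))"
definition scale where "scale a = frag_extend (\<lambda>(x, t). frag_of (a \<otimes>\<^bsub>A\<^esub> x, t))"

lemma \<iota>_closed: "r \<in> carrier R \<Longrightarrow> \<iota> r \<in> carrier A"
  using \<iota>_hom by (auto simp: ring_hom_def)

sublocale F: comm_group F
  by (rule abelian_free_Abelian_group)

section \<open>The subgroup of relations and its cosets\<close>

lemma keys_diff_subset:
  "Poly_Mapping.keys u \<subseteq> B \<Longrightarrow> Poly_Mapping.keys v \<subseteq> B \<Longrightarrow> Poly_Mapping.keys (u - v) \<subseteq> B"
  using keys_diff[of u v] by blast

lemma tensor_relations_subset: "tensor_relations R A \<iota> M \<subseteq> carrier F"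
proof
  fix u assume "u \<in> tensor_relations R A \<iota> M"
  then show "u \<in> carrier F"
    unfolding tensor_relations_def
    by (elim UnE CollectE exE conjE) (simp_all add: keys_diff_subset keys_frag_of \<iota>_closed)
qed

lemma subgroup_K: "subgroup K F"
  by (rule F.generate_is_subgroup[OF tensor_relations_subset])

lemma normal_K: "K \<lhd> F"
  by (rule F.subgroup_imp_normal[OF subgroup_K])

lemma K_keys: "k \<in> K \<Longrightarrow> Poly_Mapping.keys k \<subseteq> carrier A \<times> carrier M"
  using subsetD[OF subgroup.subset[OF subgroup_K], of k] by simp

lemma K_zero: "0 \<in> K"
  using subgroup.one_closed[OF subgroup_K] by simp

lemma K_add: "k \<in> K \<Longrightarrow> l \<in> K \<Longrightarrow> k + l \<in> K"
  using subgroup.m_closed[OF subgroup_K] by simp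

lemma K_minus: "k \<in> K \<Longrightarrow> - k \<in> K"
  using subgroup.m_inv_closed[OF subgroup_K] K_keys by fastforce

lemma cl_eq: "cl u = (\<lambda>k. k + u) ` K"
  by (auto simp: cl_def r_coset_def)

lemma cl_eq_iff: "cl u = cl v \<longleftrightarrow> u - v \<in> K"
proof
  assume "cl u = cl v"
  moreover have "u \<in> cl u" using K_zero by (auto simp: cl_eq intro!: image_eqI[of _ _ 0])
  ultimately obtain k where "k \<in> K" "u = k + v" by (auto simp: cl_eq)
  then show "u - v \<in> K" by simp
next
  assume *: "u - v \<in> K"
  have "k + u \<in> cl v" if "k \<in> K" for k
    using K_add[OF that *] by (auto simp: cl_eq intro!: image_eqI[of _ _ "k + (u - v)"])
  moreover have "k + v \<in> cl u" if "k \<in> K" for k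
    using K_add[OF that K_minus[OF *]] by (auto simp: cl_eq intro!: image_eqI[of _ _ "k + (- (u - v))"])
  ultimately show "cl u = cl v" by (auto simp: cl_eq)
qed

lemma carrier_N: "carrier N = cl ` carrier F"
  by (auto simp: induced_module_def Let_def RCOSETS_def cl_def)

lemma zero_N: "\<zero>\<^bsub>N\<^esub> = cl 0"
  by (auto simp: induced_module_def Let_def cl_eq)

lemma cl_closed: "u \<in> carrier F \<Longrightarrow> cl u \<in> carrier N"
  by (auto simp: carrier_N)

lemma add_cl: "u \<in> carrier F \<Longrightarrow> v \<in> carrier F \<Longrightarrow> cl u \<oplus>\<^bsub>N\<^esub> cl v = cl (u + v)"
  using normal.rcos_sum[OF normal_K, of u v] by (simp add: induced_module_def Let_def cl_def)

lemma F_closed: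
  "u \<in> carrier F \<Longrightarrow> v \<in> carrier F \<Longrightarrow> u + v \<in> carrier F"
  "u \<in> carrier F \<Longrightarrow> v \<in> carrier F \<Longrightarrow> u - v \<in> carrier F"
  "u \<in> carrier F \<Longrightarrow> - u \<in> carrier F" "0 \<in> carrier F"
  using F.m_closed[of u v] by (simp_all add: keys_diff_subset)

lemma abelian_group_N: "abelian_group N"
proof (rule abelian_groupI)
  fix x y assume "x \<in> carrier N" "y \<in> carrier N"
  then obtain u v where uv: "u \<in> carrier F" "v \<in> carrier F" "x = cl u" "y = cl v" by (auto simp: carrier_N)
  then show "x \<oplus>\<^bsub>N\<^esub> y \<in> carrier N" "x \<oplus>\<^bsub>N\<^esub> y = y \<oplus>\<^bsub>N\<^esub> x"
    by (simp_all add: add_cl F_closed cl_closed add.commute del: carrier_free_Abelian_group_iff)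
  fix z assume "z \<in> carrier N"
  then obtain w where w: "w \<in> carrier F" "z = cl w" by (auto simp: carrier_N)
  with uv show "x \<oplus>\<^bsub>N\<^esub> y \<oplus>\<^bsub>N\<^esub> z = x \<oplus>\<^bsub>N\<^esub> (y \<oplus>\<^bsub>N\<^esub> z)"
    by (simp add: add_cl F_closed add.assoc del: carrier_free_Abelian_group_iff)
next
  fix x assume "x \<in> carrier N"
  then obtain u where u: "u \<in> carrier F" "x = cl u" by (auto simp: carrier_N)
  then show "\<zero>\<^bsub>N\<^esub> \<oplus>\<^bsub>N\<^esub> x = x"
    by (simp add: zero_N add_cl F_closed del: carrier_free_Abelian_group_iff)
  show "\<exists>y\<in>carrier N. y \<oplus>\<^bsub>N\<^esub> x = \<zero>\<^bsub>N\<^esub>"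
    using u by (intro bexI[of _ "cl (- u)"])
      (simp_all add: zero_N add_cl F_closed cl_closed del: carrier_free_Abelian_group_iff)
qed (auto simp: zero_N F_closed intro!: cl_closed)

sublocale N: abelian_group N
  by (rule abelian_group_N)

section \<open>Pure tensors, the action of A and the universal property\<close>

lemma tensor_closed: "a \<in> carrier A \<Longrightarrow> m \<in> carrier M \<Longrightarrow> tensor a m \<in> carrier N"
  unfolding tensor_def by (intro cl_closed) simp

lemma cl_relation: "u - v - w \<in> tensor_relations R A \<iota> M \<Longrightarrow> cl u = cl (v + w)"
  unfolding cl_eq_iff by (simp add: generate.incl diff_diff_eq[symmetric])

lemma tensor_add_left:
  assumes "a \<in> carrier A" "b \<in> carrier A" "m \<in> carrier M"
  shows "tensor (a \<oplus>\<^bsub>A\<^esub> b) m = tensor a m \<oplus>\<^bsub>N\<^esub> tensor b m"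
proof -
  have "tensor (a \<oplus>\<^bsub>A\<^esub> b) m = cl (frag_of (a, m) + frag_of (b, m))"
    unfolding tensor_def using assms by (intro cl_relation) (auto simp: tensor_relations_def)
  then show ?thesis using assms by (simp add: tensor_def add_cl)
qed

lemma tensor_add_right:
  assumes "a \<in> carrier A" "m \<in> carrier M" "m' \<in> carrier M"
  shows "tensor a (m \<oplus>\<^bsub>M\<^esub> m') = tensor a m \<oplus>\<^bsub>N\<^esub> tensor a m'"
proof -
  have "tensor a (m \<oplus>\<^bsub>M\<^esub> m') = cl (frag_of (a, m) + frag_of (a, m'))"
    unfolding tensor_def using assms by (intro cl_relation) (auto simp: tensor_relations_def)
  then show ?thesis using assms by (simp add: tensor_def add_cl)
qed

lemma tensor_balanced:
  assumes "a \<in> carrier A" "r \<in> carrier R" "m \<in> carrier M"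
  shows "tensor (a \<otimes>\<^bsub>A\<^esub> \<iota> r) m = tensor a (r \<odot>\<^bsub>M\<^esub> m)"
  unfolding tensor_def cl_eq_iff using assms by (intro generate.incl) (auto simp: tensor_relations_def)

lemma scale_closed: "a \<in> carrier A \<Longrightarrow> u \<in> carrier F \<Longrightarrow> scale a u \<in> carrier F"
  using keys_frag_extend[of "\<lambda>(x, t). frag_of (a \<otimes>\<^bsub>A\<^esub> x, t)" u]
  by (fastforce simp: scale_def keys_frag_of)

lemma scale_diff: "scale a (u - v) = scale a u - scale a v"
  by (simp add: scale_def frag_extend_diff)

text \<open>Left multiplication by a commutes with right multiplication by \<iota> r and distributes
  over sums, so each generating relation goes to one of the same kind; hence the action preserves
  K.\<close>

lemma scale_tensor_relations:
  assumes a: "a \<in> carrier A" and "h \<in> tensor_relations R A \<iota> M"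
  shows "scale a h \<in> tensor_relations R A \<iota> M"
proof -
  consider x y t where "h = frag_of (x \<oplus>\<^bsub>A\<^esub> y, t) - frag_of (x, t) - frag_of (y, t)"
      "x \<in> carrier A" "y \<in> carrier A" "t \<in> carrier M"
    | x s t where "h = frag_of (x, s \<oplus>\<^bsub>M\<^esub> t) - frag_of (x, s) - frag_of (x, t)"
      "x \<in> carrier A" "s \<in> carrier M" "t \<in> carrier M"
    | x r t where "h = frag_of (x \<otimes>\<^bsub>A\<^esub> \<iota> r, t) - frag_of (x, r \<odot>\<^bsub>M\<^esub> t)"
      "x \<in> carrier A" "r \<in> carrier R" "t \<in> carrier M"
    using assms(2) unfolding tensor_relations_def by blast
  then show ?thesis
  proof cases
    case (1 x y t)
    have "scale a h = frag_of (a \<otimes>\<^bsub>A\<^esub> x \<oplus>\<^bsub>A\<^esub> a \<otimes>\<^bsub>A\<^esub> y, t) - frag_of (a \<otimes>\<^bsub>A\<^esub> x, t) - frag_of (a \<otimes>\<^bsub>A\<^esub> y, t)"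
      using 1 a by (simp add: scale_diff) (simp add: scale_def A.r_distr)
    moreover have "a \<otimes>\<^bsub>A\<^esub> x \<in> carrier A" "a \<otimes>\<^bsub>A\<^esub> y \<in> carrier A" using 1 a by auto
    ultimately show ?thesis using 1(4) unfolding tensor_relations_def by blast
  next
    case (2 x s t)
    have "scale a h = frag_of (a \<otimes>\<^bsub>A\<^esub> x, s \<oplus>\<^bsub>M\<^esub> t) - frag_of (a \<otimes>\<^bsub>A\<^esub> x, s) - frag_of (a \<otimes>\<^bsub>A\<^esub> x, t)"
      using 2 a by (simp add: scale_diff) (simp add: scale_def)
    moreover have "a \<otimes>\<^bsub>A\<^esub> x \<in> carrier A" using 2 a by auto
    ultimately show ?thesis using 2(3,4) unfolding tensor_relations_def by blast
  next
    case (3 x r t)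
    have "scale a h = frag_of (a \<otimes>\<^bsub>A\<^esub> x \<otimes>\<^bsub>A\<^esub> \<iota> r, t) - frag_of (a \<otimes>\<^bsub>A\<^esub> x, r \<odot>\<^bsub>M\<^esub> t)"
      using 3 a by (simp add: scale_diff) (simp add: scale_def A.m_assoc \<iota>_closed)
    moreover have "a \<otimes>\<^bsub>A\<^esub> x \<in> carrier A" using 3 a by auto
    ultimately show ?thesis using 3(3,4) unfolding tensor_relations_def by blast
  qed
qed

lemma scale_K:
  assumes a: "a \<in> carrier A" and "k \<in> K"
  shows "scale a k \<in> K"
  using assms(2)
proof (induction k rule: generate.induct)
  case one
  then show ?case by (simp add: scale_def K_zero)
next
  case (incl h)
  then show ?case by (intro generate.incl scale_tensor_relations a)
next
  case (inv h)
  have "Poly_Mapping.keys h \<subseteq> carrier A \<times> carrier M"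
    using subsetD[OF tensor_relations_subset inv] by simp
  then have "scale a (inv\<^bsub>F\<^esub> h) = - scale a h" by (simp add: scale_def frag_extend_minus)
  then show ?case by (simp only:) (intro K_minus generate.incl scale_tensor_relations a inv)
next
  case (eng h k)
  then show ?case by (simp add: scale_def frag_extend_add K_add)
qed

text \<open>The action is well defined: the representatives of a coset differ by elements of K,
  which \<open>scale_K\<close> keeps in K, so the nonempty union in the definition has a single
  value.\<close>

lemma smult_cl:
  assumes a: "a \<in> carrier A" and u: "u \<in> carrier F"
  shows "a \<odot>\<^bsub>N\<^esub> cl u = cl (scale a u)"
proof -
  have "a \<odot>\<^bsub>N\<^esub> cl u = (\<Union>v\<in>cl u. cl (scale a v))"
    by (simp add: induced_module_def Let_def cl_def scale_def)
  moreover have "cl (scale a v) = cl (scale a u)" if v: "v \<in> cl u" for v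
  proof -
    obtain k where "k \<in> K" "v = k + u" using v by (auto simp: cl_eq)
    then show ?thesis using scale_K[OF a] by (simp add: cl_eq_iff flip: scale_diff)
  qed
  moreover have "cl u \<noteq> {}" using K_zero by (auto simp: cl_eq)
  ultimately show ?thesis by auto
qed

lemma smult_tensor:
  "a \<in> carrier A \<Longrightarrow> b \<in> carrier A \<Longrightarrow> m \<in> carrier M \<Longrightarrow> a \<odot>\<^bsub>N\<^esub> tensor b m = tensor (a \<otimes>\<^bsub>A\<^esub> b) m"
  unfolding tensor_def by (subst smult_cl) (simp_all add: scale_def)

lemma smult_closed_N: "a \<in> carrier A \<Longrightarrow> x \<in> carrier N \<Longrightarrow> a \<odot>\<^bsub>N\<^esub> x \<in> carrier N"
  unfolding carrier_N by (auto simp: smult_cl simp del: carrier_free_Abelian_group_iff intro!: imageI scale_closed)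

lemma smult_add_N:
  assumes "a \<in> carrier A" "x \<in> carrier N" "y \<in> carrier N"
  shows "a \<odot>\<^bsub>N\<^esub> (x \<oplus>\<^bsub>N\<^esub> y) = a \<odot>\<^bsub>N\<^esub> x \<oplus>\<^bsub>N\<^esub> a \<odot>\<^bsub>N\<^esub> y"
proof -
  obtain u v where uv: "u \<in> carrier F" "v \<in> carrier F" "x = cl u" "y = cl v"
    using assms(2,3) by (auto simp: carrier_N)
  then show ?thesis
    using assms(1) by (simp add: add_cl smult_cl scale_closed F_closed del: carrier_free_Abelian_group_iff)
      (simp add: scale_def frag_extend_add)
qed

text \<open>Formal sums are generated by pairs, so additive maps on the tensor product that agree on
  pure tensors are equal. The module laws, the linearity of \<rho> and the expansion formula are all
  verified in this way.\<close>

lemma additive_eqI: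
  assumes G: "abelian_group G" and x: "x \<in> carrier N"
    and f: "\<And>x. x \<in> carrier N \<Longrightarrow> f x \<in> carrier G" and g: "\<And>x. x \<in> carrier N \<Longrightarrow> g x \<in> carrier G"
    and f_add: "\<And>x y. x \<in> carrier N \<Longrightarrow> y \<in> carrier N \<Longrightarrow> f (x \<oplus>\<^bsub>N\<^esub> y) = f x \<oplus>\<^bsub>G\<^esub> f y"
    and g_add: "\<And>x y. x \<in> carrier N \<Longrightarrow> y \<in> carrier N \<Longrightarrow> g (x \<oplus>\<^bsub>N\<^esub> y) = g x \<oplus>\<^bsub>G\<^esub> g y"
    and fg: "\<And>a m. a \<in> carrier A \<Longrightarrow> m \<in> carrier M \<Longrightarrow> f (tensor a m) = g (tensor a m)"
  shows "f x = g x"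
proof -
  interpret G: abelian_group G by fact
  obtain u where u: "u \<in> carrier F" "x = cl u" using x by (auto simp: carrier_N)
  have "Poly_Mapping.keys u \<subseteq> carrier A \<times> carrier M" using u(1) by simp
  then have "f (cl u) = g (cl u)"
  proof (induction u rule: free_Abelian_group_induct[consumes 1, case_names zero diff single])
    case zero
    have z: "cl 0 \<in> carrier N" by (intro cl_closed F_closed)
    have zz: "cl 0 \<oplus>\<^bsub>N\<^esub> cl 0 = cl 0" using z by (simp flip: zero_N)
    have "h (cl 0) = \<zero>\<^bsub>G\<^esub>" if "h (cl 0) \<in> carrier G" "h (cl 0 \<oplus>\<^bsub>N\<^esub> cl 0) = h (cl 0) \<oplus>\<^bsub>G\<^esub> h (cl 0)" for h
      using that G.add.r_cancel_one'[of "h (cl 0)" "h (cl 0)"] by (simp add: zz)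
    from this[of f] this[of g] show ?case using f g f_add g_add z by simp
  next
    case (diff u v)
    then have c: "cl (u - v) \<in> carrier N" "cl v \<in> carrier N" "cl u \<in> carrier N"
      by (auto intro!: cl_closed simp: keys_diff_subset)
    have s: "cl (u - v) \<oplus>\<^bsub>N\<^esub> cl v = cl u" using diff by (simp add: add_cl keys_diff_subset)
    \<comment> \<open>The induction over formal sums proceeds by differences; the value at u - v is
      recovered from that at u by cancelling the value at v.\<close>
    have "f (cl (u - v)) \<oplus>\<^bsub>G\<^esub> f (cl v) = g (cl (u - v)) \<oplus>\<^bsub>G\<^esub> f (cl v)"
      using f_add[OF c(1,2)] g_add[OF c(1,2)] diff unfolding s by simp
    then show ?case using c f g by simp
  next
    case (single p)
    then show ?case using fg by (auto simp: tensor_def)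
  qed
  then show ?thesis using u by simp
qed

lemma left_module_N: "left_module A N"
proof (intro left_moduleI abelian_group_N A.ring_axioms smult_closed_N smult_add_N)
  fix a b x assume ab: "a \<in> carrier A" "b \<in> carrier A" and x: "x \<in> carrier N"
  show "(a \<oplus>\<^bsub>A\<^esub> b) \<odot>\<^bsub>N\<^esub> x = a \<odot>\<^bsub>N\<^esub> x \<oplus>\<^bsub>N\<^esub> b \<odot>\<^bsub>N\<^esub> x"
    by (rule additive_eqI[OF abelian_group_N x])
      (use ab in \<open>auto simp: smult_closed_N smult_add_N smult_tensor A.l_distr tensor_add_left N.a_ac\<close>)
  show "(a \<otimes>\<^bsub>A\<^esub> b) \<odot>\<^bsub>N\<^esub> x = a \<odot>\<^bsub>N\<^esub> (b \<odot>\<^bsub>N\<^esub> x)"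
    by (rule additive_eqI[OF abelian_group_N x])
      (use ab in \<open>auto simp: smult_closed_N smult_add_N smult_tensor A.m_assoc\<close>)
next
  fix x assume x: "x \<in> carrier N"
  show "\<one>\<^bsub>A\<^esub> \<odot>\<^bsub>N\<^esub> x = x"
    by (rule additive_eqI[OF abelian_group_N x]) (auto simp: smult_closed_N smult_add_N smult_tensor)
qed

text \<open>The map b extends to the free abelian group; bilinearity and balance make the extension
  h vanish on the generating relations, hence on K, so that it is constant on cosets. The outcome is
  additive; linearity over R is a separate matter.\<close>

lemma tensor_universal:
  assumes G: "abelian_group G" and b: "\<And>a m. a \<in> carrier A \<Longrightarrow> m \<in> carrier M \<Longrightarrow> b a m \<in> carrier G"
    and left: "\<And>a a' m. a \<in> carrier A \<Longrightarrow> a' \<in> carrier A \<Longrightarrow> m \<in> carrier M \<Longrightarrow>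
      b (a \<oplus>\<^bsub>A\<^esub> a') m = b a m \<oplus>\<^bsub>G\<^esub> b a' m"
    and right: "\<And>a m m'. a \<in> carrier A \<Longrightarrow> m \<in> carrier M \<Longrightarrow> m' \<in> carrier M \<Longrightarrow>
      b a (m \<oplus>\<^bsub>M\<^esub> m') = b a m \<oplus>\<^bsub>G\<^esub> b a m'"
    and bal: "\<And>a r m. a \<in> carrier A \<Longrightarrow> r \<in> carrier R \<Longrightarrow> m \<in> carrier M \<Longrightarrow>
      b (a \<otimes>\<^bsub>A\<^esub> \<iota> r) m = b a (r \<odot>\<^bsub>M\<^esub> m)"
  obtains f where "\<And>x. x \<in> carrier N \<Longrightarrow> f x \<in> carrier G"
    "\<And>x y. x \<in> carrier N \<Longrightarrow> y \<in> carrier N \<Longrightarrow> f (x \<oplus>\<^bsub>N\<^esub> y) = f x \<oplus>\<^bsub>G\<^esub> f y"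
    "\<And>a m. a \<in> carrier A \<Longrightarrow> m \<in> carrier M \<Longrightarrow> f (tensor a m) = b a m"
proof -
  interpret G: abelian_group G by fact
  obtain h where h: "h \<in> hom F (add_monoid G)"
    and hb: "\<And>p. p \<in> carrier A \<times> carrier M \<Longrightarrow> h (frag_of p) = (case p of (a, m) \<Rightarrow> b a m)"
    by (rule comm_group.free_Abelian_group_universal[OF G.a_comm_group, of "\<lambda>(a, m). b a m" "carrier A \<times> carrier M"])
      (use b in auto)
  have hc: "h u \<in> carrier G" if "u \<in> carrier F" for u using h that by (auto simp: hom_def)
  have h_add: "h (u + v) = h u \<oplus>\<^bsub>G\<^esub> h v" if "u \<in> carrier F" "v \<in> carrier F" for u v
    using h that by (auto simp: hom_def)
  have h_diff: "h (u - v) = h u \<ominus>\<^bsub>G\<^esub> h v" if "u \<in> carrier F" "v \<in> carrier F" for u v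
    using h_add[of "u - v" v] that F_closed(2)[OF that] hc
    by (simp add: a_minus_def G.a_assoc G.r_neg del: carrier_free_Abelian_group_iff)
  have fr: "frag_of (a, m) \<in> carrier F" if "a \<in> carrier A" "m \<in> carrier M" for a m using that by simp
  \<comment> \<open>The shape of an additivity relation after expansion and sorting, supplied as a
    rewrite rule for \<open>rel\<close>.\<close>
  have cancel: "p \<oplus>\<^bsub>G\<^esub> (q \<oplus>\<^bsub>G\<^esub> (\<ominus>\<^bsub>G\<^esub> p \<oplus>\<^bsub>G\<^esub> \<ominus>\<^bsub>G\<^esub> q)) = \<zero>\<^bsub>G\<^esub>" if "p \<in> carrier G" "q \<in> carrier G" for p q
    using G.r_neg[of "p \<oplus>\<^bsub>G\<^esub> q"] that by (simp add: G.minus_add G.a_assoc)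
  have rel: "h u = \<zero>\<^bsub>G\<^esub>" if "u \<in> tensor_relations R A \<iota> M" for u
    using that unfolding tensor_relations_def
    by (elim UnE CollectE exE conjE)
      (simp_all add: h_diff hb fr F_closed left right bal b \<iota>_closed G.minus_add a_minus_def G.a_ac G.r_neg
        cancel del: carrier_free_Abelian_group_iff)
  have hK: "h k = \<zero>\<^bsub>G\<^esub>" if "k \<in> K" for k
    using that
  proof (induction rule: generate.induct)
    case one
    then show ?case using h_diff[OF F_closed(4) F_closed(4)] hc[OF F_closed(4)] by (simp add: G.r_neg a_minus_def)
  next
    case (inv k)
    then have "k \<in> carrier F" using tensor_relations_subset by blast
    then show ?case using h_diff[OF F_closed(4), of k] h_diff[OF F_closed(4) F_closed(4)] hc[OF F_closed(4)] rel[OF inv]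
      by (simp add: G.r_neg a_minus_def)
  next
    case (eng k l)
    then have "k \<in> carrier F" "l \<in> carrier F" using K_keys by auto
    then show ?case using eng h_add by simp
  qed (rule rel)
  define f where "f = (\<lambda>x. h (SOME u. u \<in> carrier F \<and> x = cl u))"
  have f: "f (cl u) = h u" if u: "u \<in> carrier F" for u
  proof -
    have "h (SOME v. v \<in> carrier F \<and> cl u = cl v) = h u"
    proof (rule someI2[of "\<lambda>v. v \<in> carrier F \<and> cl u = cl v" u "\<lambda>v. h v = h u"])
      show "u \<in> carrier F \<and> cl u = cl u" by (rule conjI[OF u refl])
      fix v assume "v \<in> carrier F \<and> cl u = cl v"
      then have v: "v \<in> carrier F" "u - v \<in> K" by (simp_all only: cl_eq_iff)
      have "h u = h (u - v) \<oplus>\<^bsub>G\<^esub> h v" using h_add[OF F_closed(2)[OF u v(1)] v(1)] by simp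
      then show "h v = h u" using hK[OF v(2)] hc[OF v(1)] by simp
    qed
    then show ?thesis by (simp only: f_def)
  qed
  show thesis
  proof
    show "f x \<in> carrier G" if "x \<in> carrier N" for x using that f hc by (auto simp: carrier_N simp del: carrier_free_Abelian_group_iff)
    show "f (x \<oplus>\<^bsub>N\<^esub> y) = f x \<oplus>\<^bsub>G\<^esub> f y" if "x \<in> carrier N" "y \<in> carrier N" for x y
      using that f h_add by (auto simp: carrier_N add_cl F_closed simp del: carrier_free_Abelian_group_iff)
    show "f (tensor a m) = b a m" if "a \<in> carrier A" "m \<in> carrier M" for a m
      using that f[OF fr[OF that]] hb by (simp add: tensor_def)
  qed
qed

end

text \<open>The coordinate \<rho>_i is a \<otimes> m |-> \<alpha>_i(a) m: it is balanced because
  \<alpha>_i is right R-linear, and R-linear because \<alpha>_i is left R-linear. On pure tensors,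
  the expansion is a = \<Sum> c_j \<iota>(\<alpha>_j(a)) with the scalars \<alpha>_j(a) moved across
  the tensor sign.\<close>

lemma (in central_basis) induced_induced_module:
  assumes M: "left_module R M"
  obtains \<eta> \<rho> where "induced R A \<iota> n \<alpha> c M (induced_module R A \<iota> M) \<eta> \<rho>"
proof -
  interpret M: left_module R M by fact
  interpret extension_of_scalars R A M \<iota> by unfold_locales (rule \<iota>_hom)
  let ?N = "induced_module R A \<iota> M"
  note N = left_module_N
  interpret NN: left_module A ?N by (rule N)
  \<comment> \<open>The properties are bundled into one predicate so that the maps can be chosen for
    all i < n at once.\<close>
  define good where "good = (\<lambda>i f. (\<forall>x\<in>carrier ?N. f x \<in> carrier M) \<and>
      (\<forall>x\<in>carrier ?N. \<forall>y\<in>carrier ?N. f (x \<oplus>\<^bsub>?N\<^esub> y) = f x \<oplus>\<^bsub>M\<^esub> f y) \<and>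
      (\<forall>a\<in>carrier A. \<forall>m\<in>carrier M. f (tensor a m) = \<alpha> i a \<odot>\<^bsub>M\<^esub> m))"
  have "\<exists>f. good i f" if i: "i < n" for i
  proof (rule tensor_universal[OF M.abelian_group_axioms, of "\<lambda>a m. \<alpha> i a \<odot>\<^bsub>M\<^esub> m"])
    fix f assume "\<And>x. x \<in> carrier ?N \<Longrightarrow> f x \<in> carrier M"
      "\<And>x y. x \<in> carrier ?N \<Longrightarrow> y \<in> carrier ?N \<Longrightarrow> f (x \<oplus>\<^bsub>?N\<^esub> y) = f x \<oplus>\<^bsub>M\<^esub> f y"
      "\<And>a m. a \<in> carrier A \<Longrightarrow> m \<in> carrier M \<Longrightarrow> f (tensor a m) = \<alpha> i a \<odot>\<^bsub>M\<^esub> m"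
    then show ?thesis unfolding good_def by (intro exI[of _ f]) simp
  qed (use i in \<open>auto simp: \<alpha>_closed \<alpha>_add \<alpha>_right \<iota>_closed M.smult_l_distr M.smult_r_distr M.smult_assoc1\<close>)
  then have "\<forall>i. \<exists>f. i < n \<longrightarrow> good i f" by blast
  then obtain f where "\<forall>i. i < n \<longrightarrow> good i (f i)" by (rule choice[THEN exE])
  then have f_closed: "\<And>i x. i < n \<Longrightarrow> x \<in> carrier ?N \<Longrightarrow> f i x \<in> carrier M"
    and f_add: "\<And>i x y. i < n \<Longrightarrow> x \<in> carrier ?N \<Longrightarrow> y \<in> carrier ?N \<Longrightarrow> f i (x \<oplus>\<^bsub>?N\<^esub> y) = f i x \<oplus>\<^bsub>M\<^esub> f i y"
    and f_tensor: "\<And>i a m. i < n \<Longrightarrow> a \<in> carrier A \<Longrightarrow> m \<in> carrier M \<Longrightarrow> f i (tensor a m) = \<alpha> i a \<odot>\<^bsub>M\<^esub> m"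
    by (simp_all add: good_def)
  let ?\<eta> = "\<lambda>m\<in>carrier M. tensor \<one>\<^bsub>A\<^esub> m" and ?\<rho> = "\<lambda>i. restrict (f i) (carrier ?N)"
  have \<eta>: "?\<eta> \<in> left_hom R M (restricted \<iota> ?N)"
  proof (rule left_hom_restrictI[OF M])
    show "tensor \<one>\<^bsub>A\<^esub> (r \<odot>\<^bsub>M\<^esub> m) = r \<odot>\<^bsub>restricted \<iota> ?N\<^esub> tensor \<one>\<^bsub>A\<^esub> m"
      if "r \<in> carrier R" "m \<in> carrier M" for r m
      using that tensor_balanced[of "\<one>\<^bsub>A\<^esub>" r m] by (simp add: \<iota>_closed smult_tensor)
  qed (auto simp: tensor_closed tensor_add_right)
  have \<rho>: "?\<rho> i \<in> left_hom R (restricted \<iota> ?N) M" if i: "i < n" for i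
  proof -
    have "f i (\<iota> r \<odot>\<^bsub>?N\<^esub> x) = r \<odot>\<^bsub>M\<^esub> f i x" if "r \<in> carrier R" and x: "x \<in> carrier ?N" for r x
      by (rule additive_eqI[OF M.abelian_group_axioms x])
        (use i that(1) in \<open>auto simp: f_closed f_add f_tensor \<iota>_closed tensor_closed smult_tensor \<alpha>_left \<alpha>_closed
          M.smult_r_distr M.smult_assoc1 NN.smult_r_distr\<close>)
    then show ?thesis using i
      by (intro left_homI) (auto simp: f_closed f_add \<iota>_closed)
  qed
  have "x = (\<Oplus>\<^bsub>?N\<^esub>j\<in>{..<n}. c j \<odot>\<^bsub>?N\<^esub> ?\<eta> (?\<rho> j x))" (is "x = ?\<Phi> x") if x: "x \<in> carrier ?N" for x
  proof (rule additive_eqI[OF abelian_group_N x, of "\<lambda>x. x" ?\<Phi>])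
    have tc: "c j \<odot>\<^bsub>?N\<^esub> tensor \<one>\<^bsub>A\<^esub> (f j y) \<in> carrier ?N" if "j < n" "y \<in> carrier ?N" for j y
      using that by (simp add: c_closed tensor_closed f_closed)
    show "?\<Phi> y \<in> carrier ?N" if y: "y \<in> carrier ?N" for y
      using y by (auto intro!: N.finsum_closed simp: tc f_closed)
    show "?\<Phi> (y \<oplus>\<^bsub>?N\<^esub> z) = ?\<Phi> y \<oplus>\<^bsub>?N\<^esub> ?\<Phi> z" if yz: "y \<in> carrier ?N" "z \<in> carrier ?N" for y z
    proof -
      have "?\<Phi> (y \<oplus>\<^bsub>?N\<^esub> z) = (\<Oplus>\<^bsub>?N\<^esub>j\<in>{..<n}. c j \<odot>\<^bsub>?N\<^esub> ?\<eta> (?\<rho> j y) \<oplus>\<^bsub>?N\<^esub> c j \<odot>\<^bsub>?N\<^esub> ?\<eta> (?\<rho> j z))"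
        using yz by (intro N.finsum_cong')
          (auto simp: tc f_closed f_add tensor_add_right tensor_closed c_closed NN.smult_r_distr)
      also have "\<dots> = ?\<Phi> y \<oplus>\<^bsub>?N\<^esub> ?\<Phi> z"
        using yz by (intro N.finsum_addf) (auto simp: tc f_closed)
      finally show ?thesis .
    qed
    show "tensor a m = ?\<Phi> (tensor a m)" if am: "a \<in> carrier A" "m \<in> carrier M" for a m
    proof -
      have t: "c j \<odot>\<^bsub>?N\<^esub> ?\<eta> (?\<rho> j (tensor a m)) = tensor (c j \<otimes>\<^bsub>A\<^esub> \<iota> (\<alpha> j a)) m" if "j < n" for j
        using that am tensor_balanced[of "\<one>\<^bsub>A\<^esub>" "\<alpha> j a" m]
        by (simp add: tensor_closed f_tensor \<alpha>_closed c_closed \<iota>_closed smult_tensor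
            tensor_balanced)
      have "?\<Phi> (tensor a m) = (\<Oplus>\<^bsub>?N\<^esub>j\<in>{..<n}. tensor (c j \<otimes>\<^bsub>A\<^esub> \<iota> (\<alpha> j a)) m)"
        using am t by (intro N.finsum_cong') (auto simp: tensor_closed c_closed \<iota>_closed \<alpha>_closed)
      also have "\<dots> = (\<Oplus>\<^bsub>?N\<^esub>j\<in>{..<n}. (c j \<otimes>\<^bsub>A\<^esub> \<iota> (\<alpha> j a)) \<odot>\<^bsub>?N\<^esub> tensor \<one>\<^bsub>A\<^esub> m)"
        using am by (intro N.finsum_cong') (auto simp: smult_tensor tensor_closed c_closed \<iota>_closed \<alpha>_closed)
      also have "\<dots> = (\<Oplus>\<^bsub>A\<^esub>j\<in>{..<n}. c j \<otimes>\<^bsub>A\<^esub> \<iota> (\<alpha> j a)) \<odot>\<^bsub>?N\<^esub> tensor \<one>\<^bsub>A\<^esub> m"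
        using am by (intro NN.finsum_smult[symmetric]) (auto simp: tensor_closed c_closed \<iota>_closed \<alpha>_closed)
      also have "\<dots> = tensor a m" using am basis[OF am(1)] by (simp add: smult_tensor)
      finally show ?thesis by simp
    qed
  qed auto
  then have "induced R A \<iota> n \<alpha> c M ?N ?\<eta> ?\<rho>"
    by unfold_locales
      (use \<eta> \<rho> in \<open>auto simp: f_tensor smult_tensor tensor_closed\<close>)
  then show thesis by (rule that)
qed

section \<open>Wakamatsu tilting modules\<close>

text \<open>The module axioms see only these four fields, so they pass between records of different
  types, here from modules to bimodules.\<close>

lemma left_module_cong:
  assumes M: "left_module R M" and eq: "carrier N = carrier M" "\<zero>\<^bsub>N\<^esub> = \<zero>\<^bsub>M\<^esub>" "add N = add M" "smult N = smult M"
  shows "left_module R N"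
proof -
  interpret left_module R M by fact
  show ?thesis
    by (intro left_moduleI abelian_groupI R.ring_axioms)
      (auto simp: eq M.a_ac smult_l_distr smult_r_distr smult_assoc1 intro: M.add.l_inv_ex)
qed

lemma finsum_eq_if_add_monoid_eq:
  assumes "carrier N = carrier M" "\<zero>\<^bsub>N\<^esub> = \<zero>\<^bsub>M\<^esub>" "add N = add M"
  shows "finsum N = finsum M"
  using assms by (intro ext) (simp add: finsum_def finprod_def)

lemma bimodule_power_simps [simp]:
  "carrier (bimodule_power n M) = carrier (copower {..<n} M)"
  "\<zero>\<^bsub>bimodule_power n M\<^esub> = \<zero>\<^bsub>copower {..<n} M\<^esub>"
  "add (bimodule_power n M) = add (copower {..<n} M)"
  "smult (bimodule_power n M) = smult (copower {..<n} M)"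
  "rsmult (bimodule_power n M) f r = (\<lambda>i\<in>{..<n}. rsmult M (f i) r)"
  by (simp_all add: bimodule_power_def module.extend_def bimodule.fields_def copower_def)

lemma ring_bimodule_simps [simp]:
  "carrier (ring_bimodule f g B) = carrier B" "\<zero>\<^bsub>ring_bimodule f g B\<^esub> = \<zero>\<^bsub>B\<^esub>"
  "add (ring_bimodule f g B) = add B" "l \<odot>\<^bsub>ring_bimodule f g B\<^esub> b = f l \<otimes>\<^bsub>B\<^esub> b"
  "rsmult (ring_bimodule f g B) b r = b \<otimes>\<^bsub>B\<^esub> g r"
  by (simp_all add: ring_bimodule_def)

text \<open>With A embedded by f as a bimodule summand U of R^n, the \<alpha>_i are the coordinates
  of f, and c_j is the element of A corresponding to the projection onto U of the j-th unit
  vector.\<close>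

lemma centrally_projective_basis:
  assumes "ring_extension R A \<iota>" "centrally_projective R A \<iota>"
  obtains n \<alpha> c where "central_basis R A \<iota> n \<alpha> c"
proof -
  interpret R: ring R using assms(1) by (simp add: ring_extension_def)
  interpret A: ring A using assms(1) by (simp add: ring_extension_def)
  have \<iota>: "\<iota> \<in> ring_hom R A" using assms(1) by (simp add: ring_extension_def)
  have \<iota>_closed: "r \<in> carrier R \<Longrightarrow> \<iota> r \<in> carrier A" for r using \<iota> by (auto simp: ring_hom_def)
  let ?B = "ring_bimodule \<iota> \<iota> A"
  let ?R = "ring_bimodule id id R"
  obtain n U V f where sub: "sub_bimodule R R U (bimodule_power n ?R)" "sub_bimodule R R V (bimodule_power n ?R)"
    and UV: "U \<inter> V = {\<zero>\<^bsub>bimodule_power n ?R\<^esub>}" "U <+>\<^bsub>bimodule_power n ?R\<^esub> V = carrier (bimodule_power n ?R)"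
    and f: "f \<in> left_hom R ?B (bimodule_power n ?R\<lparr>carrier := U\<rparr>)"
    and bij: "bij_betw f (carrier ?B) (carrier (bimodule_power n ?R\<lparr>carrier := U\<rparr>))"
    and fr: "\<forall>x\<in>carrier ?B. \<forall>r\<in>carrier R. f (rsmult ?B x r) = rsmult (bimodule_power n ?R\<lparr>carrier := U\<rparr>) (f x) r"
    using assms(2) unfolding centrally_projective_def bimodule_iso_to_summand_def bimodule_iso_def by blast
  let ?C = "bimodule_power n ?R"
  have subU: "submodule U R ?C" and subV: "submodule V R ?C"
    and Ur: "\<And>x r. x \<in> U \<Longrightarrow> r \<in> carrier R \<Longrightarrow> rsmult ?C x r \<in> U"
    and Vr: "\<And>x r. x \<in> V \<Longrightarrow> r \<in> carrier R \<Longrightarrow> rsmult ?C x r \<in> V"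
    using sub by (auto simp: sub_bimodule_def)
  have R': "left_module R ?R"
    by (rule left_module_cong[OF left_module_regular[OF R.ring_axioms]]) (auto simp: fun_eq_iff)
  note C0 = left_module_copower[OF R', of "{..<n}"]
  have C: "left_module R ?C" by (rule left_module_cong[OF C0]) simp_all
  have B: "left_module R ?B"
    by (intro left_moduleI abelian_groupI R.ring_axioms)
      (use \<iota> in \<open>auto simp: ring_hom_def A.l_distr A.r_distr A.m_assoc A.a_ac Pi_def intro: A.add.l_inv_ex\<close>)
  interpret C: left_module R ?C by (rule C)
  obtain p where p: "p \<in> left_hom R ?C ?C" and p_add: "\<And>u v. u \<in> U \<Longrightarrow> v \<in> V \<Longrightarrow> p (u \<oplus>\<^bsub>?C\<^esub> v) = u"
    and dec: "\<And>y. y \<in> carrier ?C \<Longrightarrow> \<exists>u\<in>U. \<exists>v\<in>V. y = u \<oplus>\<^bsub>?C\<^esub> v"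
    by (fact summand_projection[OF C subU subV UV])
  have UC: "U \<subseteq> carrier ?C" and VC: "V \<subseteq> carrier ?C"
    using subgroup.subset[OF submodule.axioms(1)[OF subU]] subgroup.subset[OF submodule.axioms(1)[OF subV]]
    by (simp_all del: bimodule_power_simps)
  have memC: "x \<in> carrier ?C \<longleftrightarrow> x \<in> {..<n} \<rightarrow>\<^sub>E carrier R" for x by auto
  have zV: "\<zero>\<^bsub>?C\<^esub> \<in> V" using UV(1) by auto
  have pU: "p y \<in> U" if y: "y \<in> carrier ?C" for y
  proof -
    obtain u v where "u \<in> U" "v \<in> V" "y = u \<oplus>\<^bsub>?C\<^esub> v" using dec[OF y] by blast
    then show ?thesis using p_add[of u v] by (simp only:)
  qed
  have pu: "p u = u" if "u \<in> U" for u
    using p_add[OF that zV] C.M.r_zero[of u] UC that by auto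
  have fU: "f a \<in> U" if "a \<in> carrier A" for a using bij that by (auto simp: bij_betw_def)
  have fC: "f a \<in> carrier ?C" if "a \<in> carrier A" for a using fU[OF that] UC by blast
  have f_add: "f (a \<oplus>\<^bsub>A\<^esub> b) = f a \<oplus>\<^bsub>?C\<^esub> f b" if "a \<in> carrier A" "b \<in> carrier A" for a b
    using left_hom_add[OF f, of a b] that by simp
  have f_left: "f (\<iota> r \<otimes>\<^bsub>A\<^esub> a) = r \<odot>\<^bsub>?C\<^esub> f a" if "r \<in> carrier R" "a \<in> carrier A" for r a
    using left_hom_smult[OF f, of r a] that by simp
  have f_right: "f (a \<otimes>\<^bsub>A\<^esub> \<iota> r) = rsmult ?C (f a) r" if "r \<in> carrier R" "a \<in> carrier A" for r a
    using fr that by simp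
  have fh: "f \<in> left_hom R ?B ?C"
    using fC f_add f_left by (intro left_homI) (auto simp del: bimodule_power_simps simp: left_hom_undefined[OF f])
  \<comment> \<open>\<open>summand_projection\<close> yields left linearity only. Right linearity
    holds because both summands are stable under the right action, so it respects the
    decomposition.\<close>
  have p_right: "p (rsmult ?C y r) = rsmult ?C (p y) r" if y: "y \<in> carrier ?C" and r: "r \<in> carrier R" for y r
  proof -
    obtain u v where uv: "u \<in> U" "v \<in> V" "y = u \<oplus>\<^bsub>?C\<^esub> v" using dec[OF y] by blast
    have "u \<in> carrier ?C" "v \<in> carrier ?C" using uv UC VC by auto
    then have "u i \<in> carrier R" "v i \<in> carrier R" if "i < n" for i using that unfolding memC by auto
    then have "rsmult ?C y r = rsmult ?C u r \<oplus>\<^bsub>?C\<^esub> rsmult ?C v r"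
      using r by (auto simp: uv(3) R.l_distr fun_eq_iff)
    then show ?thesis using p_add Ur[OF uv(1) r] Vr[OF uv(2) r] uv by metis
  qed
  define e where "e = (\<lambda>j. \<lambda>i\<in>{..<n}. if i = j then \<one>\<^bsub>R\<^esub> else \<zero>\<^bsub>R\<^esub>)"
  have e: "e j \<in> carrier ?C" for j by (auto simp: e_def memC simp del: bimodule_power_simps)
  define g where "g = inv_into (carrier A) f"
  have g: "g u \<in> carrier A" "f (g u) = u" if "u \<in> U" for u
    using bij that by (auto simp: g_def bij_betw_def inv_into_into f_inv_into_f)
  have f_inj: "a = b" if "f a = f b" "a \<in> carrier A" "b \<in> carrier A" for a b
    using bij that by (auto simp: bij_betw_def inj_on_def)
  define c where "c = (\<lambda>j. g (p (e j)))"
  have c: "c j \<in> carrier A" "f (c j) = p (e j)" for j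
    using g[OF pU[OF e]] by (auto simp: c_def)
  have comm: "\<iota> r \<otimes>\<^bsub>A\<^esub> c j = c j \<otimes>\<^bsub>A\<^esub> \<iota> r" if r: "r \<in> carrier R" for r j
  proof (rule f_inj)
    \<comment> \<open>The left and right actions of R agree on unit vectors; the bimodule maps p and
      f carry this over to c j.\<close>
    have "r \<odot>\<^bsub>?C\<^esub> e j = rsmult ?C (e j) r" using r by (auto simp: e_def fun_eq_iff)
    then show "f (\<iota> r \<otimes>\<^bsub>A\<^esub> c j) = f (c j \<otimes>\<^bsub>A\<^esub> \<iota> r)"
      using r by (simp only: f_left f_right c left_hom_smult[OF p r e, symmetric] p_right[OF e r, symmetric])
  qed (use r c \<iota>_closed in auto)
  have "central_basis R A \<iota> n (\<lambda>i a. f a i) c"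
  proof (unfold_locales, rule \<iota>)
    fix i a assume i: "i < n" and a: "a \<in> carrier A"
    show fi: "f a i \<in> carrier R" using fC[OF a] i unfolding memC by auto
    show "f (a \<oplus>\<^bsub>A\<^esub> b) i = f a i \<oplus>\<^bsub>R\<^esub> f b i" if "b \<in> carrier A" for b
      using f_add[OF a that] i by simp
    show "f (a \<otimes>\<^bsub>A\<^esub> \<iota> r) i = f a i \<otimes>\<^bsub>R\<^esub> r" if "r \<in> carrier R" for r
      using f_right[OF that a] i by simp
  next
    fix i r a assume "i < n" "r \<in> carrier R" "a \<in> carrier A"
    then show "f (\<iota> r \<otimes>\<^bsub>A\<^esub> a) i = r \<otimes>\<^bsub>R\<^esub> f a i" using f_left[of r a] by simp
  next
    fix i r assume "i < n" "r \<in> carrier R"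
    then show "\<iota> r \<otimes>\<^bsub>A\<^esub> c i = c i \<otimes>\<^bsub>A\<^esub> \<iota> r" by (intro comm)
  next
    fix a assume a: "a \<in> carrier A"
    have fi: "f a i \<in> carrier R" if "i < n" for i using fC[OF a] that unfolding memC by auto
    have ca: "c j \<otimes>\<^bsub>A\<^esub> \<iota> (f a j) \<in> carrier A" if "j < n" for j using c fi[OF that] \<iota>_closed by auto
    have es: "rsmult ?C (e j) (f a j) \<in> carrier ?C" if "j < n" for j
      using fi[OF that] unfolding memC by (auto simp: e_def)
    have sumB: "finsum ?B = finsum A" by (rule finsum_eq_if_add_monoid_eq) simp_all
    have sumC: "finsum ?C = finsum (copower {..<n} ?R)" by (rule finsum_eq_if_add_monoid_eq) simp_all
    \<comment> \<open>The expansion of a is verified after the injective map f: there it becomes p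
      applied to the expansion of f a in unit vectors, and p fixes f a.\<close>
    have "f (\<Oplus>\<^bsub>A\<^esub>j\<in>{..<n}. c j \<otimes>\<^bsub>A\<^esub> \<iota> (f a j)) = (\<Oplus>\<^bsub>?C\<^esub>j\<in>{..<n}. f (c j \<otimes>\<^bsub>A\<^esub> \<iota> (f a j)))"
      unfolding sumB[symmetric] by (rule left_hom_finsum[OF B C fh]) (auto simp: ca)
    also have "\<dots> = (\<Oplus>\<^bsub>?C\<^esub>j\<in>{..<n}. p (rsmult ?C (e j) (f a j)))"
    proof (rule C.M.finsum_cong'[OF refl])
      show "(\<lambda>j. p (rsmult ?C (e j) (f a j))) \<in> {..<n} \<rightarrow> carrier ?C"
        using left_hom_closed[OF p es] by blast
      show "f (c j \<otimes>\<^bsub>A\<^esub> \<iota> (f a j)) = p (rsmult ?C (e j) (f a j))" if "j \<in> {..<n}" for j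
        using that fi by (simp only: f_right[OF _ c(1)] c(2) p_right[OF e] lessThan_iff)
    qed
    also have "\<dots> = p (\<Oplus>\<^bsub>?C\<^esub>j\<in>{..<n}. rsmult ?C (e j) (f a j))"
      by (rule left_hom_finsum[OF C C p, symmetric]) (use es in blast)
    also have "(\<Oplus>\<^bsub>?C\<^esub>j\<in>{..<n}. rsmult ?C (e j) (f a j)) =
        (\<Oplus>\<^bsub>?C\<^esub>j\<in>{..<n}. (\<lambda>i\<in>{..<n}. if i = j then f a j else \<zero>\<^bsub>?R\<^esub>))"
    proof (rule C.M.finsum_cong'[OF refl])
      have "(\<lambda>i\<in>{..<n}. if i = j then f a j else \<zero>\<^bsub>?R\<^esub>) \<in> carrier ?C" if "j < n" for j
        using fi[OF that] unfolding memC by auto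
      then show "(\<lambda>j. \<lambda>i\<in>{..<n}. if i = j then f a j else \<zero>\<^bsub>?R\<^esub>) \<in> {..<n} \<rightarrow> carrier ?C" by blast
      show "rsmult ?C (e j) (f a j) = (\<lambda>i\<in>{..<n}. if i = j then f a j else \<zero>\<^bsub>?R\<^esub>)" if "j \<in> {..<n}" for j
        using fi that by (auto simp: e_def fun_eq_iff)
    qed
    also have "\<dots> = f a"
      unfolding sumC using fC[OF a] by (intro copower_decompose[OF R', symmetric]) auto
    also have "p (f a) = f a" by (rule pu[OF fU[OF a]])
    finally have "f (\<Oplus>\<^bsub>A\<^esub>j\<in>{..<n}. c j \<otimes>\<^bsub>A\<^esub> \<iota> (f a j)) = f a" .
    then show "a = (\<Oplus>\<^bsub>A\<^esub>j\<in>{..<n}. c j \<otimes>\<^bsub>A\<^esub> \<iota> (f a j))"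
      by (intro f_inj[symmetric] a A.finsum_closed) (auto simp: ca)
  qed (rule c)
  then show thesis by (rule that)
qed

section \<open>Inducing resolutions and coresolutions\<close>

context central_basis
begin

text \<open>The tensor product lies in add(S), so it embeds into the prescribed type and is copied
  there. Module and structure maps are packed into one tuple, so that a single use of
  \<open>choice\<close> selects them in all degrees.\<close>

lemma induced_in_type:
  fixes S :: "('a, 's, 'i) module_scheme" and h :: "'z \<Rightarrow> nat"
  assumes "in_add R T M" and T: "induced R A \<iota> n \<alpha> c T S \<eta>T \<rho>T" and "surj h"
  shows "\<exists>t. induced R A \<iota> n \<alpha> c M (fst t :: ('a, 'z \<Rightarrow> 's) module) (fst (snd t)) (snd (snd t))"
proof -
  interpret T: induced R A \<iota> n \<alpha> c T S \<eta>T \<rho>T by fact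
  have M: "left_module R M" using assms(1) by (simp add: in_add_def)
  let ?N = "induced_module R A \<iota> M"
  obtain \<eta> \<rho> where N: "induced R A \<iota> n \<alpha> c M ?N \<eta> \<rho>" by (rule induced_induced_module[OF M])
  interpret N: induced R A \<iota> n \<alpha> c M ?N \<eta> \<rho> by fact
  obtain k :: "_ \<Rightarrow> 'z \<Rightarrow> 's" where k: "inj_on k (carrier ?N)"
    by (rule in_add_embedding[OF in_add_induced[OF assms(1) N T] T.N.left_module_axioms \<open>surj h\<close>])
  note iso = image_module_iso[OF N.N.left_module_axioms k]
  have "induced R A \<iota> n \<alpha> c M (image_module k ?N) (compose (carrier M) (restrict k (carrier ?N)) \<eta>)
    (\<lambda>i. compose (carrier (image_module k ?N)) (\<rho> i)
      (restrict (inv_into (carrier ?N) k) (carrier (image_module k ?N))))"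
    by (rule N.induced_iso[OF iso(1-3)]) (use k in \<open>auto simp: iso(4)\<close>)
  then show ?thesis by (intro exI[of _ "(_, _, _)"]) simp
qed

text \<open>Finitely generated projective R-modules form add(R), so the induced terms lie in add(A);
  this makes them finitely generated projective and small enough for the resolution type. Vanishing
  of cohomology is transferred degree by degree.\<close>

lemma induced_resolution:
  fixes S :: "('a, 's, 'i) module_scheme"
  assumes T: "induced R A \<iota> n \<alpha> c T S \<eta>T \<rho>T"
    and res: "projective_resolution R P d e T" and fg: "\<And>i. fin_generated R (P i)"
  obtains Q :: "nat \<Rightarrow> ('a, ('a, 's) resolution_type) module" and d' e' where
    "projective_resolution A Q d' e' S" "\<And>i. fin_generated A (Q i)"
    "\<And>i. ext_cocycles R P d T (Suc i) = ext_coboundaries R P d T (Suc i) \<Longrightarrow>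
      ext_cocycles A Q d' S (Suc i) = ext_coboundaries A Q d' S (Suc i)"
proof -
  interpret T: induced R A \<iota> n \<alpha> c T S \<eta>T \<rho>T by fact
  have add: "in_add R (regular R) (P i)" for i
    using res fg by (intro in_add_regular_if_fg_projective) (auto simp: projective_resolution_def)
  \<comment> \<open>Lists matter only through their length: every natural number is the length of a
    list, so functions on lists have room for any finite number of coordinates in A.\<close>
  have "surj (length :: ('a + 's) list \<Rightarrow> nat)" by (rule surjI[of _ "\<lambda>k. replicate k undefined"]) simp
  from induced_in_type[OF add induced_regular this] obtain t where
    t: "\<forall>i. induced R A \<iota> n \<alpha> c (P i) (fst (t i) :: ('a, ('a + 's) list \<Rightarrow> 'a) module) (fst (snd (t i))) (snd (snd (t i)))"
    using choice[of "\<lambda>i t. induced R A \<iota> n \<alpha> c (P i) (fst t) (fst (snd t)) (snd (snd t))"] by blast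
  define Q where "Q = (\<lambda>i. fst (t i))"
  define \<eta> where "\<eta> = (\<lambda>i. fst (snd (t i)))"
  define \<rho> where "\<rho> = (\<lambda>i. snd (snd (t i)))"
  have Q: "induced R A \<iota> n \<alpha> c (P i) (Q i) (\<eta> i) (\<rho> i)" for i
    using t by (simp add: Q_def \<eta>_def \<rho>_def)
  note dh = resolution_hom[OF res]
  define D where "D = (\<lambda>i. induced.extend n c (Q (Suc i)) (\<rho> (Suc i)) (Q i) (compose (carrier (P (Suc i))) (\<eta> i) (d i)))"
  define E where "E = induced.extend n c (Q 0) (\<rho> 0) S (compose (carrier (P 0)) \<eta>T e)"
  have D: "induced_hom R A \<iota> n \<alpha> c (P (Suc i)) (Q (Suc i)) (\<eta> (Suc i)) (\<rho> (Suc i)) (P i) (Q i) (\<eta> i) (\<rho> i) (d i) (D i)" for i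
    unfolding D_def by (rule induced.induced_map[OF Q Q dh(1)])
  have E: "induced_hom R A \<iota> n \<alpha> c (P 0) (Q 0) (\<eta> 0) (\<rho> 0) T S \<eta>T \<rho>T e E"
    unfolding E_def by (rule induced.induced_map[OF Q T dh(2)])
  have addQ: "in_add A (regular A) (Q i)" for i by (rule in_add_induced[OF add Q induced_regular])
  have resQ: "projective_resolution A Q D E S"
    unfolding projective_resolution_def
  proof (intro conjI allI)
    show "projective A (Q i)" for i by (rule projective_if_in_add_regular[OF addQ])
    show "D i \<in> left_hom A (Q (Suc i)) (Q i)" for i by (rule induced_hom.g_hom[OF D])
    show "E \<in> left_hom A (Q 0) S" by (rule induced_hom.g_hom[OF E])
    show "E ` carrier (Q 0) = carrier S"
      using res by (intro induced_hom.image_induced[OF E]) (simp add: projective_resolution_def)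
    show "a_kernel (Q 0) S E = D 0 ` carrier (Q 1)"
      using induced_exact[OF D E resolution_kernel(2)[OF res]] by simp
    show "a_kernel (Q (Suc i)) (Q i) (D i) = D (Suc i) ` carrier (Q (Suc (Suc i)))" for i
      by (rule induced_exact[OF D D resolution_kernel(1)[OF res]])
  qed
  show thesis
  proof
    show "projective_resolution A Q D E S" by (rule resQ)
    show "fin_generated A (Q i)" for i by (rule fin_generated_if_in_add_regular[OF addQ])
    show "ext_cocycles A Q D S (Suc i) = ext_coboundaries A Q D S (Suc i)"
      if van: "ext_cocycles R P d T (Suc i) = ext_coboundaries R P d T (Suc i)" for i
      \<comment> \<open>In a successor degree, equality of cocycles and coboundaries is exactness of
        Hom at the middle of three consecutive terms, with \<open>d (Suc i)\<close> coming in and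
        \<open>d i\<close> going out.\<close>
      unfolding ext_cocycles_def ext_coboundaries.simps
    proof (rule induced_hom_exact[OF D D T])
      show "D i (D (Suc i) x) = \<zero>\<^bsub>Q i\<^esub>" if "x \<in> carrier (Q (Suc (Suc i)))" for x
        by (rule resolution_complex[OF resQ that])
    qed (use van in \<open>simp add: ext_cocycles_def\<close>)
  qed
qed

text \<open>The initial term R becomes A by \<open>induced_regular\<close>. The other terms lie in
  add(T), so their induced modules lie in add(S) and embed into sequences over S.\<close>

lemma induced_coresolution:
  fixes S :: "('a, 's, 'i) module_scheme"
  assumes T: "induced R A \<iota> n \<alpha> c T S \<eta>T \<rho>T"
    and cores: "add_coresolution R T C u d" and exact: "hom_exact R T C u d"
  obtains N :: "nat \<Rightarrow> ('a, nat \<Rightarrow> 's) module" and u' d' where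
    "add_coresolution A S N u' d'" "hom_exact A S N u' d'"
proof -
  interpret T: induced R A \<iota> n \<alpha> c T S \<eta>T \<rho>T by fact
  have add: "in_add R T (C i)" and uh: "u \<in> left_hom R (regular R) (C 0)"
    and dh: "d i \<in> left_hom R (C i) (C (Suc i))" and inj: "inj_on u (carrier (regular R))"
    and ker0: "a_kernel (C 0) (C (Suc 0)) (d 0) = u ` carrier (regular R)"
    and ker: "a_kernel (C (Suc i)) (C (Suc (Suc i))) (d (Suc i)) = d i ` carrier (C i)" for i
    using cores by (auto simp: add_coresolution_def)
  from induced_in_type[OF add T surj_id] obtain t where
    t: "\<forall>i. induced R A \<iota> n \<alpha> c (C i) (fst (t i) :: ('a, nat \<Rightarrow> 's) module) (fst (snd (t i))) (snd (snd (t i)))"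
    using choice[of "\<lambda>i t. induced R A \<iota> n \<alpha> c (C i) (fst t) (fst (snd t)) (snd (snd t))"] by blast
  define N where "N = (\<lambda>i. fst (t i))"
  define \<eta> where "\<eta> = (\<lambda>i. fst (snd (t i)))"
  define \<rho> where "\<rho> = (\<lambda>i. snd (snd (t i)))"
  have N: "induced R A \<iota> n \<alpha> c (C i) (N i) (\<eta> i) (\<rho> i)" for i
    using t by (simp add: N_def \<eta>_def \<rho>_def)
  define D where "D = (\<lambda>i. induced.extend n c (N i) (\<rho> i) (N (Suc i)) (compose (carrier (C i)) (\<eta> (Suc i)) (d i)))"
  define u' where "u' = induced.extend n c (regular A) (\<lambda>i. restrict (\<alpha> i) (carrier A)) (N 0)
    (compose (carrier (regular R)) (\<eta> 0) u)"
  have D: "induced_hom R A \<iota> n \<alpha> c (C i) (N i) (\<eta> i) (\<rho> i) (C (Suc i)) (N (Suc i)) (\<eta> (Suc i)) (\<rho> (Suc i)) (d i) (D i)" for i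
    unfolding D_def by (rule induced.induced_map[OF N N dh])
  have u': "induced_hom R A \<iota> n \<alpha> c (regular R) (regular A) (restrict \<iota> (carrier R)) (\<lambda>i. restrict (\<alpha> i) (carrier A))
      (C 0) (N 0) (\<eta> 0) (\<rho> 0) u u'"
    unfolding u'_def by (rule induced.induced_map[OF induced_regular N uh])
  have kerN0: "a_kernel (N 0) (N (Suc 0)) (D 0) = u' ` carrier (regular A)"
    by (rule induced_exact[OF u' D ker0])
  have kerN: "a_kernel (N (Suc i)) (N (Suc (Suc i))) (D (Suc i)) = D i ` carrier (N i)" for i
    by (rule induced_exact[OF D D ker])
  show thesis
  proof
    show "add_coresolution A S N u' D"
      unfolding add_coresolution_def
    proof (intro conjI allI)
      show "in_add A S (N i)" for i by (rule in_add_induced[OF add N T])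
      show "u' \<in> left_hom A (regular A) (N 0)" by (rule induced_hom.g_hom[OF u'])
      show "D i \<in> left_hom A (N i) (N (Suc i))" for i by (rule induced_hom.g_hom[OF D])
      show "inj_on u' (carrier A)" using induced_hom.inj_on_induced[OF u' inj] by simp
      show "a_kernel (N 0) (N 1) (D 0) = u' ` carrier A" using kerN0 by simp
      show "a_kernel (N (Suc i)) (N (Suc (Suc i))) (D (Suc i)) = D i ` carrier (N i)" for i by (rule kerN)
    qed
    have zero0: "D 0 (u' x) = \<zero>\<^bsub>N (Suc 0)\<^esub>" if "x \<in> carrier (regular A)" for x
      using imageI[OF that, of u'] unfolding kerN0[symmetric] mem_a_kernel by simp
    have zero: "D (Suc i) (D i x) = \<zero>\<^bsub>N (Suc (Suc i))\<^esub>" if "x \<in> carrier (N i)" for i x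
      using imageI[OF that, of "D i"] unfolding kerN[symmetric] mem_a_kernel by simp
    show "hom_exact A S N u' D"
      unfolding hom_exact_def
    proof (intro conjI allI)
      show "precomp (regular A) u' ` left_hom A (N 0) S = left_hom A (regular A) S"
        using exact by (intro induced_hom_surj[OF u' T]) (simp add: hom_exact_def)
      show "{f \<in> left_hom A (N 0) S. precomp (regular A) u' f = zero_hom (regular A) S} =
          precomp (N 0) (D 0) ` left_hom A (N 1) S"
        unfolding One_nat_def
        by (rule induced_hom_exact[OF u' D T], erule zero0) (use exact in \<open>simp_all add: hom_exact_def\<close>)
      show "{f \<in> left_hom A (N (Suc i)) S. precomp (N i) (D i) f = zero_hom (N i) S} =
          precomp (N (Suc i)) (D (Suc i)) ` left_hom A (N (Suc (Suc i))) S" for i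
        by (rule induced_hom_exact[OF D D T], erule zero) (use exact in \<open>simp_all add: hom_exact_def\<close>)
    qed
  qed
qed

end

theorem corollary2p4:
  fixes R :: "('r, 'e) ring_scheme" and A :: "('a, 'f) ring_scheme" and \<iota> :: "'r \<Rightarrow> 'a"
    and T :: "('r, 't, 'g) module_scheme"
  assumes "frobenius_extension R A \<iota>"
    and "centrally_projective R A \<iota>"
    and "wakamatsu_tilting R T"
  shows "wakamatsu_tilting A (induced_module R A \<iota> T)"
proof -
  let ?S = "induced_module R A \<iota> T"
  have "ring_extension R A \<iota>" using assms(1) by (simp add: frobenius_extension_def)
  then obtain n \<alpha> c where "central_basis R A \<iota> n \<alpha> c"
    by (rule centrally_projective_basis[OF _ assms(2)])
  then interpret central_basis R A \<iota> n \<alpha> c .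
  have T: "left_module R T" using assms(3) by (simp add: wakamatsu_tilting_def)
  obtain \<eta> \<rho> where S: "induced R A \<iota> n \<alpha> c T ?S \<eta> \<rho>" by (rule induced_induced_module[OF T])
  interpret S: induced R A \<iota> n \<alpha> c T ?S \<eta> \<rho> by fact
  note SS = S.N.left_module_axioms
  obtain P :: "nat \<Rightarrow> ('r, ('r, 't) resolution_type) module" and d e
    where P: "projective_resolution R P d e T" "\<And>i. fin_generated R (P i)"
    using assms(3) by (auto simp: wakamatsu_tilting_def has_fg_projective_resolution_def)
  obtain Q :: "nat \<Rightarrow> ('a, ('a, ('a \<times> 't \<Rightarrow>\<^sub>0 int) set) resolution_type) module" and d' e'
    where Q: "projective_resolution A Q d' e' ?S" "\<And>i. fin_generated A (Q i)"
      and van: "\<And>i. ext_cocycles R P d T (Suc i) = ext_coboundaries R P d T (Suc i) \<Longrightarrow>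
        ext_cocycles A Q d' ?S (Suc i) = ext_coboundaries A Q d' ?S (Suc i)"
    by (fact induced_resolution[OF S P])
  have "ext_vanishes A ?S ?S i" if "i > 0" for i
  proof -
    obtain k where i: "i = Suc k" using \<open>i > 0\<close> gr0_implies_Suc by blast
    have "ext_vanishes R T T i" using assms(3) \<open>i > 0\<close> by (simp add: wakamatsu_tilting_def)
    then have "ext_cocycles R P d T (Suc k) = ext_coboundaries R P d T (Suc k)"
      using P(1) unfolding ext_vanishes_def i by blast
    \<comment> \<open>So far Ext vanishes when computed from Q alone, while
      \<open>ext_vanishes\<close> concerns every resolution in the given type; each of them is
      compared with Q.\<close>
    from equalityD1[OF van[OF this]] show ?thesis
      unfolding ext_vanishes_def i by (intro allI impI ext_independent_of_resolution[OF _ Q(1) SS SS])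
  qed
  moreover have "has_fg_projective_resolution A ?S"
    using Q unfolding has_fg_projective_resolution_def by blast
  moreover obtain C :: "nat \<Rightarrow> ('r, nat \<Rightarrow> 't) module" and u w
    where C: "add_coresolution R T C u w" "hom_exact R T C u w"
    using assms(3) by (auto simp: wakamatsu_tilting_def)
  obtain N :: "nat \<Rightarrow> ('a, nat \<Rightarrow> ('a \<times> 't \<Rightarrow>\<^sub>0 int) set) module" and u' w'
    where "add_coresolution A ?S N u' w'" "hom_exact A ?S N u' w'"
    by (fact induced_coresolution[OF S C])
  ultimately show ?thesis
    unfolding wakamatsu_tilting_def using SS by blast
qed

end
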